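(* Let $Z\in2^\omega$ be $\Pi^1_1$-ML-random. The following are equivalent: (i) $\varrho(\mathcal C\mid Z)=1$ for each $\Sigma^1_1$ class $\mathcal C\subseteq 2^\omega$ containing $Z$; (ii) $\varrho(\mathcal C\mid Z)=1$ for each closed $\Sigma^1_1$ class $\mathcal C\subseteq2^\omega$ containing $Z$; (iii) each left-$\Pi^1_1$ martingale converges on $Z$ to a finite value.
   Context: $\lambda$ is the uniform measure on $2^\omega$, $[\sigma]$ the cone of extensions of a string $\sigma$. For $\mathcal C\subseteq2^\omega$, $\varrho(\mathcal C\mid Z)=\liminf_{n}\frac{\lambda(\mathcal C\cap[Z\upharpoonright n])}{2^{-n}}$. $Z$ is $\Pi^1_1$-ML-random if $Z\notin\bigcap_nU_n$ for every uniformly $\Pi^1_1$ sequence of open sets $U_n=[W_n]$ ($W_n\subseteq2^{<\omega}$ uniformly $\Pi^1_1$) with $\lambda(U_n)\le2^{-n}$. A real $r$ is left-$\Pi^1_1$ if $\{q\in\mathbb Q:q<r\}$ is $\Pi^1_1$. A martingale $M:2^{<\omega}\to\mathbb R_{\ge0}$ (with $M(\sigma)=(M(\sigma0)+M(\sigma1))/2$) is left-$\Pi^1_1$ if $M(\sigma)$ is left-$\Pi^1_1$ uniformly in $\sigma$. $M$ converges on $Z$ to a finite value if $\lim_nM(Z\upharpoonright n)$ exists in $\mathbb R$. *)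

theory Defs
  imports "HOL-Probability.Probability" "HOL-Library.Nat_Bijection"
begin

section \<open>Lightface \<open>\<Pi>\<^sup>1\<^sub>1\<close> and \<open>\<Sigma>\<^sup>1\<^sub>1\<close>\<close>

text \<open>
  Subsets of the natural numbers are predicates \<^typ>\<open>nat \<Rightarrow> bool\<close>; this type is also the Cantor space.
  Arithmetical formulas are the formulas of second-order arithmetic in which only number variables
  are quantified. Set variables may occur free.
\<close>

datatype arith_term =
    Var nat
  | Zero
  | Succ arith_term
  | Plus arith_term arith_term
  | Times arith_term arith_term

datatype arith_fm =
    Eq arith_term arith_term
  | Less arith_term arith_term
  | Mem arith_term nat  \<comment> \<open>the second argument is the index of a set variable\<close>
  | Neg arith_fm
  | Conj arith_fm arith_fm
  | All nat arith_fm    \<comment> \<open>binds the number variable with the given index\<close>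

primrec term_val :: "(nat \<Rightarrow> nat) \<Rightarrow> arith_term \<Rightarrow> nat" where
  "term_val e (Var i) = e i"
| "term_val e Zero = 0"
| "term_val e (Succ t) = Suc (term_val e t)"
| "term_val e (Plus s t) = term_val e s + term_val e t"
| "term_val e (Times s t) = term_val e s * term_val e t"

primrec holds :: "(nat \<Rightarrow> (nat \<Rightarrow> bool)) \<Rightarrow> (nat \<Rightarrow> nat) \<Rightarrow> arith_fm \<Rightarrow> bool" where
  "holds S e (Eq s t) \<longleftrightarrow> term_val e s = term_val e t"
| "holds S e (Less s t) \<longleftrightarrow> term_val e s < term_val e t"
| "holds S e (Mem t i) \<longleftrightarrow> S i (term_val e t)"
| "holds S e (Neg \<phi>) \<longleftrightarrow> \<not> holds S e \<phi>"
| "holds S e (Conj \<phi> \<psi>) \<longleftrightarrow> holds S e \<phi> \<and> holds S e \<psi>"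
| "holds S e (All x \<phi>) \<longleftrightarrow> (\<forall>n. holds S (e(x := n)) \<phi>)"

text \<open>
  There are no parameters: number and set variables other than those displayed below are
  interpreted as \<open>0\<close> and the empty set. The number argument is number variable \<open>0\<close>, the set argument
  of a class is set variable \<open>0\<close>. As the matrix is arithmetical, quantifying over sets or over
  functions from numbers to numbers makes no difference.
\<close>

definition Pi11_set :: "nat set \<Rightarrow> bool" where
  "Pi11_set A \<longleftrightarrow>
     (\<exists>\<phi>. \<forall>n. n \<in> A \<longleftrightarrow>
        (\<forall>Y. holds ((\<lambda>_ _. False)(0 := Y)) ((\<lambda>_. 0)(0 := n)) \<phi>))"

definition Sigma11_class :: "(nat \<Rightarrow> bool) set \<Rightarrow> bool" where
  "Sigma11_class C \<longleftrightarrow>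
     (\<exists>\<phi>. \<forall>Z. Z \<in> C \<longleftrightarrow>
        (\<exists>Y. holds ((\<lambda>_ _. False)(0 := Z, 1 := Y)) (\<lambda>_. 0) \<phi>))"

definition string_code :: "bool list \<Rightarrow> nat" where
  "string_code \<sigma> = list_encode (map of_bool \<sigma>)"

definition rat_code :: "rat \<Rightarrow> nat" where
  "rat_code q = (case quotient_of q of (a, b) \<Rightarrow> prod_encode (int_encode a, nat b))"

definition uniformly_Pi11 :: "(nat \<Rightarrow> bool list set) \<Rightarrow> bool" where
  "uniformly_Pi11 W \<longleftrightarrow> Pi11_set {prod_encode (n, string_code \<sigma>) |n \<sigma>. \<sigma> \<in> W n}"


section \<open>Cantor space and density\<close>

text \<open>
  The uniform measure is completed because \<open>\<Sigma>\<^sup>1\<^sub>1\<close> classes need not be Borel, and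
  \<^const>\<open>measure\<close> would give a non-measurable set the value \<open>0\<close>.
\<close>

definition cantor_measure :: "(nat \<Rightarrow> bool) measure" where
  "cantor_measure = completion (\<Pi>\<^sub>M i\<in>UNIV. measure_pmf (bernoulli_pmf (1/2)))"

definition restr :: "(nat \<Rightarrow> bool) \<Rightarrow> nat \<Rightarrow> bool list" where
  "restr Z n = map Z [0..<n]"

definition cone :: "bool list \<Rightarrow> (nat \<Rightarrow> bool) set" where
  "cone \<sigma> = {X. restr X (length \<sigma>) = \<sigma>}"

definition lower_density :: "(nat \<Rightarrow> bool) set \<Rightarrow> (nat \<Rightarrow> bool) \<Rightarrow> ereal" where
  "lower_density C Z =
     liminf (\<lambda>n. ereal (measure cantor_measure (C \<inter> cone (restr Z n)) / (1/2) ^ n))"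


section \<open>Randomness and martingales\<close>

definition Pi11_Martin_Loef_random :: "(nat \<Rightarrow> bool) \<Rightarrow> bool" where
  "Pi11_Martin_Loef_random Z \<longleftrightarrow>
     (\<forall>W. uniformly_Pi11 W \<and> (\<forall>n. measure cantor_measure (\<Union>\<sigma>\<in>W n. cone \<sigma>) \<le> (1/2) ^ n)
        \<longrightarrow> Z \<notin> (\<Inter>n. \<Union>\<sigma>\<in>W n. cone \<sigma>))"

definition is_martingale :: "(bool list \<Rightarrow> real) \<Rightarrow> bool" where
  "is_martingale M \<longleftrightarrow>
     (\<forall>\<sigma>. 0 \<le> M \<sigma> \<and> M \<sigma> = (M (\<sigma> @ [False]) + M (\<sigma> @ [True])) / 2)"

definition left_Pi11 :: "(bool list \<Rightarrow> real) \<Rightarrow> bool" where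
  "left_Pi11 M \<longleftrightarrow>
     Pi11_set {prod_encode (string_code \<sigma>, rat_code q) |\<sigma> q. of_rat q < M \<sigma>}"

end

theory Submission
  imports Defs "HOL-Number_Theory.Cong"
begin

text \<open>
  Every \<open>\<Sigma>\<^sup>1\<^sub>1\<close> class \<open>C\<close> is \<open>{X. \<exists>V. \<forall>a. \<exists>c. Q X V a c}\<close> with \<open>Q\<close> arithmetical and clopen. Bounding
  the witnesses \<open>c\<close> by finite lists gives a tree of clopen approximations of \<open>C\<close> of measure at least
  \<open>r\<close>. An infinite path yields a closed subset of \<open>C\<close> of measure at least \<open>r\<close>; if the tree is
  well-founded, recursion along it yields an open cover of \<open>C\<close> of measure arbitrarily close to \<open>r\<close>. The
  cover is the only solution of an arithmetical recursion and hence uniformly \<open>\<Pi>\<^sup>1\<^sub>1\<close>. In particular \<open>C\<close>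
  is measurable, and \<open>1\<close> minus its conditional measure is a left-\<open>\<Pi>\<^sup>1\<^sub>1\<close> martingale.

  Where the density of \<open>C\<close> in \<open>[\<tau>]\<close> is less than \<open>1\<close>, the cover splits into a clopen part, missing a fixed
  fraction of \<open>[\<tau>]\<close>, and a remainder of measure at most \<open>4\<close> to the power \<open>- |\<tau>|\<close>. The remainders form
  a Solovay test, so a random \<open>Z \<in> C\<close> is in almost all the clopen parts that apply to it.

  (ii) implies (i): removing from Cantor space what the clopen parts miss leaves a closed \<open>\<Sigma>\<^sup>1\<^sub>1\<close>
  class that contains \<open>Z\<close> and has holes wherever the density of \<open>C\<close> is low. (iii) implies (i): if the
  density of the complement of \<open>C\<close> had a positive limit along \<open>Z\<close>, iterating the clopen parts would give
  a Martin-Loef test capturing \<open>Z\<close>. (i) implies (iii): a left-\<open>\<Pi>\<^sup>1\<^sub>1\<close> martingale \<open>M\<close> has a bound \<open>B\<close>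
  along \<open>Z\<close>. If \<open>M \<le> q\<close> infinitely often along \<open>Z\<close>, then \<open>Z\<close> is in the \<open>\<Sigma>\<^sup>1\<^sub>1\<close> class of all \<open>X\<close> with these
  two properties, and optional stopping bounds \<open>M\<close> by \<open>q\<close> plus \<open>2 B\<close> times the codensity of that class.
\<close>

section \<open>Arithmetical relations\<close>

text \<open>Every set that enters a test needs a parameter-free definition of the right complexity.
  This dictates two habits. Cut-off indices and levels are always least ones: an equation with
  several solutions could not be evaluated by quantifying over all of them. And measures never occur
  in formulas as reals, only as numbers of strings, compared after clearing denominators.

  For a left-\<open>Pi11\<close> martingale, \<open>q < M \<sigma>\<close> is \<open>Pi11\<close>
  but \<open>M \<sigma> \<le> q\<close> is only \<open>Sigma11\<close>. A test can therefore see
  \<open>M\<close> rise but not fall, so counting upcrossings gives no test. The falls are collected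
  in a class instead, and density replaces the upcrossing argument. The same asymmetry makes the
  density of the complement of \<open>C\<close> the left-\<open>Pi11\<close> one: well-foundedness
  of the tree certifies upper bounds on the measure of \<open>C\<close>.

  The power of \<open>4\<close> in the bound on remainders pays for the \<open>2 ^ n\<close> strings
  \<open>\<tau>\<close> of length \<open>n\<close> and leaves the summable total
  \<open>2 ^ -n\<close>.\<close>

type_synonym senv = "nat \<Rightarrow> nat \<Rightarrow> bool"
type_synonym nenv = "nat \<Rightarrow> nat"

definition arith :: "(senv \<Rightarrow> nenv \<Rightarrow> bool) \<Rightarrow> bool" where
  "arith P \<longleftrightarrow> (\<exists>\<phi>. \<forall>S e. P S e \<longleftrightarrow> holds S e \<phi>)"

text \<open>
  The graph is stated in de Bruijn style: variable \<open>0\<close> holds the value and the arguments of \<open>f\<close>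
  are shifted up by one. All closure rules for quantifiers use the same convention.
\<close>

definition arithF :: "(senv \<Rightarrow> nenv \<Rightarrow> nat) \<Rightarrow> bool" where
  "arithF f \<longleftrightarrow> arith (\<lambda>S e. f S (\<lambda>i. e (Suc i)) = e 0)"

named_theorems arI

lemma arith_holds: "arith (\<lambda>S e. holds S e \<phi>)"
  unfolding arith_def by blast

lemma arith_not [arI]: "arith P \<Longrightarrow> arith (\<lambda>S e. \<not> P S e)"
  unfolding arith_def by (metis holds.simps(4))

lemma arith_conj [arI]: "arith P \<Longrightarrow> arith Q \<Longrightarrow> arith (\<lambda>S e. P S e \<and> Q S e)"
  unfolding arith_def by (metis holds.simps(5))

lemma arith_disj [arI]:
  assumes "arith P" "arith Q" shows "arith (\<lambda>S e. P S e \<or> Q S e)"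
  using arith_not[OF arith_conj[OF arith_not[OF assms(1)] arith_not[OF assms(2)]]] by simp

lemma arith_imp [arI]:
  assumes "arith P" "arith Q" shows "arith (\<lambda>S e. P S e \<longrightarrow> Q S e)"
  using arith_disj[OF arith_not[OF assms(1)] assms(2)]
  unfolding imp_conv_disj .

lemma arith_if [arI]:
  assumes "arith P" "arith Q" "arith R" shows "arith (\<lambda>S e. if P S e then Q S e else R S e)"
  using arith_disj[OF arith_conj[OF assms(1,2)] arith_conj[OF arith_not[OF assms(1)] assms(3)]]
  by (rule back_subst[of arith]) (intro ext, simp)

lemma arith_iff [arI]:
  assumes "arith P" "arith Q" shows "arith (\<lambda>S e. P S e \<longleftrightarrow> Q S e)"
  using arith_if[OF assms(1,2) arith_not[OF assms(2)]]
  by (rule back_subst[of arith]) (intro ext, simp)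

section \<open>Renaming, fresh variables and substitution\<close>

lemma term_rename: "\<exists>t'. \<forall>e. term_val e t' = term_val (\<lambda>i. e (r i)) t"
proof (induction t)
  case (Var i) show ?case by (rule exI[of _ "arith_term.Var (r i)"]) simp
next
  case Zero show ?case by (rule exI[of _ "arith_term.Zero"]) simp
next
  case (Succ t) then show ?case by (metis term_val.simps(3))
next
  case (Plus s t) then show ?case by (metis term_val.simps(4))
next
  case (Times s t) then show ?case by (metis term_val.simps(5))
qed

text \<open>Injectivity is what carries the renaming under a binder: no other variable is sent to
  \<open>r x\<close>, so binding \<open>r x\<close> affects the image of \<open>x\<close>
  alone.\<close>

lemma holds_rename:
  assumes "inj r"
  shows "\<exists>\<psi>. \<forall>S e. holds S e \<psi> = holds S (\<lambda>i. e (r i)) \<phi>"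
proof (induction \<phi>)
  case (Eq s t)
  show ?case using term_rename[of r s] term_rename[of r t] by (metis holds.simps(1))
next
  case (Less s t)
  show ?case using term_rename[of r s] term_rename[of r t] by (metis holds.simps(2))
next
  case (Mem t i)
  show ?case using term_rename[of r t] by (metis holds.simps(3))
next
  case (Neg \<phi>) then show ?case by (metis holds.simps(4))
next
  case (Conj \<phi>1 \<phi>2) then show ?case by (metis holds.simps(5))
next
  case (All x \<phi>)
  then obtain \<psi> where \<psi>: "\<And>S e. holds S e \<psi> = holds S (\<lambda>i. e (r i)) \<phi>" by blast
  have "(\<lambda>i. (e(r x := n)) (r i)) = (\<lambda>i. e (r i))(x := n)" for e :: nenv and n
    using assms by (auto simp: fun_eq_iff inj_eq)
  then have "holds S e (arith_fm.All (r x) \<psi>) = holds S (\<lambda>i. e (r i)) (arith_fm.All x \<phi>)" for S e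
    by (simp add: \<psi>)
  then show ?case by blast
qed

definition agree :: "nat \<Rightarrow> nenv \<Rightarrow> nenv \<Rightarrow> bool" where
  "agree k e e' \<longleftrightarrow> (\<forall>i<k. e i = e' i)"

lemma agree_mono: "agree k e e' \<Longrightarrow> l \<le> k \<Longrightarrow> agree l e e'"
  unfolding agree_def by auto

lemma agree_max: "agree (max k l) e e' \<Longrightarrow> agree k e e'" "agree (max k l) e e' \<Longrightarrow> agree l e e'"
  by (erule agree_mono, simp)+

lemma term_val_support: "\<exists>k. \<forall>e e'. agree k e e' \<longrightarrow> term_val e t = term_val e' t"
proof (induction t)
  case (Var i) show ?case by (rule exI[of _ "Suc i"]) (simp add: agree_def)
next
  case (Plus s t)
  from Plus.IH(1) obtain k where k: "\<forall>e e'. agree k e e' \<longrightarrow> term_val e s = term_val e' s" ..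
  from Plus.IH(2) obtain l where l: "\<forall>e e'. agree l e e' \<longrightarrow> term_val e t = term_val e' t" ..
  show ?case
  proof (intro exI[of _ "max k l"] allI impI)
    fix e e' assume *: "agree (max k l) e e'"
    show "term_val e (Plus s t) = term_val e' (Plus s t)"
      using k[rule_format, OF agree_max(1)[OF *]] l[rule_format, OF agree_max(2)[OF *]] by simp
  qed
next
  case (Times s t)
  from Times.IH(1) obtain k where k: "\<forall>e e'. agree k e e' \<longrightarrow> term_val e s = term_val e' s" ..
  from Times.IH(2) obtain l where l: "\<forall>e e'. agree l e e' \<longrightarrow> term_val e t = term_val e' t" ..
  show ?case
  proof (intro exI[of _ "max k l"] allI impI)
    fix e e' assume *: "agree (max k l) e e'"
    show "term_val e (Times s t) = term_val e' (Times s t)"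
      using k[rule_format, OF agree_max(1)[OF *]] l[rule_format, OF agree_max(2)[OF *]] by simp
  qed
next
  case (Succ t) then show ?case by simp
next
  case Zero then show ?case by simp
qed

lemma term_val_support2:
  "\<exists>k. \<forall>e e'. agree k e e' \<longrightarrow> term_val e s = term_val e' s \<and> term_val e t = term_val e' t"
proof -
  from term_val_support[of s] obtain k where k: "\<forall>e e'. agree k e e' \<longrightarrow> term_val e s = term_val e' s" ..
  from term_val_support[of t] obtain l where l: "\<forall>e e'. agree l e e' \<longrightarrow> term_val e t = term_val e' t" ..
  show ?thesis
  proof (intro exI[of _ "max k l"] allI impI)
    fix e e' assume *: "agree (max k l) e e'"
    show "term_val e s = term_val e' s \<and> term_val e t = term_val e' t"
      using k[rule_format, OF agree_max(1)[OF *]] l[rule_format, OF agree_max(2)[OF *]] by simp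
  qed
qed

text \<open>Formulas have named variables. A bound on the relevant ones supplies the fresh variable
  with which the de Bruijn style rules for quantifiers are realized.\<close>

lemma holds_support: "\<exists>k. \<forall>S e e'. agree k e e' \<longrightarrow> holds S e \<phi> = holds S e' \<phi>"
proof (induction \<phi>)
  case (Eq s t)
  from term_val_support2[of s t] obtain k where
    k: "\<forall>e e'. agree k e e' \<longrightarrow> term_val e s = term_val e' s \<and> term_val e t = term_val e' t" ..
  show ?case
  proof (intro exI[of _ k] allI impI)
    fix S e e' assume "agree k e e'"
    from k[rule_format, OF this] show "holds S e (Eq s t) = holds S e' (Eq s t)" by simp
  qed
next
  case (Less s t)
  from term_val_support2[of s t] obtain k where
    k: "\<forall>e e'. agree k e e' \<longrightarrow> term_val e s = term_val e' s \<and> term_val e t = term_val e' t" ..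
  show ?case
  proof (intro exI[of _ k] allI impI)
    fix S e e' assume "agree k e e'"
    from k[rule_format, OF this] show "holds S e (Less s t) = holds S e' (Less s t)" by simp
  qed
next
  case (Mem t i)
  from term_val_support[of t] obtain k where
    k: "\<forall>e e'. agree k e e' \<longrightarrow> term_val e t = term_val e' t" ..
  show ?case
  proof (intro exI[of _ k] allI impI)
    fix S e e' assume "agree k e e'"
    from k[rule_format, OF this] show "holds S e (Mem t i) = holds S e' (Mem t i)" by simp
  qed
next
  case (Neg \<phi>) then show ?case by simp
next
  case (Conj \<phi>1 \<phi>2)
  from Conj.IH(1) obtain k where k: "\<forall>S e e'. agree k e e' \<longrightarrow> holds S e \<phi>1 = holds S e' \<phi>1" ..
  from Conj.IH(2) obtain l where l: "\<forall>S e e'. agree l e e' \<longrightarrow> holds S e \<phi>2 = holds S e' \<phi>2" ..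
  show ?case
  proof (intro exI[of _ "max k l"] allI impI)
    fix S e e' assume *: "agree (max k l) e e'"
    show "holds S e (Conj \<phi>1 \<phi>2) = holds S e' (Conj \<phi>1 \<phi>2)"
      using k[rule_format, OF agree_max(1)[OF *]] l[rule_format, OF agree_max(2)[OF *]] by simp
  qed
next
  case (All x \<phi>)
  then obtain k where k: "\<forall>S e e'. agree k e e' \<longrightarrow> holds S e \<phi> = holds S e' \<phi>" ..
  show ?case
  proof (intro exI[of _ k] allI impI)
    fix S e e' assume *: "agree k e e'"
    have "holds S (e(x := n)) \<phi> = holds S (e'(x := n)) \<phi>" for n
      by (rule k[rule_format]) (use * in \<open>auto simp: agree_def\<close>)
    then show "holds S e (arith_fm.All x \<phi>) = holds S e' (arith_fm.All x \<phi>)" by simp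
  qed
qed

lemma arith_rename:
  assumes "arith P" "inj r"
  shows "arith (\<lambda>S e. P S (\<lambda>i. e (r i)))"
  using assms holds_rename[OF assms(2)] unfolding arith_def by metis

lemma arith_all [arI]:
  assumes "arith (\<lambda>S e. P S (\<lambda>i. e (Suc i)) (e 0))"
  shows "arith (\<lambda>S e. \<forall>n::nat. P S e n)"
proof -
  obtain \<phi> where \<phi>: "\<And>S e. P S (\<lambda>i. e (Suc i)) (e 0) = holds S e \<phi>"
    using assms unfolding arith_def by blast
  from holds_support[of \<phi>] obtain k where
    k: "\<forall>S e e'. agree k e e' \<longrightarrow> holds S e \<phi> = holds S e' \<phi>" ..
  \<comment> \<open>The cycle that undoes the shift: variables \<open>1, ..., k\<close> move down by
    one, and the quantified variable \<open>0\<close> goes to \<open>k\<close>. Overwriting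
    \<open>e k\<close> is harmless, since \<open>P\<close> would read it as variable
    \<open>k + 1\<close> of \<open>\<phi>\<close>, which is beyond the support.\<close>
  define r where "r i = (if i = 0 then k else if i \<le> k then i - 1 else i)" for i
  have "inj r" unfolding inj_def r_def by auto
  then obtain \<psi> where \<psi>: "\<And>S e. holds S e \<psi> = holds S (\<lambda>i. e (r i)) \<phi>"
    using holds_rename by metis
  have "holds S (e(k := n)) \<psi> = P S e n" for S e n
  proof -
    have "holds S (e(k := n)) \<psi> = holds S (case_nat n e) \<phi>"
      unfolding \<psi> by (rule k[rule_format]) (auto simp: agree_def r_def split: nat.split)
    also have "\<dots> = P S e n" using \<phi>[of S "case_nat n e"] by simp
    finally show ?thesis .
  qed
  then have "\<forall>S e. (\<forall>n. P S e n) = holds S e (arith_fm.All k \<psi>)" by simp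
  then show ?thesis unfolding arith_def by blast
qed

lemma arith_ex [arI]:
  assumes "arith (\<lambda>S e. P S (\<lambda>i. e (Suc i)) (e 0))"
  shows "arith (\<lambda>S e. \<exists>n::nat. P S e n)"
  using arith_not[OF arith_all[OF arith_not[OF assms]]] by simp

lemma arith_of_term: "arith (\<lambda>S e. term_val e s = term_val e t)"
  "arith (\<lambda>S e. term_val e s < term_val e t)" "arith (\<lambda>S e. S k (term_val e t))"
  unfolding arith_def
  using holds.simps(1)[of _ _ s t] holds.simps(2)[of _ _ s t] holds.simps(3)[of _ _ t k] by metis+

lemma arith_var_eq: "arith (\<lambda>S e. e i = e j)"
  using arith_of_term(1)[of "arith_term.Var i" "arith_term.Var j"] by simp

lemma arithF_var [arI]: "arithF (\<lambda>S e. e k)"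
  unfolding arithF_def by (rule arith_var_eq)

lemma arithF_shift:
  assumes "arithF f" shows "arithF (\<lambda>S e. f S (\<lambda>i. e (Suc i)))"
proof -
  have "inj (case_nat 0 (\<lambda>i. Suc (Suc i)))" by (auto simp: inj_def split: nat.splits)
  from arith_rename[OF assms[unfolded arithF_def] this] show ?thesis by (simp add: arithF_def)
qed

lemma arith_shift:
  assumes "arith P" shows "arith (\<lambda>S e. P S (\<lambda>i. e (Suc i)))"
  using arith_rename[OF assms, of Suc] by simp

lemma arith_bin:
  assumes "arith (\<lambda>S e. R (e 1) (e 0))" "arithF f" "arithF g"
  shows "arith (\<lambda>S e. R (f S e) (g S e))"
proof -
  have "arith (\<lambda>S e. \<exists>a. f S e = a \<and> (\<exists>b. g S e = b \<and> R a b))"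
    using assms(1,2) arithF_shift[OF assms(3)]
    by (intro arith_ex arith_conj) (simp_all add: arithF_def)
  then show ?thesis by simp
qed

lemma arith_eq [arI]: "arithF f \<Longrightarrow> arithF g \<Longrightarrow> arith (\<lambda>S e. f S e = g S e)"
  by (rule arith_bin[of "(=)"]) (simp add: arith_var_eq)

lemma arith_less [arI]: "arithF f \<Longrightarrow> arithF g \<Longrightarrow> arith (\<lambda>S e. f S e < g S e)"
  by (rule arith_bin[of "(<)"])
    (use arith_of_term(2)[of "arith_term.Var 1" "arith_term.Var 0"] in simp)

lemma arith_le [arI]:
  assumes "arithF f" "arithF g" shows "arith (\<lambda>S e. f S e \<le> g S e)"
  using arith_not[OF arith_less[OF assms(2,1)]] by (simp add: not_less)

lemma arith_mem [arI]:
  assumes "arithF f" shows "arith (\<lambda>S e. S k (f S e))"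
proof -
  have "arith (\<lambda>S e. \<exists>a. f S e = a \<and> S k a)"
    using assms arith_of_term(3)[of k "arith_term.Var 0"]
    by (intro arith_ex arith_conj) (simp_all add: arithF_def)
  then show ?thesis by simp
qed

lemma arithF_bin:
  assumes "arith (\<lambda>S e. h (e 1) (e 0) = e 2)" "arithF f" "arithF g"
  shows "arithF (\<lambda>S e. h (f S e) (g S e))"
proof -
  have "arith (\<lambda>S e. \<exists>a. f S (\<lambda>i. e (Suc i)) = a \<and> (\<exists>b. g S (\<lambda>i. e (Suc i)) = b \<and> h a b = e 0))"
    using assms(1) arithF_shift[OF assms(2)] arithF_shift[OF arithF_shift[OF assms(3)]]
    by (intro arith_ex arith_conj) (simp_all add: arithF_def numeral_2_eq_2)
  then show ?thesis by (simp add: arithF_def)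
qed

lemma arithF_un:
  assumes "arith (\<lambda>S e. h (e 0) = e 1)" "arithF f"
  shows "arithF (\<lambda>S e. h (f S e))"
proof -
  have "arith (\<lambda>S e. \<exists>a. f S (\<lambda>i. e (Suc i)) = a \<and> h a = e 0)"
    using assms(1) arithF_shift[OF assms(2)]
    by (intro arith_ex arith_conj) (simp_all add: arithF_def)
  then show ?thesis by (simp add: arithF_def)
qed

lemma arithF_plus [arI]: "arithF f \<Longrightarrow> arithF g \<Longrightarrow> arithF (\<lambda>S e. f S e + g S e)"
  by (rule arithF_bin[of "(+)"])
    (use arith_of_term(1)[of "arith_term.Plus (arith_term.Var 1) (arith_term.Var 0)" "arith_term.Var 2"] in simp)

lemma arithF_times [arI]: "arithF f \<Longrightarrow> arithF g \<Longrightarrow> arithF (\<lambda>S e. f S e * g S e)"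
  by (rule arithF_bin[of "(*)"])
    (use arith_of_term(1)[of "arith_term.Times (arith_term.Var 1) (arith_term.Var 0)" "arith_term.Var 2"] in simp)

lemma arithF_Suc [arI]: "arithF f \<Longrightarrow> arithF (\<lambda>S e. Suc (f S e))"
  by (rule arithF_un[of Suc])
    (use arith_of_term(1)[of "arith_term.Succ (arith_term.Var 0)" "arith_term.Var 1"] in simp)

lemma arithF_const [arI]: "arithF (\<lambda>S e. n)"
proof (induction n)
  case 0
  show ?case
    using arith_of_term(1)[of "arith_term.Zero" "arith_term.Var 0"] by (simp add: arithF_def)
qed (rule arithF_Suc)

lemma arith_const [arI]: "arith (\<lambda>S e. b)"
  using arith_eq[OF arithF_const[of 0] arithF_const[of "if b then 0 else 1"]] by (cases b) simp_all

lemma arithF_term_val: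
  assumes "\<And>i. arithF (F i)"
  shows "arithF (\<lambda>S e. term_val (\<lambda>i. F i S e) t)"
  by (induction t) (simp_all add: assms arI)

text \<open>Arithmetical comprehension in the form of simultaneous substitution: number variables
  become arithmetical functions, set variables become arithmetically defined sets. In the quantifier
  case the bound variable is the new variable \<open>0\<close>, and all substituted objects are
  shifted past it.\<close>

lemma arith_subst:
  assumes "arith P" "\<And>i. arithF (F i)" "\<And>i. arith (\<lambda>S e. D i S (\<lambda>j. e (Suc j)) (e 0))"
  shows "arith (\<lambda>S e. P (\<lambda>i m. D i S e m) (\<lambda>i. F i S e))"
proof -
  obtain \<phi> where "\<And>S e. P S e = holds S e \<phi>" using assms(1) unfolding arith_def by blast
  moreover have "arith (\<lambda>S e. holds (\<lambda>i m. D i S e m) (\<lambda>i. F i S e) \<phi>)"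
    using assms(2,3)
  proof (induction \<phi> arbitrary: F D)
    case (Eq s t) then show ?case by (simp add: arithF_term_val arI)
  next
    case (Less s t) then show ?case by (simp add: arithF_term_val arI)
  next
    case (Mem t k)
    have "arith (\<lambda>S e. \<exists>a. term_val (\<lambda>i. F i S e) t = a \<and> D k S e a)"
      using arithF_term_val[of F t] Mem by (intro arith_ex arith_conj) (simp_all add: arithF_def)
    then show ?case by simp
  next
    case (Neg \<phi>) then show ?case by (simp add: arI)
  next
    case (Conj \<phi>1 \<phi>2) then show ?case by (simp add: arI)
  next
    case (All x \<phi>)
    have inj: "inj (case_nat 0 (\<lambda>i. Suc (Suc i)))" by (auto simp: inj_def split: nat.splits)
    let ?F = "\<lambda>i S e. if i = x then e 0 else F i S (\<lambda>j. e (Suc j))"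
    have "arith (\<lambda>S e. holds (\<lambda>i m. D i S (\<lambda>j. e (Suc j)) m) (\<lambda>i. ?F i S e) \<phi>)"
    proof (rule All.IH)
      show "arithF (?F i)" for i
        by (cases "i = x") (simp_all add: arithF_shift All.prems arI)
      show "arith (\<lambda>S e. D i S (\<lambda>j. e (Suc (Suc j))) (e 0))" for i
        using arith_rename[OF All.prems(2) inj] by simp
    qed
    moreover have "(\<lambda>i. ?F i S e) = (\<lambda>i. F i S (\<lambda>j. e (Suc j)))(x := e 0)" for S e by auto
    ultimately have "arith (\<lambda>S e. holds (\<lambda>i m. D i S (\<lambda>j. e (Suc j)) m)
        ((\<lambda>i. F i S (\<lambda>j. e (Suc j)))(x := e 0)) \<phi>)" by simp
    from arith_all[of "\<lambda>S e n. holds (\<lambda>i m. D i S e m) ((\<lambda>i. F i S e)(x := n)) \<phi>", OF this]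
    show ?case by simp
  qed
  ultimately show ?thesis by simp
qed

lemma arith_app2:
  assumes "arith (\<lambda>S e. R S (e 0) (e 1))" "arithF f" "arithF g"
  shows "arith (\<lambda>S e. R S (f S e) (g S e))"
  using arith_subst[OF assms(1), of "\<lambda>i. if i = 0 then f else g" "\<lambda>i S e m. S i m"] assms(2,3)
  by (simp add: arI)

lemma arith_app3:
  assumes "arith (\<lambda>S e. R S (e 0) (e 1) (e 2))" "arithF f" "arithF g" "arithF h"
  shows "arith (\<lambda>S e. R S (f S e) (g S e) (h S e))"
  using arith_subst[OF assms(1), of "\<lambda>i. if i = 0 then f else if i = 1 then g else h" "\<lambda>i S e m. S i m"]
    assms(2-4)
  by (simp add: arI)

lemma arith_set_subst:
  assumes "arith P" "\<And>i. arith (\<lambda>S e. D i S (\<lambda>j. e (Suc j)) (e 0))"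
  shows "arith (\<lambda>S e. P (\<lambda>i m. D i S e m) e)"
  using arith_subst[OF assms(1) arithF_var assms(2)] by simp

lemma arithF_cases:
  assumes "arith P" "arithF f" "arithF g"
  shows "arithF (\<lambda>S e. if P S e then f S e else g S e)"
proof -
  have "arith (\<lambda>S e. if P S (\<lambda>i. e (Suc i)) then f S (\<lambda>i. e (Suc i)) = e 0 else g S (\<lambda>i. e (Suc i)) = e 0)"
    using assms by (intro arith_if arith_shift) (simp_all add: arithF_def)
  then show ?thesis unfolding arithF_def by (rule back_subst[of arith]) (intro ext, simp)
qed

lemma arithF_minus [arI]: "arithF f \<Longrightarrow> arithF g \<Longrightarrow> arithF (\<lambda>S e. f S e - g S e)"
proof (rule arithF_bin[of "(-)"])
  have "(\<lambda>(S::senv) e::nenv. e 1 - e 0 = e 2) =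
    (\<lambda>S e. e 1 = e 0 + e 2 \<or> (e 1 \<le> e 0 \<and> e 2 = 0))" by (intro ext) linarith
  moreover have "arith \<dots>" by (intro arI)
  ultimately show "arith (\<lambda>S e. e 1 - e 0 = e 2)" by simp
qed

lemma arithF_mod: "arithF f \<Longrightarrow> arithF g \<Longrightarrow> arithF (\<lambda>S e. f S e mod Suc (g S e))"
proof (rule arithF_bin[of "\<lambda>a b. a mod Suc b"])
  have "(\<lambda>(S::senv) e::nenv. e 1 mod Suc (e 0) = e 2) =
    (\<lambda>S e. e 2 < Suc (e 0) \<and> (\<exists>q. e 1 = q * Suc (e 0) + e 2))"
  proof (intro ext iffI)
    fix S :: senv and e :: nenv
    assume "e 1 mod Suc (e 0) = e 2"
    then show "e 2 < Suc (e 0) \<and> (\<exists>q. e 1 = q * Suc (e 0) + e 2)"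
      by (metis div_mod_decomp mod_less_divisor zero_less_Suc)
  next
    fix S :: senv and e :: nenv
    assume "e 2 < Suc (e 0) \<and> (\<exists>q. e 1 = q * Suc (e 0) + e 2)"
    then show "e 1 mod Suc (e 0) = e 2"
      by (elim conjE exE) (simp del: mult_Suc_right)
  qed
  moreover have "arith \<dots>" by (intro arI)
  ultimately show "arith (\<lambda>S e. e 1 mod Suc (e 0) = e 2)" by simp
qed

section \<open>Goedel's beta function and primitive recursion\<close>

definition beta :: "nat \<Rightarrow> nat \<Rightarrow> nat \<Rightarrow> nat" where
  "beta c d i = c mod Suc (Suc i * d)"

text \<open>Chinese remainder theorem. With \<open>d\<close> the factorial of \<open>M\<close>, a
  common prime of the moduli for \<open>i < j\<close> divides \<open>j - i\<close> or
  \<open>d\<close>. As \<open>j - i \<le> M\<close>, it divides \<open>d\<close> in either case and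
  hence \<open>1\<close>. Since \<open>M\<close> also bounds the values \<open>f i\<close>, these
  are smaller than the moduli and equal their residues.\<close>

lemma beta_complete: "\<exists>c d. \<forall>i\<le>n. beta c d i = f i"
proof -
  define M where "M = n + 1 + (\<Sum>i\<le>n. f i)"
  define d where "d = (fact M :: nat)"
  have cop: "coprime (Suc (Suc i * d)) (Suc (Suc j * d))" if "i \<le> n" "j \<le> n" "i < j" for i j
  proof (rule ccontr)
    assume "\<not> ?thesis"
    then have "gcd (Suc (Suc i * d)) (Suc (Suc j * d)) \<noteq> 1" by (simp add: coprime_iff_gcd_eq_1)
    then obtain p where "prime p" "p dvd gcd (Suc (Suc i * d)) (Suc (Suc j * d))"
      using prime_factor_nat by blast
    then have p: "prime p" "p dvd Suc (Suc i * d)" "p dvd Suc (Suc j * d)" by auto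
    have "p dvd Suc (Suc j * d) - Suc (Suc i * d)" using p by (metis dvd_diff_nat)
    also have "Suc (Suc j * d) - Suc (Suc i * d) = (j - i) * d" using that by (simp add: algebra_simps diff_mult_distrib)
    finally have "p dvd j - i \<or> p dvd d" using p(1) by (simp add: prime_dvd_mult_iff)
    moreover have "j - i dvd d" unfolding d_def
      by (rule dvd_fact) (use that in \<open>auto simp: M_def\<close>)
    ultimately have "p dvd Suc i * d" by (meson dvd_mult dvd_trans)
    with p(2) have "p dvd 1" by (metis Suc_eq_plus1 dvd_add_right_iff)
    then show False using p(1) by simp
  qed
  have "\<exists>x. \<forall>i\<in>{..n}. [x = f i] (mod Suc (Suc i * d))"
  proof (rule chinese_remainder_nat, simp, intro ballI impI)
    fix i j assume "i \<in> {..n}" "j \<in> {..n}" "i \<noteq> j"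
    then show "coprime (Suc (Suc i * d)) (Suc (Suc j * d))"
      using cop[of i j] cop[of j i] by (metis atMost_iff coprime_commute linorder_neqE_nat)
  qed
  then obtain c where c: "\<And>i. i \<le> n \<Longrightarrow> [c = f i] (mod Suc (Suc i * d))" by auto
  have "beta c d i = f i" if "i \<le> n" for i
  proof -
    have "f i \<le> M" unfolding M_def using member_le_sum[of i "{..n}" f] that by simp
    also have "M \<le> d" unfolding d_def by (rule fact_ge_self)
    finally have "f i < Suc (Suc i * d)" by simp
    then show ?thesis using c[OF that] unfolding beta_def cong_def by simp
  qed
  then show ?thesis by blast
qed

lemma arithF_beta [arI]:
  "arithF f \<Longrightarrow> arithF g \<Longrightarrow> arithF h \<Longrightarrow> arithF (\<lambda>S e. beta (f S e) (g S e) (h S e))"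
  unfolding beta_def by (intro arithF_mod arI)

lemma arithF_app2:
  assumes "arithF (\<lambda>S e. h S (e 0) (e 1))" "arithF f" "arithF g"
  shows "arithF (\<lambda>S e. h S (f S e) (g S e))"
proof -
  have "inj (case_nat (2::nat) (case_nat 0 (case_nat 1 (\<lambda>i. i + 3))))"
    by (auto simp: inj_def split: nat.splits)
  from arith_rename[OF assms(1)[unfolded arithF_def] this]
  have "arith (\<lambda>S e. h S (e 0) (e 1) = e 2)" by simp
  from arith_app3[OF this arithF_shift[OF assms(2)] arithF_shift[OF assms(3)] arithF_var[of 0]]
  show ?thesis by (simp add: arithF_def)
qed

text \<open>A value is described by the existence of a beta code of the computation leading to it.
  The step \<open>h\<close> is free of parameters; they enter only through the initial value and the
  number of steps.\<close>

lemma arithF_rec: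
  assumes g: "arithF (\<lambda>S e. x S e 0)" and n: "arithF n"
    and h: "arithF (\<lambda>S e. h (e 0) (e 1))"
    and Suc: "\<And>S e i. x S e (Suc i) = h i (x S e i)"
  shows "arithF (\<lambda>S e. x S e (n S e))"
proof -
  have eq: "x S e m = v \<longleftrightarrow> (\<exists>c d. beta c d 0 = x S e 0 \<and>
      (\<forall>i<m. beta c d (Suc i) = h i (beta c d i)) \<and> beta c d m = v)" for S e m v
  proof
    assume "x S e m = v"
    moreover obtain c d where "\<forall>i\<le>m. beta c d i = x S e i" using beta_complete by metis
    ultimately show "\<exists>c d. beta c d 0 = x S e 0 \<and>
      (\<forall>i<m. beta c d (Suc i) = h i (beta c d i)) \<and> beta c d m = v"
      by (intro exI[of _ c] exI[of _ d]) (simp add: Suc)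
  next
    assume "\<exists>c d. beta c d 0 = x S e 0 \<and>
      (\<forall>i<m. beta c d (Suc i) = h i (beta c d i)) \<and> beta c d m = v"
    then obtain c d where *: "beta c d 0 = x S e 0" "\<And>i. i < m \<Longrightarrow> beta c d (Suc i) = h i (beta c d i)"
      "beta c d m = v" by blast
    have "i \<le> m \<Longrightarrow> beta c d i = x S e i" for i by (induction i) (simp_all add: * Suc)
    then show "x S e m = v" using *(3) by simp
  qed
  have hb: "arithF (\<lambda>S e. h (e 0) (beta (e (Suc (Suc 0))) (e (Suc 0)) (e 0)))"
    by (rule arithF_app2[OF h]) (intro arI)+
  have g': "arithF (\<lambda>S e. x S (\<lambda>i. e (Suc (Suc (Suc i)))) 0)"
    using arithF_shift[OF arithF_shift[OF arithF_shift[OF g]]] .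
  have n': "arithF (\<lambda>S e. n S (\<lambda>i. e (Suc (Suc (Suc i)))))"
    "arithF (\<lambda>S e. n S (\<lambda>i. e (Suc (Suc (Suc (Suc i))))))"
    using arithF_shift[OF arithF_shift[OF arithF_shift[OF n]]] arithF_shift by blast+
  show ?thesis unfolding arithF_def eq by (intro arI hb n' g')
qed

section \<open>Codes of finite lists and strings\<close>

lemma arith_app:
  assumes "arith (\<lambda>S e. P S (\<lambda>j. e (Suc j)) (e 0))" "arithF g"
  shows "arith (\<lambda>S e. P S e (g S e))"
proof -
  have "arith (\<lambda>S e. \<exists>a. g S e = a \<and> P S e a)"
    using assms by (intro arith_ex arith_conj) (simp_all add: arithF_def)
  then show ?thesis by simp
qed

lemma arith_lift:
  assumes "arith (\<lambda>S e. P S (\<lambda>j. e (Suc j)) (e 0))"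
  shows "arith (\<lambda>S e. P S (\<lambda>j. e (Suc (Suc j))) (e 0))"
proof -
  have "inj (case_nat 0 (\<lambda>i. Suc (Suc i)))" by (auto simp: inj_def split: nat.splits)
  from arith_rename[OF assms this] show ?thesis by simp
qed

lemma arithF_prod_encode [arI]:
  "arithF f \<Longrightarrow> arithF g \<Longrightarrow> arithF (\<lambda>S e. prod_encode (f S e, g S e))"
proof (rule arithF_bin[of "\<lambda>a b. prod_encode (a, b)"])
  have "prod_encode (a, b) = c \<longleftrightarrow> 2 * c = (a + b) * Suc (a + b) + 2 * a" for a b c
  proof -
    have "even ((a + b) * Suc (a + b))" by simp
    then have "2 * ((a + b) * Suc (a + b) div 2) = (a + b) * Suc (a + b)" by (rule dvd_mult_div_cancel)
    then have "2 * prod_encode (a, b) = (a + b) * Suc (a + b) + 2 * a"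
      unfolding prod_encode_def triangle_def by (simp del: mult_Suc_right)
    then show ?thesis by presburger
  qed
  then show "arith (\<lambda>S e. prod_encode (e 1, e 0) = e 2)" by (simp only:) (intro arI)
qed

lemma arithF_prod_decode [arI]:
  assumes "arithF f"
  shows "arithF (\<lambda>S e. fst (prod_decode (f S e)))" "arithF (\<lambda>S e. snd (prod_decode (f S e)))"
proof -
  have *: "fst (prod_decode n) = v \<longleftrightarrow> (\<exists>b. n = prod_encode (v, b))"
    "snd (prod_decode n) = v \<longleftrightarrow> (\<exists>a. n = prod_encode (a, v))" for n v
    by (metis fst_conv prod.collapse prod_decode_inverse prod_encode_inverse)
      (metis snd_conv prod.collapse prod_decode_inverse prod_encode_inverse)
  show "arithF (\<lambda>S e. fst (prod_decode (f S e)))"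
    by (rule arithF_un[of "\<lambda>n. fst (prod_decode n)"]) (simp_all only: * assms, intro arI)
  show "arithF (\<lambda>S e. snd (prod_decode (f S e)))"
    by (rule arithF_un[of "\<lambda>n. snd (prod_decode n)"]) (simp_all only: * assms, intro arI)
qed

definition tail_code :: "nat \<Rightarrow> nat" where
  "tail_code c = list_encode (tl (list_decode c))"

lemma tail_code_iff: "tail_code c = d \<longleftrightarrow> c = 0 \<and> d = 0 \<or> (\<exists>a. c = Suc (prod_encode (a, d)))"
proof (cases "list_decode c")
  case Nil
  then have "c = 0" by (metis list_decode_inverse list_encode.simps(1))
  then show ?thesis by (auto simp: tail_code_def)
next
  case (Cons a xs)
  then have "c = Suc (prod_encode (a, list_encode xs))" by (metis list_decode_inverse list_encode.simps(2))
  then show ?thesis by (auto simp: tail_code_def)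
qed

text \<open>The only list operation obtained by recursion. Lengths and entries are read off from the
  codes of the tails, which are \<open>0\<close> exactly for the empty list.\<close>

definition drop_code :: "nat \<Rightarrow> nat \<Rightarrow> nat" where
  "drop_code c i = list_encode (drop i (list_decode c))"

lemma arithF_drop_code [arI]:
  assumes "arithF f" "arithF g" shows "arithF (\<lambda>S e. drop_code (f S e) (g S e))"
proof (rule arithF_rec[where x = "\<lambda>S e. drop_code (f S e)" and h = "\<lambda>i. tail_code"])
  show "arithF (\<lambda>S e. drop_code (f S e) 0)" using assms(1) by (simp add: drop_code_def)
  show "arithF (\<lambda>S e. tail_code (e 1))"
    by (rule arithF_un[of tail_code]) (unfold tail_code_iff, (intro arI)+)
  show "drop_code (f S e) (Suc i) = tail_code (drop_code (f S e) i)" for S e i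
    by (simp add: drop_code_def tail_code_def drop_Suc tl_drop)
qed (rule assms)

definition nthd :: "nat list \<Rightarrow> nat \<Rightarrow> nat" where
  "nthd xs i = (if i < length xs then xs ! i else 0)"

definition arithN :: "(senv \<Rightarrow> nenv \<Rightarrow> nat list) \<Rightarrow> bool" where
  "arithN f \<longleftrightarrow> arithF (\<lambda>S e. list_encode (f S e))"

lemma arithN_decode [arI]: "arithF f \<Longrightarrow> arithN (\<lambda>S e. list_decode (f S e))"
  by (simp add: arithN_def)

lemma list_encode_eq_0: "list_encode xs = 0 \<longleftrightarrow> xs = []"
  by (cases xs) auto

lemma arithF_nthd [arI]:
  assumes "arithN f" "arithF g" shows "arithF (\<lambda>S e. nthd (f S e) (g S e))"
proof -
  have *: "nthd (list_decode c) i = v \<longleftrightarrow> (drop_code c i = 0 \<and> v = 0) \<or>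
      (\<exists>b. drop_code c i = Suc (prod_encode (v, b)))" for c i v
  proof (cases "i < length (list_decode c)")
    case True
    then have "drop_code c i = Suc (prod_encode (list_decode c ! i, drop_code c (Suc i)))"
      by (simp add: drop_code_def flip: Cons_nth_drop_Suc)
    then show ?thesis using True by (auto simp: nthd_def)
  next
    case False
    then show ?thesis by (auto simp: nthd_def drop_code_def)
  qed
  have "arith (\<lambda>S e. nthd (list_decode (e 1)) (e 0) = e 2)" unfolding * by (intro arI)
  from arithF_bin[OF this] assms show ?thesis by (force simp: arithN_def)
qed

lemma arithF_lengthN [arI]:
  assumes "arithN f" shows "arithF (\<lambda>S e. length (f S e))"
proof -
  have *: "length (list_decode c) = n \<longleftrightarrow> drop_code c n = 0 \<and> (\<forall>i<n. drop_code c i \<noteq> 0)" for c n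
    by (auto simp: drop_code_def list_encode_eq_0 not_le[symmetric] intro: le_antisym)
  have "arith (\<lambda>S e. length (list_decode (e 0)) = e 1)" unfolding * by (intro arI)
  from arithF_un[OF this] assms show ?thesis by (force simp: arithN_def)
qed

lemma arithN_snoc [arI]:
  assumes "arithN f" "arithF g" shows "arithN (\<lambda>S e. f S e @ [g S e])"
proof -
  have *: "list_encode (list_decode c @ [a]) = d \<longleftrightarrow> length (list_decode d) = Suc (length (list_decode c))
      \<and> (\<forall>i < length (list_decode c). nthd (list_decode d) i = nthd (list_decode c) i)
      \<and> nthd (list_decode d) (length (list_decode c)) = a" for c a d
  proof -
    have "list_encode (list_decode c @ [a]) = d \<longleftrightarrow> list_decode d = list_decode c @ [a]"
      by (metis list_decode_inverse list_encode_inverse)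
    also have "\<dots> \<longleftrightarrow> length (list_decode d) = Suc (length (list_decode c))
      \<and> (\<forall>i < length (list_decode c). nthd (list_decode d) i = nthd (list_decode c) i)
      \<and> nthd (list_decode d) (length (list_decode c)) = a"
      by (auto simp: list_eq_iff_nth_eq nthd_def nth_append less_Suc_eq)
    finally show ?thesis .
  qed
  have "arith (\<lambda>S e. list_encode (list_decode (e 1) @ [e 0]) = e 2)" unfolding * by (intro arI)
  from arithF_bin[OF this] assms show ?thesis by (force simp: arithN_def)
qed

lemma arith_allN [arI]:
  assumes "arith (\<lambda>S e. P S (\<lambda>i. e (Suc i)) (list_decode (e 0)))"
  shows "arith (\<lambda>S e. \<forall>b::nat list. P S e b)"
proof -
  have "(\<lambda>S e. \<forall>b. P S e b) = (\<lambda>S e. \<forall>c. P S e (list_decode c))"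
    by (intro ext) (metis list_encode_inverse)
  then show ?thesis using arith_all[OF assms] by simp
qed

lemma arith_exN [arI]:
  assumes "arith (\<lambda>S e. P S (\<lambda>i. e (Suc i)) (list_decode (e 0)))"
  shows "arith (\<lambda>S e. \<exists>b::nat list. P S e b)"
  using arith_not[OF arith_allN[OF arith_not[OF assms]]] by simp

text \<open>Decoding is total, so a quantifier over strings becomes a quantifier over all numbers
  without a test for well-formed codes.\<close>

definition string_decode :: "nat \<Rightarrow> bool list" where
  "string_decode c = map (\<lambda>x. x \<noteq> 0) (list_decode c)"

lemma string_decode_code [simp]: "string_decode (string_code u) = u"
  by (simp add: string_decode_def string_code_def comp_def)

lemma list_decode_string_code: "list_decode (string_code u) = map of_bool u"
  by (simp add: string_code_def)

lemma string_code_eq: "string_code u = string_code v \<longleftrightarrow> u = v"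
  by (metis string_decode_code)

definition arithL :: "(senv \<Rightarrow> nenv \<Rightarrow> bool list) \<Rightarrow> bool" where
  "arithL f \<longleftrightarrow> arithF (\<lambda>S e. string_code (f S e))"

text \<open>Definition of a string by its bits; prefixes, concatenation and restrictions of points
  are reduced to this case.\<close>

lemma arithL_map:
  assumes "arith (\<lambda>S e. P S (\<lambda>j. e (Suc j)) (e 0))" "arithF n"
  shows "arithL (\<lambda>S e. map (P S e) [0..<n S e])"
proof -
  have *: "string_code (map p [0..<k]) = c \<longleftrightarrow> length (list_decode c) = k \<and>
      (\<forall>i<k. if p i then nthd (list_decode c) i = 1 else nthd (list_decode c) i = 0)" for p k c
  proof -
    have "string_code (map p [0..<k]) = c \<longleftrightarrow> list_decode c = map of_bool (map p [0..<k])"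
      by (metis list_decode_inverse list_encode_inverse string_code_def)
    also have "\<dots> \<longleftrightarrow> length (list_decode c) = k \<and> (\<forall>i<k. list_decode c ! i = of_bool (p i))"
      unfolding list_eq_iff_nth_eq by (rule iffI; clarsimp)
    also have "\<dots> \<longleftrightarrow> length (list_decode c) = k \<and> (\<forall>i<k. nthd (list_decode c) i = of_bool (p i))"
      by (rule conj_cong) (simp_all add: nthd_def)
    also have "(\<forall>i<k. nthd (list_decode c) i = of_bool (p i)) \<longleftrightarrow>
      (\<forall>i<k. if p i then nthd (list_decode c) i = 1 else nthd (list_decode c) i = 0)"
      by (intro all_cong) simp
    finally show ?thesis .
  qed
  have n: "arithF (\<lambda>S e. n S (\<lambda>i. e (Suc i)))" "arithF (\<lambda>S e. n S (\<lambda>i. e (Suc (Suc i))))"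
    by (intro arithF_shift assms)+
  show ?thesis unfolding arithL_def arithF_def * by (intro arI n arith_lift[OF assms(1)])
qed

lemma arithL_decode [arI]:
  assumes "arithF f" shows "arithL (\<lambda>S e. string_decode (f S e))"
proof -
  have eq: "string_decode c = map (\<lambda>i. nthd (list_decode c) i \<noteq> 0) [0..<length (list_decode c)]" for c
    by (rule nth_equalityI) (auto simp: string_decode_def nthd_def)
  show ?thesis unfolding eq
    using arithF_shift[OF assms] assms by (intro arithL_map) (intro arI; assumption)+
qed

lemma arithF_lengthL [arI]:
  assumes "arithL f" shows "arithF (\<lambda>S e. length (f S e))"
proof -
  have eq: "length u = length (list_decode (string_code u))" for u
    by (simp add: list_decode_string_code)
  show ?thesis unfolding eq using assms unfolding arithL_def by (intro arI)
qed

definition bit_at :: "bool list \<Rightarrow> nat \<Rightarrow> bool" where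
  "bit_at u i \<longleftrightarrow> i < length u \<and> u ! i"

lemma arith_bit_at [arI]:
  assumes "arithL f" "arithF g" shows "arith (\<lambda>S e. bit_at (f S e) (g S e))"
proof -
  have eq: "bit_at u i \<longleftrightarrow> nthd (list_decode (string_code u)) i = 1" for u i
    by (auto simp: bit_at_def nthd_def list_decode_string_code)
  show ?thesis unfolding eq using assms unfolding arithL_def by (intro arI)
qed

lemma arith_eqL [arI]:
  assumes "arithL f" "arithL g" shows "arith (\<lambda>S e. f S e = g S e)"
  using assms arith_eq unfolding arithL_def string_code_eq[symmetric] by blast

lemma arithF_string_code [arI]: "arithL f \<Longrightarrow> arithF (\<lambda>S e. string_code (f S e))"
  by (simp add: arithL_def)

lemma arithF_list_encode [arI]: "arithN f \<Longrightarrow> arithF (\<lambda>S e. list_encode (f S e))"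
  by (simp add: arithN_def)

lemma arithL_shift: "arithL f \<Longrightarrow> arithL (\<lambda>S e. f S (\<lambda>i. e (Suc i)))"
  unfolding arithL_def by (rule arithF_shift)

lemma arithF_min [arI]: "arithF f \<Longrightarrow> arithF g \<Longrightarrow> arithF (\<lambda>S e. min (f S e) (g S e))"
  unfolding min_def by (intro arithF_cases arI)

lemma arithL_take [arI]:
  assumes "arithF n" "arithL f" shows "arithL (\<lambda>S e. take (n S e) (f S e))"
proof -
  have eq: "take k u = map (bit_at u) [0..<min k (length u)]" for k u
    by (rule nth_equalityI) (auto simp: bit_at_def)
  show ?thesis unfolding eq
    using arithL_shift[OF assms(2)] assms by (intro arithL_map) (intro arI; assumption)+
qed

lemma arithL_append [arI]:
  assumes "arithL f" "arithL g" shows "arithL (\<lambda>S e. f S e @ g S e)"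
proof -
  have eq: "u @ v = map (\<lambda>i. if i < length u then bit_at u i else bit_at v (i - length u))
      [0..<length u + length v]" for u v
    by (rule nth_equalityI) (auto simp: bit_at_def nth_append)
  show ?thesis unfolding eq
    using arithL_shift[OF assms(1)] arithL_shift[OF assms(2)] assms
    by (intro arithL_map) (intro arI; assumption)+
qed

lemma arithL_restr [arI]:
  assumes "arithF n" shows "arithL (\<lambda>S e. restr (S k) (n S e))"
  unfolding restr_def using assms by (intro arithL_map arI)

lemma arith_allL [arI]:
  assumes "arith (\<lambda>S e. P S (\<lambda>i. e (Suc i)) (string_decode (e 0)))"
  shows "arith (\<lambda>S e. \<forall>u::bool list. P S e u)"
proof -
  have "(\<lambda>S e. \<forall>u. P S e u) = (\<lambda>S e. \<forall>c. P S e (string_decode c))"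
    by (intro ext) (metis string_decode_code)
  then show ?thesis using arith_all[OF assms] by simp
qed

lemma arith_exL [arI]:
  assumes "arith (\<lambda>S e. P S (\<lambda>i. e (Suc i)) (string_decode (e 0)))"
  shows "arith (\<lambda>S e. \<exists>u::bool list. P S e u)"
  using arith_not[OF arith_allL[OF arith_not[OF assms]]] by simp

text \<open>Measures of clopen sets enter formulas as numbers of strings. A lower bound for such a
  number is witnessed by a list of pairwise distinct elements, and the number itself is the largest
  lower bound.\<close>

lemma le_card_iff:
  assumes "finite A"
  shows "k \<le> card A \<longleftrightarrow> (\<exists>c. (\<forall>i<k. string_decode (nthd c i) \<in> A) \<and>
      (\<forall>i<k. \<forall>j<i. string_decode (nthd c i) \<noteq> string_decode (nthd c j)))" (is "_ = (\<exists>c. ?P c \<and> ?Q c)")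
proof
  assume "k \<le> card A"
  then obtain B where B: "B \<subseteq> A" "card B = k" by (meson obtain_subset_with_card_n)
  obtain us where us: "set us = B" "distinct us"
    using finite_distinct_list[OF finite_subset[OF B(1) assms]] by blast
  then have len: "length us = k" using B(2) distinct_card by metis
  define c where "c = map string_code us"
  have "string_decode (nthd c i) = us ! i" if "i < k" for i
    using that by (simp add: nthd_def c_def len)
  then have "?P c" "?Q c" using us len B(1) by (auto simp: nth_eq_iff_index_eq)
  then show "\<exists>c. ?P c \<and> ?Q c" by blast
next
  assume "\<exists>c. ?P c \<and> ?Q c"
  then obtain c where c: "?P c" "?Q c" by blast
  have "inj_on (\<lambda>i. string_decode (nthd c i)) {..<k}"
    using c(2) by (intro inj_onI) (metis lessThan_iff linorder_neqE_nat)
  then have "card ((\<lambda>i. string_decode (nthd c i)) ` {..<k}) = k" by (simp add: card_image)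
  moreover have "(\<lambda>i. string_decode (nthd c i)) ` {..<k} \<subseteq> A" using c(1) by auto
  ultimately show "k \<le> card A" using card_mono[OF assms] by metis
qed

lemma finite_length_eq: "finite {u::bool list. length u = n \<and> P u}"
  by (rule finite_subset[OF _ finite_lists_length_eq[of UNIV n]]) auto

lemma arithF_card:
  assumes P: "arith (\<lambda>S e. P S (\<lambda>j. e (Suc j)) (string_decode (e 0)))" and n: "arithF n"
  shows "arithF (\<lambda>S e. card {u. length u = n S e \<and> P S e u})"
proof -
  have le: "arith (\<lambda>S e. k S e \<le> card {u. length u = n S (\<lambda>i. e (Suc i)) \<and> P S (\<lambda>i. e (Suc i)) u})"
    if k: "arithF k" for k
  proof -
    have k': "arithF (\<lambda>S e. k S (\<lambda>i. e (Suc i)))" "arithF (\<lambda>S e. k S (\<lambda>i. e (Suc (Suc i))))"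
      by (intro arithF_shift k)+
    have n': "arithF (\<lambda>S e. n S (\<lambda>i. e (Suc (Suc (Suc i)))))"
      using arithF_shift[OF arithF_shift[OF arithF_shift[OF n]]] .
    have "arith (\<lambda>S e. P S (\<lambda>i. e (Suc (Suc (Suc (Suc i))))) (string_decode (e 0)))"
      using arith_lift[OF arith_lift[OF arith_lift[OF P]]] .
    from arith_app[OF this, of "\<lambda>S e. nthd (list_decode (e (Suc 0))) (e 0)"]
    have P': "arith (\<lambda>S e. P S (\<lambda>i. e (Suc (Suc (Suc i)))) (string_decode (nthd (list_decode (e (Suc 0))) (e 0))))"
      by (simp add: arI)
    show ?thesis unfolding le_card_iff[OF finite_length_eq] mem_Collect_eq
      by (intro arI k' n' P')
  qed
  have eq: "card A = v \<longleftrightarrow> v \<le> card A \<and> \<not> Suc v \<le> card A" for A :: "bool list set" and v by auto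
  show ?thesis unfolding arithF_def
    by (subst eq) (intro arith_conj arith_not le arI)
qed

lemma arithF_power2 [arI]: "arithF n \<Longrightarrow> arithF (\<lambda>S e. 2 ^ n S e)"
  by (rule arithF_rec[where x = "\<lambda>S e i. 2 ^ i" and h = "\<lambda>i v. 2 * v"]) (simp_all add: arI)

section \<open>Closure properties and normal form of \<open>\<Sigma>\<^sup>1\<^sub>1\<close>\<close>

text \<open>The set quantifier follows the de Bruijn convention as well: the witness is set variable
  \<open>0\<close> of the matrix and the set variables of \<open>P\<close> move up by one.\<close>

definition Sigma11 :: "(senv \<Rightarrow> nenv \<Rightarrow> bool) \<Rightarrow> bool" where
  "Sigma11 P \<longleftrightarrow> (\<exists>A. arith A \<and> (\<forall>S e. P S e \<longleftrightarrow> (\<exists>Y. A (case_nat Y S) e)))"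

definition Pi11 :: "(senv \<Rightarrow> nenv \<Rightarrow> bool) \<Rightarrow> bool" where
  "Pi11 P \<longleftrightarrow> Sigma11 (\<lambda>S e. \<not> P S e)"

lemma Sigma11I:
  assumes "arith A" "\<And>S e. P S e \<longleftrightarrow> (\<exists>Y. A (case_nat Y S) e)" shows "Sigma11 P"
  using assms unfolding Sigma11_def by blast

lemma Sigma11_ex_set:
  assumes "arith (\<lambda>S e. B (S 0) (\<lambda>i. S (Suc i)) e)"
  shows "Sigma11 (\<lambda>S e. \<exists>Y. B Y S e)"
  by (rule Sigma11I[OF assms]) simp

lemma arith_set_shift:
  assumes "arith P" shows "arith (\<lambda>S e. P (\<lambda>i. S (Suc i)) e)"
  using arith_set_subst[OF assms, of "\<lambda>i S e m. S (Suc i) m"] by (simp add: arI)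

lemma arithF_set_shift:
  assumes "arithF f" shows "arithF (\<lambda>S e. f (\<lambda>i. S (Suc i)) e)"
  using arith_set_shift[OF assms[unfolded arithF_def]] by (simp add: arithF_def)

lemma Sigma11_arith: "arith P \<Longrightarrow> Sigma11 P"
  by (rule Sigma11I[OF arith_set_shift]) simp_all

lemma arith_first_set:
  assumes "arith A" "arith (\<lambda>S e. D S (\<lambda>j. e (Suc j)) (e 0))"
  shows "arith (\<lambda>S e. A (case_nat (\<lambda>m. D S e m) (\<lambda>i. S (Suc i))) e)"
proof -
  have "arith (\<lambda>S e. A (\<lambda>i m. if i = 0 then D S e m else S i m) e)"
  proof (rule arith_set_subst[OF assms(1)])
    fix i show "arith (\<lambda>S e. if i = 0 then D S (\<lambda>j. e (Suc j)) (e 0) else S i (e 0))"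
      by (cases "i = 0") (simp_all add: assms(2) arI)
  qed
  moreover have "(\<lambda>i m. if i = 0 then D S e m else S i m) = case_nat (\<lambda>m. D S e m) (\<lambda>i. S (Suc i))" for S e
    by (intro ext) (simp split: nat.split)
  ultimately show ?thesis by simp
qed

lemma Sigma11_conj:
  assumes "Sigma11 P" "Sigma11 Q" shows "Sigma11 (\<lambda>S e. P S e \<and> Q S e)"
proof -
  obtain A B where A: "arith A" "\<And>S e. P S e \<longleftrightarrow> (\<exists>Y. A (case_nat Y S) e)"
    and B: "arith B" "\<And>S e. Q S e \<longleftrightarrow> (\<exists>Y. B (case_nat Y S) e)"
    using assms unfolding Sigma11_def by blast
  \<comment> \<open>The two witnesses become the even and the odd part of a single set.\<close>
  let ?C = "\<lambda>S e. A (case_nat (\<lambda>m. S 0 (2 * m)) (\<lambda>i. S (Suc i))) e \<and>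
    B (case_nat (\<lambda>m. S 0 (Suc (2 * m))) (\<lambda>i. S (Suc i))) e"
  have "arith ?C"
    by (intro arith_conj arith_first_set A(1) B(1) arI)
  moreover have "P S e \<and> Q S e \<longleftrightarrow> (\<exists>Y. ?C (case_nat Y S) e)" for S e
  proof
    assume "P S e \<and> Q S e"
    then obtain Y1 Y2 where "A (case_nat Y1 S) e" "B (case_nat Y2 S) e" using A(2) B(2) by blast
    then show "\<exists>Y. ?C (case_nat Y S) e"
      by (intro exI[of _ "\<lambda>m. if even m then Y1 (m div 2) else Y2 (m div 2)"]) simp
  next
    assume "\<exists>Y. ?C (case_nat Y S) e"
    then show "P S e \<and> Q S e" using A(2) B(2) by auto
  qed
  ultimately show ?thesis by (rule Sigma11I)
qed

lemma Sigma11_disj: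
  assumes "Sigma11 P" "Sigma11 Q" shows "Sigma11 (\<lambda>S e. P S e \<or> Q S e)"
proof -
  obtain A B where A: "arith A" "\<And>S e. P S e \<longleftrightarrow> (\<exists>Y. A (case_nat Y S) e)"
    and B: "arith B" "\<And>S e. Q S e \<longleftrightarrow> (\<exists>Y. B (case_nat Y S) e)"
    using assms unfolding Sigma11_def by blast
  show ?thesis by (rule Sigma11I[OF arith_disj[OF A(1) B(1)]]) (auto simp: A(2) B(2))
qed

lemma Sigma11_ex:
  assumes "Sigma11 (\<lambda>S e. P S (\<lambda>i. e (Suc i)) (e 0))"
  shows "Sigma11 (\<lambda>S e. \<exists>n::nat. P S e n)"
proof -
  obtain A where A: "arith A" "\<And>S e. P S (\<lambda>i. e (Suc i)) (e 0) \<longleftrightarrow> (\<exists>Y. A (case_nat Y S) e)"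
    using assms unfolding Sigma11_def by blast
  have P: "P S e n \<longleftrightarrow> (\<exists>Y. A (case_nat Y S) (case_nat n e))" for S e n
    using A(2)[of S "case_nat n e"] by simp
  have "case_nat (e 0) (\<lambda>i. e (Suc i)) = e" for e :: nenv
    by (intro ext) (simp split: nat.split)
  then have "arith (\<lambda>S e. \<exists>n. A S (case_nat n e))"
    by (intro arith_ex) (simp add: A(1))
  then show ?thesis by (rule Sigma11I) (auto simp: P)
qed

text \<open>Countable choice: the witnesses for the individual \<open>n\<close> are stored as the
  columns of one set.\<close>

lemma Sigma11_all:
  assumes "Sigma11 (\<lambda>S e. P S (\<lambda>i. e (Suc i)) (e 0))"
  shows "Sigma11 (\<lambda>S e. \<forall>n::nat. P S e n)"
proof -
  obtain A where A: "arith A" "\<And>S e. P S (\<lambda>i. e (Suc i)) (e 0) \<longleftrightarrow> (\<exists>Y. A (case_nat Y S) e)"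
    using assms unfolding Sigma11_def by blast
  have P: "P S e n \<longleftrightarrow> (\<exists>Y. A (case_nat Y S) (case_nat n e))" for S e n
    using A(2)[of S "case_nat n e"] by simp
  let ?C = "\<lambda>S e. \<forall>n. A (case_nat (\<lambda>m. S 0 (prod_encode (n, m))) (\<lambda>i. S (Suc i))) (case_nat n e)"
  have "case_nat (e 0) (\<lambda>i. e (Suc i)) = e" for e :: nenv
    by (intro ext) (simp split: nat.split)
  moreover have "arith (\<lambda>S e. A (case_nat (\<lambda>m. S 0 (prod_encode (e 0, m))) (\<lambda>i. S (Suc i))) e)"
    by (intro arith_first_set A(1) arI)
  ultimately have "arith ?C" by (intro arith_all) simp
  moreover have "(\<forall>n. P S e n) \<longleftrightarrow> (\<exists>Y. ?C (case_nat Y S) e)" for S e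
  proof
    assume "\<forall>n. P S e n"
    then obtain F where F: "\<And>n. A (case_nat (F n) S) (case_nat n e)" unfolding P by metis
    show "\<exists>Y. ?C (case_nat Y S) e"
      by (rule exI[of _ "\<lambda>k. F (fst (prod_decode k)) (snd (prod_decode k))"]) (simp add: F)
  next
    assume "\<exists>Y. ?C (case_nat Y S) e"
    then show "\<forall>n. P S e n" unfolding P by auto
  qed
  ultimately show ?thesis by (rule Sigma11I)
qed

lemma Sigma11_subst:
  assumes "Sigma11 P" "\<And>i. arithF (F i)"
  shows "Sigma11 (\<lambda>S e. P S (\<lambda>i. F i S e))"
proof -
  obtain A where A: "arith A" "\<And>S e. P S e \<longleftrightarrow> (\<exists>Y. A (case_nat Y S) e)"
    using assms(1) unfolding Sigma11_def by blast
  have "arith (\<lambda>S e. A (\<lambda>i m. S i m) (\<lambda>i. F i (\<lambda>k. S (Suc k)) e))"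
    by (rule arith_subst[OF A(1)]) (rule arithF_set_shift[OF assms(2)] arith_mem arithF_var)+
  then show ?thesis by (rule Sigma11I) (simp add: A(2))
qed

lemma Pi11_arith: "arith P \<Longrightarrow> Pi11 P"
  unfolding Pi11_def by (intro Sigma11_arith arI)

lemma Pi11_conj: "Pi11 P \<Longrightarrow> Pi11 Q \<Longrightarrow> Pi11 (\<lambda>S e. P S e \<and> Q S e)"
  unfolding Pi11_def de_Morgan_conj by (rule Sigma11_disj)

lemma Pi11_disj: "Pi11 P \<Longrightarrow> Pi11 Q \<Longrightarrow> Pi11 (\<lambda>S e. P S e \<or> Q S e)"
  unfolding Pi11_def de_Morgan_disj by (rule Sigma11_conj)

lemma Pi11_imp: "arith P \<Longrightarrow> Pi11 Q \<Longrightarrow> Pi11 (\<lambda>S e. P S e \<longrightarrow> Q S e)"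
  unfolding imp_conv_disj by (rule Pi11_disj[OF Pi11_arith[OF arith_not]])

lemma Pi11_all:
  "Pi11 (\<lambda>S e. P S (\<lambda>i. e (Suc i)) (e 0)) \<Longrightarrow> Pi11 (\<lambda>S e. \<forall>n::nat. P S e n)"
  unfolding Pi11_def not_all by (rule Sigma11_ex)

lemma Pi11_ex:
  "Pi11 (\<lambda>S e. P S (\<lambda>i. e (Suc i)) (e 0)) \<Longrightarrow> Pi11 (\<lambda>S e. \<exists>n::nat. P S e n)"
  unfolding Pi11_def not_ex by (rule Sigma11_all)

lemma Pi11_all_set:
  "arith (\<lambda>S e. B (S 0) (\<lambda>i. S (Suc i)) e) \<Longrightarrow> Pi11 (\<lambda>S e. \<forall>Y. B Y S e)"
  unfolding Pi11_def not_all by (intro Sigma11_ex_set arI)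

lemma Pi11_subst:
  assumes "Pi11 P" "\<And>i. arithF (F i)" shows "Pi11 (\<lambda>S e. P S (\<lambda>i. F i S e))"
  using Sigma11_subst[OF assms(1)[unfolded Pi11_def] assms(2)] unfolding Pi11_def .

lemma Pi11_exL:
  assumes "Pi11 (\<lambda>S e. P S (\<lambda>i. e (Suc i)) (string_decode (e 0)))"
  shows "Pi11 (\<lambda>S e. \<exists>u::bool list. P S e u)"
proof -
  have "(\<lambda>S e. \<exists>u. P S e u) = (\<lambda>S e. \<exists>c. P S e (string_decode c))"
    by (intro ext) (metis string_decode_code)
  then show ?thesis using Pi11_ex[OF assms] by simp
qed

lemma Pi11_app2:
  assumes "Pi11 (\<lambda>S e. R S (e 0) (e 1))" "arithF f" "arithF g"
  shows "Pi11 (\<lambda>S e. R S (f S e) (g S e))"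
  using Pi11_subst[OF assms(1), of "\<lambda>i. if i = 0 then f else g"] assms(2,3)
  by simp

lemma Pi11_app3:
  assumes "Pi11 (\<lambda>S e. R S (e 0) (e 1) (e 2))" "arithF f" "arithF g" "arithF h"
  shows "Pi11 (\<lambda>S e. R S (f S e) (g S e) (h S e))"
  using Pi11_subst[OF assms(1), of "\<lambda>i. if i = 0 then f else if i = 1 then g else h"] assms(2-4)
  by simp

lemma Pi11_setI:
  assumes "Pi11 (\<lambda>S e. e 0 \<in> A)"
  shows "Pi11_set A"
proof -
  obtain B where B: "arith B" "\<And>S e. e 0 \<notin> A \<longleftrightarrow> (\<exists>Y. B (case_nat Y S) e)"
    using assms unfolding Pi11_def Sigma11_def by blast
  obtain \<phi> where \<phi>: "\<And>S e. B S e = holds S e \<phi>" using B(1) unfolding arith_def by blast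
  have "(\<lambda>_ _. False)(0 := Y) = case_nat Y (\<lambda>_ _. False)" for Y :: "nat \<Rightarrow> bool"
    by (intro ext) (simp split: nat.split)
  then have "n \<in> A \<longleftrightarrow> (\<forall>Y. holds ((\<lambda>_ _. False)(0 := Y)) ((\<lambda>_. 0)(0 := n)) (Neg \<phi>))" for n
    using B(2)[of "(\<lambda>_. 0)(0 := n)" "\<lambda>_ _. False"] by (auto simp: \<phi>)
  then show ?thesis unfolding Pi11_set_def by blast
qed

lemma Pi11_setD:
  assumes "Pi11_set A" "arithF f"
  shows "Pi11 (\<lambda>S e. f S e \<in> A)"
proof -
  obtain \<phi> where \<phi>: "\<And>n. n \<in> A \<longleftrightarrow> (\<forall>Y. holds ((\<lambda>_ _. False)(0 := Y)) ((\<lambda>_. 0)(0 := n)) \<phi>)"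
    using assms(1) unfolding Pi11_set_def by blast
  have *: "arith (\<lambda>S e. holds (\<lambda>i m. if i = 0 then S 0 m else False) (\<lambda>i. if i = 0 then f (\<lambda>k. S (Suc k)) e else 0) \<phi>)"
  proof (rule arith_subst[OF arith_holds])
    fix i :: nat
    show "arithF (\<lambda>S e. if i = 0 then f (\<lambda>k. S (Suc k)) e else 0)"
      by (cases "i = 0") (simp_all add: arithF_set_shift assms(2) arI)
    show "arith (\<lambda>S e. if i = 0 then S 0 (e 0) else False)"
      by (cases "i = 0") (simp_all add: arI)
  qed
  have eq: "(\<lambda>i m. if i = 0 then S 0 m else False) = (\<lambda>_ _. False)(0 := S 0)"
    "(\<lambda>i. if i = 0 then k else 0) = (\<lambda>_. 0)(0 := k)" for S :: senv and k :: nat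
    by (intro ext, simp)+
  from *[unfolded eq] show ?thesis unfolding \<phi> by (rule Pi11_all_set)
qed

lemma Sigma11_classI:
  assumes "Sigma11 (\<lambda>S e. S 0 \<in> C)"
  shows "Sigma11_class C"
proof -
  obtain A where A: "arith A" "\<And>S e. S 0 \<in> C \<longleftrightarrow> (\<exists>Y. A (case_nat Y S) e)"
    using assms unfolding Sigma11_def by blast
  have "arith (\<lambda>S e. A (\<lambda>i m. if i = 0 then S 1 m else S 0 m) e)"
  proof (rule arith_set_subst[OF A(1)])
    fix i :: nat show "arith (\<lambda>S e. if i = 0 then S 1 (e 0) else S 0 (e 0))"
      by (cases "i = 0") (simp_all add: arI)
  qed
  then obtain \<phi> where \<phi>: "\<And>S e. A (\<lambda>i m. if i = 0 then S 1 m else S 0 m) e = holds S e \<phi>"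
    unfolding arith_def by blast
  have "(\<lambda>i m. if i = 0 then Y m else Z m) = case_nat Y (\<lambda>_. Z)" for Y Z :: "nat \<Rightarrow> bool"
    by (intro ext) (simp split: nat.split)
  then have "Z \<in> C \<longleftrightarrow> (\<exists>Y. holds ((\<lambda>_ _. False)(0 := Z, 1 := Y)) (\<lambda>_. 0) \<phi>)" for Z
    using A(2)[of "\<lambda>_. Z" "\<lambda>_. 0"] by (simp flip: \<phi>)
  then show ?thesis unfolding Sigma11_class_def by blast
qed

lemma uniformly_Pi11I:
  assumes "Pi11 (\<lambda>S e. string_decode (e 1) \<in> W (e 0))"
  shows "uniformly_Pi11 W"
  unfolding uniformly_Pi11_def
proof (rule Pi11_setI)
  \<comment> \<open>Many numbers decode to the same string, but the set contains only the canonical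
    codes, hence the condition that encoding gives back \<open>c\<close>.\<close>
  have eq: "k \<in> {prod_encode (n, string_code \<sigma>) |n \<sigma>. \<sigma> \<in> W n} \<longleftrightarrow>
    (\<exists>n c. k = prod_encode (n, c) \<and> string_code (string_decode c) = c \<and> string_decode c \<in> W n)" for k
    by auto (metis string_decode_code)
  have *: "Pi11 (\<lambda>S e. string_decode (e 0) \<in> W (e (Suc 0)))"
    using Pi11_app2[OF assms, of "\<lambda>S e. e (Suc 0)" "\<lambda>S e. e 0"] by (simp add: arI)
  show "Pi11 (\<lambda>S e. e 0 \<in> {prod_encode (n, string_code \<sigma>) |n \<sigma>. \<sigma> \<in> W n})"
    unfolding eq by (intro Pi11_ex Pi11_conj * Pi11_arith arI)
qed

section \<open>Skolem normal form with a locally constant matrix\<close>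

definition finite_use :: "(senv \<Rightarrow> bool) \<Rightarrow> bool" where
  "finite_use Q \<longleftrightarrow> (\<forall>S. \<exists>m. \<forall>S'. (\<forall>i<m. \<forall>j<m. S i j = S' i j) \<longrightarrow> Q S = Q S')"

lemma finite_use_const: "finite_use (\<lambda>S. b)"
  unfolding finite_use_def by simp

lemma finite_use_mem: "finite_use (\<lambda>S. S i j)"
  unfolding finite_use_def
proof (intro allI exI impI)
  fix S S' :: senv assume "\<forall>a<Suc (max i j). \<forall>b<Suc (max i j). S a b = S' a b"
  then show "S i j = S' i j" by (simp add: less_Suc_eq_le)
qed

lemma finite_use_not: "finite_use Q \<Longrightarrow> finite_use (\<lambda>S. \<not> Q S)"
  unfolding finite_use_def by simp

lemma finite_use_conj:
  assumes "finite_use P" "finite_use Q" shows "finite_use (\<lambda>S. P S \<and> Q S)"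
  unfolding finite_use_def
proof
  fix S
  from assms(1) obtain m where m: "\<forall>S'. (\<forall>i<m. \<forall>j<m. S i j = S' i j) \<longrightarrow> P S = P S'"
    unfolding finite_use_def by blast
  from assms(2) obtain n where n: "\<forall>S'. (\<forall>i<n. \<forall>j<n. S i j = S' i j) \<longrightarrow> Q S = Q S'"
    unfolding finite_use_def by blast
  show "\<exists>m. \<forall>S'. (\<forall>i<m. \<forall>j<m. S i j = S' i j) \<longrightarrow> (P S \<and> Q S) = (P S' \<and> Q S')"
  proof (intro exI allI impI)
    fix S' assume *: "\<forall>i<max m n. \<forall>j<max m n. S i j = S' i j"
    have "P S = P S'" by (rule m[rule_format]) (simp add: *)
    moreover have "Q S = Q S'" by (rule n[rule_format]) (simp add: *)
    ultimately show "(P S \<and> Q S) = (P S' \<and> Q S')" by simp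
  qed
qed

lemma finite_use_disj:
  assumes "finite_use P" "finite_use Q" shows "finite_use (\<lambda>S. P S \<or> Q S)"
  using finite_use_not[OF finite_use_conj[OF finite_use_not[OF assms(1)] finite_use_not[OF assms(2)]]]
  by simp

lemma finite_use_bounded_all:
  assumes "\<And>k. finite_use (P k)" shows "finite_use (\<lambda>S. \<forall>k<n::nat. P k S)"
proof (induction n)
  case (Suc n)
  have "(\<lambda>S. \<forall>k<Suc n. P k S) = (\<lambda>S. P n S \<and> (\<forall>k<n. P k S))" by (auto simp: less_Suc_eq)
  then show ?case using finite_use_conj[OF assms Suc] by simp
qed (simp add: finite_use_const)

lemma finite_use_reindex:
  assumes "finite_use Q" shows "finite_use (\<lambda>S. Q (\<lambda>i j. S (p i j) (q i j)))"
  unfolding finite_use_def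
proof
  fix S :: senv
  obtain m where
    m: "\<forall>S'. (\<forall>i<m. \<forall>j<m. S (p i j) (q i j) = S' i j) \<longrightarrow> Q (\<lambda>i j. S (p i j) (q i j)) = Q S'"
    using spec[OF assms[unfolded finite_use_def], of "\<lambda>i j. S (p i j) (q i j)"] by (rule exE)
  define k where "k = Suc (\<Sum>i<m. \<Sum>j<m. p i j + q i j)"
  have k: "p i j < k" "q i j < k" if "i < m" "j < m" for i j
  proof -
    have "p i j + q i j \<le> (\<Sum>j<m. p i j + q i j)" using that by (intro member_le_sum) auto
    also have "\<dots> \<le> (\<Sum>i<m. \<Sum>j<m. p i j + q i j)"
      using that member_le_sum[of i "{..<m}" "\<lambda>i. \<Sum>j<m. p i j + q i j"] by simp
    finally show "p i j < k" "q i j < k" unfolding k_def by simp_all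
  qed
  show "\<exists>m. \<forall>S'. (\<forall>i<m. \<forall>j<m. S i j = S' i j) \<longrightarrow>
      Q (\<lambda>i j. S (p i j) (q i j)) = Q (\<lambda>i j. S' (p i j) (q i j))"
    by (intro exI[of _ k] allI impI m[rule_format]) (simp add: k)
qed

lemmas finite_use_intros = finite_use_const finite_use_mem finite_use_not finite_use_conj
  finite_use_disj finite_use_bounded_all

text \<open>
  A matrix \<open>Q\<close> of finite use decides only finitely many bits, so in the form \<open>\<exists>Y. \<forall>a. \<exists>b. Q\<close> bounding
  \<open>b\<close> as a function of \<open>a\<close> leaves a closed set. An existential number quantifier is absorbed into \<open>Y\<close>
  as the least element of a column.
\<close>

definition normal_form :: "(senv \<Rightarrow> nenv \<Rightarrow> bool) \<Rightarrow> bool" where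
  "normal_form P \<longleftrightarrow> (\<exists>Q. arith (\<lambda>S e. Q S (e 0) (e 1) (\<lambda>i. e (Suc (Suc i)))) \<and>
     (\<forall>a b e. finite_use (\<lambda>S. Q S a b e)) \<and>
     (\<forall>S e. P S e \<longleftrightarrow> (\<exists>Y. \<forall>a. \<exists>b. Q (case_nat Y S) a b e)))"

lemma normal_formI:
  assumes "arith (\<lambda>S e. Q S (e 0) (e 1) (\<lambda>i. e (Suc (Suc i))))"
    "\<And>a b e. finite_use (\<lambda>S. Q S a b e)"
    "\<And>S e. P S e \<longleftrightarrow> (\<exists>Y. \<forall>a. \<exists>b. Q (case_nat Y S) a b e)"
  shows "normal_form P"
  using assms unfolding normal_form_def by blast

lemma normal_formE:
  assumes "normal_form P"
  obtains Q where "arith (\<lambda>S e. Q S (e 0) (e 1) (\<lambda>i. e (Suc (Suc i))))"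
    "\<And>a b e. finite_use (\<lambda>S. Q S a b e)"
    "\<And>S e. P S e \<longleftrightarrow> (\<exists>Y. \<forall>a. \<exists>b. Q (case_nat Y S) a b e)"
  using assms unfolding normal_form_def by (elim exE conjE) (rule that; simp)

lemma arith_matrix:
  assumes "arith (\<lambda>S e. Q S (e 0) (e 1) (\<lambda>i. e (Suc (Suc i))))" "arithF f" "arithF g"
    "\<And>i. arithF (F i)" "\<And>i. arith (\<lambda>S e. D i S (\<lambda>j. e (Suc j)) (e 0))"
  shows "arith (\<lambda>S e. Q (\<lambda>i m. D i S e m) (f S e) (g S e) (\<lambda>i. F i S e))"
proof -
  have "arithF (case i of 0 \<Rightarrow> f | Suc j \<Rightarrow> (case j of 0 \<Rightarrow> g | Suc k \<Rightarrow> F k))" for i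
    by (auto split: nat.split simp: assms)
  from arith_subst[where F = "\<lambda>i. case i of 0 \<Rightarrow> f | Suc j \<Rightarrow> (case j of 0 \<Rightarrow> g | Suc k \<Rightarrow> F k)", OF assms(1) this assms(5)]
  show ?thesis by simp
qed

definition upd_first :: "(nat \<Rightarrow> nat) \<Rightarrow> senv \<Rightarrow> senv" where
  "upd_first q S = (\<lambda>i m. S i (if i = 0 then q m else m))"

lemma upd_first_case [simp]: "upd_first q (case_nat Y S) = case_nat (\<lambda>m. Y (q m)) S"
  unfolding upd_first_def by (intro ext) (simp split: nat.split)

lemma finite_use_upd_first: "finite_use Q \<Longrightarrow> finite_use (\<lambda>S. Q (upd_first q S))"
  unfolding upd_first_def by (rule finite_use_reindex)

lemma arith_matrix_upd_first:
  assumes Q: "arith (\<lambda>S e. Q S (e 0) (e 1) (\<lambda>i. e (Suc (Suc i))))" "arithF f" "arithF g"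
    "\<And>i. arithF (F i)" and q: "arithF (\<lambda>S e. q S (\<lambda>j. e (Suc j)) (e 0))"
  shows "arith (\<lambda>S e. Q (upd_first (q S e) S) (f S e) (g S e) (\<lambda>i. F i S e))"
  unfolding upd_first_def
proof (rule arith_matrix[OF Q, where D = "\<lambda>i S e m. S i (if i = 0 then q S e m else m)"])
  fix i :: nat
  show "arith (\<lambda>S e. S i (if i = 0 then q S (\<lambda>j. e (Suc j)) (e 0) else e 0))"
    by (cases "i = 0") (simp_all add: q arI)
qed

lemma normal_form_atom:
  assumes "arith P" "\<And>e. finite_use (\<lambda>S. P S e)"
  shows "normal_form P"
proof (rule normal_formI[where Q = "\<lambda>S a b e. P (\<lambda>i. S (Suc i)) e"])
  show "arith (\<lambda>S e. P (\<lambda>i. S (Suc i)) (\<lambda>i. e (Suc (Suc i))))"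
    using arith_rename[OF arith_set_shift[OF assms(1)], of "\<lambda>i. Suc (Suc i)"]
    by (simp add: inj_def)
  show "finite_use (\<lambda>S. P (\<lambda>i. S (Suc i)) e)" for e
    using finite_use_reindex[OF assms(2), of "\<lambda>i j. Suc i" "\<lambda>i j. j"] .
qed simp

lemma normal_form_conj:
  assumes "normal_form P1" "normal_form P2" shows "normal_form (\<lambda>S e. P1 S e \<and> P2 S e)"
proof -
  obtain Q1 where Q1: "arith (\<lambda>S e. Q1 S (e 0) (e 1) (\<lambda>i. e (Suc (Suc i))))"
      "\<And>a b e. finite_use (\<lambda>S. Q1 S a b e)" "\<And>S e. P1 S e \<longleftrightarrow> (\<exists>Y. \<forall>a. \<exists>b. Q1 (case_nat Y S) a b e)"
    by (fact normal_formE[OF assms(1)])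
  obtain Q2 where Q2: "arith (\<lambda>S e. Q2 S (e 0) (e 1) (\<lambda>i. e (Suc (Suc i))))"
      "\<And>a b e. finite_use (\<lambda>S. Q2 S a b e)" "\<And>S e. P2 S e \<longleftrightarrow> (\<exists>Y. \<forall>a. \<exists>b. Q2 (case_nat Y S) a b e)"
    by (fact normal_formE[OF assms(2)])
  let ?Q = "\<lambda>S a b e. Q1 (upd_first (\<lambda>m. 2 * m) S) a (fst (prod_decode b)) e \<and>
    Q2 (upd_first (\<lambda>m. Suc (2 * m)) S) a (snd (prod_decode b)) e"
  show ?thesis
  proof (rule normal_formI[of ?Q])
    show "arith (\<lambda>S e. ?Q S (e 0) (e 1) (\<lambda>i. e (Suc (Suc i))))"
      by (intro arith_conj arith_matrix_upd_first[OF Q1(1)] arith_matrix_upd_first[OF Q2(1)] arI)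
    show "finite_use (\<lambda>S. ?Q S a b e)" for a b e
      by (intro finite_use_conj finite_use_upd_first[OF Q1(2)] finite_use_upd_first[OF Q2(2)])
    show "P1 S e \<and> P2 S e \<longleftrightarrow> (\<exists>Y. \<forall>a. \<exists>b. ?Q (case_nat Y S) a b e)" for S e
    proof
      assume "P1 S e \<and> P2 S e"
      then obtain Y1 Y2 where Y: "\<forall>a. \<exists>b. Q1 (case_nat Y1 S) a b e" "\<forall>a. \<exists>b. Q2 (case_nat Y2 S) a b e"
        unfolding Q1(3) Q2(3) by (elim conjE exE)
      show "\<exists>Y. \<forall>a. \<exists>b. ?Q (case_nat Y S) a b e"
      proof (intro exI[of _ "\<lambda>m. if even m then Y1 (m div 2) else Y2 (m div 2)"] allI)
        fix a
        from Y obtain b1 b2 where "Q1 (case_nat Y1 S) a b1 e" "Q2 (case_nat Y2 S) a b2 e" by blast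
        then show "\<exists>b. ?Q (case_nat (\<lambda>m. if even m then Y1 (m div 2) else Y2 (m div 2)) S) a b e"
          by (intro exI[of _ "prod_encode (b1, b2)"]) simp
      qed
    next
      assume "\<exists>Y. \<forall>a. \<exists>b. ?Q (case_nat Y S) a b e"
      then show "P1 S e \<and> P2 S e" unfolding Q1(3) Q2(3) upd_first_case by blast
    qed
  qed
qed

text \<open>Bit \<open>0\<close> of the witness announces the disjunct that is going to be verified;
  the remaining bits are the witness for it.\<close>

lemma normal_form_disj:
  assumes "normal_form P1" "normal_form P2" shows "normal_form (\<lambda>S e. P1 S e \<or> P2 S e)"
proof -
  obtain Q1 where Q1: "arith (\<lambda>S e. Q1 S (e 0) (e 1) (\<lambda>i. e (Suc (Suc i))))"
      "\<And>a b e. finite_use (\<lambda>S. Q1 S a b e)" "\<And>S e. P1 S e \<longleftrightarrow> (\<exists>Y. \<forall>a. \<exists>b. Q1 (case_nat Y S) a b e)"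
    by (fact normal_formE[OF assms(1)])
  obtain Q2 where Q2: "arith (\<lambda>S e. Q2 S (e 0) (e 1) (\<lambda>i. e (Suc (Suc i))))"
      "\<And>a b e. finite_use (\<lambda>S. Q2 S a b e)" "\<And>S e. P2 S e \<longleftrightarrow> (\<exists>Y. \<forall>a. \<exists>b. Q2 (case_nat Y S) a b e)"
    by (fact normal_formE[OF assms(2)])
  let ?Q = "\<lambda>S a b e. (S 0 0 \<and> Q1 (upd_first Suc S) a b e) \<or> (\<not> S 0 0 \<and> Q2 (upd_first Suc S) a b e)"
  show ?thesis
  proof (rule normal_formI[of ?Q])
    show "arith (\<lambda>S e. ?Q S (e 0) (e 1) (\<lambda>i. e (Suc (Suc i))))"
      by (intro arith_conj arith_disj arith_not arith_matrix_upd_first[OF Q1(1)] arith_matrix_upd_first[OF Q2(1)] arI)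
    show "finite_use (\<lambda>S. ?Q S a b e)" for a b e
      by (intro finite_use_intros finite_use_upd_first[OF Q1(2)] finite_use_upd_first[OF Q2(2)])
    show "P1 S e \<or> P2 S e \<longleftrightarrow> (\<exists>Y. \<forall>a. \<exists>b. ?Q (case_nat Y S) a b e)" for S e
    proof
      assume "P1 S e \<or> P2 S e"
      then show "\<exists>Y. \<forall>a. \<exists>b. ?Q (case_nat Y S) a b e"
      proof
        assume "P1 S e"
        then obtain Y where "\<forall>a. \<exists>b. Q1 (case_nat Y S) a b e" unfolding Q1(3) by blast
        then show ?thesis by (intro exI[of _ "case_nat True Y"]) simp
      next
        assume "P2 S e"
        then obtain Y where "\<forall>a. \<exists>b. Q2 (case_nat Y S) a b e" unfolding Q2(3) by blast
        then show ?thesis by (intro exI[of _ "case_nat False Y"]) simp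
      qed
    next
      assume "\<exists>Y. \<forall>a. \<exists>b. ?Q (case_nat Y S) a b e"
      then obtain Y where Y: "\<forall>a. \<exists>b. ?Q (case_nat Y S) a b e" ..
      show "P1 S e \<or> P2 S e" unfolding Q1(3) Q2(3) using Y by (cases "Y 0") auto
    qed
  qed
qed

lemma normal_form_all:
  assumes "normal_form P" shows "normal_form (\<lambda>S e. \<forall>n. P S (e(x := n)))"
proof -
  obtain Q where Q: "arith (\<lambda>S e. Q S (e 0) (e 1) (\<lambda>i. e (Suc (Suc i))))"
      "\<And>a b e. finite_use (\<lambda>S. Q S a b e)" "\<And>S e. P S e \<longleftrightarrow> (\<exists>Y. \<forall>a. \<exists>b. Q (case_nat Y S) a b e)"
    by (fact normal_formE[OF assms])
  \<comment> \<open>The quantified number is merged with \<open>a\<close> into the pair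
    \<open>c\<close>, and each of its values has its own column of the witness.\<close>
  let ?Q = "\<lambda>S c b e. Q (upd_first (\<lambda>m. prod_encode (fst (prod_decode c), m)) S) (snd (prod_decode c)) b
    (e(x := fst (prod_decode c)))"
  show ?thesis
  proof (rule normal_formI[of ?Q])
    have "arith (\<lambda>S e. Q (upd_first (\<lambda>m. prod_encode (fst (prod_decode (e 0)), m)) S) (snd (prod_decode (e 0)))
        (e (Suc 0)) (\<lambda>i. if i = x then fst (prod_decode (e 0)) else e (Suc (Suc i))))"
    proof (intro arith_matrix_upd_first[OF Q(1)] arI)
      fix i show "arithF (\<lambda>S e. if i = x then fst (prod_decode (e 0)) else e (Suc (Suc i)))"
        by (cases "i = x") (simp_all add: arI)
    qed
    moreover have "(\<lambda>i. if i = x then k else e (Suc (Suc i))) = (\<lambda>i. e (Suc (Suc i)))(x := k)"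
      for e :: nenv and k by (intro ext) simp
    ultimately show "arith (\<lambda>S e. ?Q S (e 0) (e 1) (\<lambda>i. e (Suc (Suc i))))" by simp
    show "finite_use (\<lambda>S. ?Q S a b e)" for a b e
      by (rule finite_use_upd_first[OF Q(2)])
    show "(\<forall>n. P S (e(x := n))) \<longleftrightarrow> (\<exists>Y. \<forall>a. \<exists>b. ?Q (case_nat Y S) a b e)" for S e
    proof
      assume "\<forall>n. P S (e(x := n))"
      then have "\<forall>n. \<exists>Y. \<forall>a. \<exists>b. Q (case_nat Y S) a b (e(x := n))" unfolding Q(3) .
      from choice[OF this] obtain F where F: "\<forall>n a. \<exists>b. Q (case_nat (F n) S) a b (e(x := n))" ..
      then show "\<exists>Y. \<forall>a. \<exists>b. ?Q (case_nat Y S) a b e"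
        by (intro exI[of _ "\<lambda>k. F (fst (prod_decode k)) (snd (prod_decode k))"] allI) simp
    next
      assume "\<exists>Y. \<forall>a. \<exists>b. ?Q (case_nat Y S) a b e"
      then obtain Y where Y: "\<And>c. \<exists>b. ?Q (case_nat Y S) c b e" by blast
      have "\<exists>b. Q (case_nat (\<lambda>m. Y (prod_encode (n, m))) S) a b (e(x := n))" for n a
        using Y[of "prod_encode (n, a)"] by simp
      then show "\<forall>n. P S (e(x := n))" unfolding Q(3) by blast
    qed
  qed
qed

lemma normal_form_ex:
  assumes "normal_form P" shows "normal_form (\<lambda>S e. \<exists>n. P S (e(x := n)))"
proof -
  obtain Q where Q: "arith (\<lambda>S e. Q S (e 0) (e 1) (\<lambda>i. e (Suc (Suc i))))"
      "\<And>a b e. finite_use (\<lambda>S. Q S a b e)" "\<And>S e. P S e \<longleftrightarrow> (\<exists>Y. \<forall>a. \<exists>b. Q (case_nat Y S) a b e)"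
    by (fact normal_formE[OF assms])
  \<comment> \<open>The even part of the witness marks a number \<open>n\<close>. The inner
    quantifier guesses \<open>n\<close> anew for each \<open>a\<close>, because a search for it
    would not have finite use. Requiring the least marked number makes all these guesses agree, and
    leastness is checked on finitely many bits.\<close>
  let ?Q = "\<lambda>S a c e. S 0 (2 * fst (prod_decode c)) \<and> (\<forall>k<fst (prod_decode c). \<not> S 0 (2 * k)) \<and>
    Q (upd_first (\<lambda>m. Suc (2 * m)) S) a (snd (prod_decode c)) (e(x := fst (prod_decode c)))"
  show ?thesis
  proof (rule normal_formI[of ?Q])
    have "arith (\<lambda>S e. Q (upd_first (\<lambda>m. Suc (2 * m)) S) (e 0) (snd (prod_decode (e (Suc 0))))
        (\<lambda>i. if i = x then fst (prod_decode (e (Suc 0))) else e (Suc (Suc i))))"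
    proof (intro arith_matrix_upd_first[OF Q(1)] arI)
      fix i show "arithF (\<lambda>S e. if i = x then fst (prod_decode (e (Suc 0))) else e (Suc (Suc i)))"
        by (cases "i = x") (simp_all add: arI)
    qed
    moreover have "(\<lambda>i. if i = x then k else e (Suc (Suc i))) = (\<lambda>i. e (Suc (Suc i)))(x := k)"
      for e :: nenv and k by (intro ext) simp
    ultimately have "arith (\<lambda>S e. Q (upd_first (\<lambda>m. Suc (2 * m)) S) (e 0) (snd (prod_decode (e (Suc 0))))
        ((\<lambda>i. e (Suc (Suc i)))(x := fst (prod_decode (e (Suc 0))))))" by simp
    then show "arith (\<lambda>S e. ?Q S (e 0) (e 1) (\<lambda>i. e (Suc (Suc i))))"
      unfolding One_nat_def by (intro arith_conj arith_not arI)
    show "finite_use (\<lambda>S. ?Q S a b e)" for a b e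
      by (intro finite_use_intros finite_use_upd_first[OF Q(2)])
    show "(\<exists>n. P S (e(x := n))) \<longleftrightarrow> (\<exists>Y. \<forall>a. \<exists>b. ?Q (case_nat Y S) a b e)" for S e
    proof
      assume "\<exists>n. P S (e(x := n))"
      then obtain n Y where Y: "\<forall>a. \<exists>b. Q (case_nat Y S) a b (e(x := n))"
        unfolding Q(3) by (elim exE)
      show "\<exists>Y. \<forall>a. \<exists>b. ?Q (case_nat Y S) a b e"
      proof (intro exI[of _ "\<lambda>m. if even m then m div 2 = n else Y (m div 2)"] allI)
        fix a
        from Y obtain b where "Q (case_nat Y S) a b (e(x := n))" by blast
        then show "\<exists>b. ?Q (case_nat (\<lambda>m. if even m then m div 2 = n else Y (m div 2)) S) a b e"
          by (intro exI[of _ "prod_encode (n, b)"]) simp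
      qed
    next
      assume "\<exists>Y. \<forall>a. \<exists>b. ?Q (case_nat Y S) a b e"
      then obtain Y where "\<forall>a. \<exists>c. ?Q (case_nat Y S) a c e" ..
      from choice[OF this] obtain c where Y: "\<forall>a. ?Q (case_nat Y S) a (c a) e" ..
      define n where "n = fst (prod_decode (c 0))"
      have A: "Y (2 * fst (prod_decode (c a)))" "\<And>k. k < fst (prod_decode (c a)) \<Longrightarrow> \<not> Y (2 * k)" for a
        using spec[OF Y, of a] by simp_all
      have n: "fst (prod_decode (c a)) = n" for a
        unfolding n_def
        by (rule linorder_cases[of "fst (prod_decode (c a))" "fst (prod_decode (c 0))"]) (use A in \<open>blast+\<close>)
      have "\<exists>b. Q (case_nat (\<lambda>m. Y (Suc (2 * m))) S) a b (e(x := n))" for a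
        using spec[OF Y, of a] unfolding n upd_first_case by blast
      then show "\<exists>n. P S (e(x := n))" unfolding Q(3) by blast
    qed
  qed
qed

text \<open>The formula and its negation are treated together, since \<open>Neg\<close> exchanges
  them and the negation of \<open>All\<close> is the existential case.\<close>

lemma normal_form_holds:
  "normal_form (\<lambda>S e. holds S e \<phi>) \<and> normal_form (\<lambda>S e. \<not> holds S e \<phi>)"
proof (induction \<phi>)
  case (Eq s t)
  show ?case
    by (intro conjI normal_form_atom arith_not arith_holds) (simp_all add: finite_use_intros)
next
  case (Less s t)
  show ?case
    by (intro conjI normal_form_atom arith_not arith_holds) (simp_all add: finite_use_intros)
next
  case (Mem t i)
  show ?case
    by (intro conjI normal_form_atom arith_not arith_holds) (simp_all add: finite_use_intros)
next
  case (Neg \<phi>) then show ?case by simp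
next
  case (Conj \<phi>1 \<phi>2)
  then show ?case unfolding holds.simps de_Morgan_conj
    by (intro conjI normal_form_conj normal_form_disj) simp_all
next
  case (All x \<phi>)
  show ?case unfolding holds.simps not_all
    using normal_form_all[OF conjunct1[OF All.IH]] normal_form_ex[OF conjunct2[OF All.IH]] by (rule conjI)
qed

definition continuous_matrix :: "((nat \<Rightarrow> bool) \<Rightarrow> (nat \<Rightarrow> bool) \<Rightarrow> nat \<Rightarrow> nat \<Rightarrow> bool) \<Rightarrow> bool" where
  "continuous_matrix Q \<longleftrightarrow> (\<forall>X V a c. \<exists>m. \<forall>X' V'. (\<forall>i<m. X i = X' i \<and> V i = V' i) \<longrightarrow> Q X V a c = Q X' V' a c)"

lemma Sigma11_class_normal_form:
  assumes "Sigma11_class C"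
  obtains Q where "arith (\<lambda>S e. Q (S 0) (S 1) (e 0) (e 1))" "continuous_matrix Q"
    "\<And>X. X \<in> C \<longleftrightarrow> (\<exists>V. \<forall>a. \<exists>c. Q X V a c)"
proof -
  obtain \<phi> where \<phi>: "\<And>X. X \<in> C \<longleftrightarrow> (\<exists>Y. holds ((\<lambda>_ _. False)(0 := X, 1 := Y)) (\<lambda>_. 0) \<phi>)"
    using assms unfolding Sigma11_class_def by blast
  have nf: "normal_form (\<lambda>S e. holds S e \<phi>)" using normal_form_holds by blast
  obtain R where R: "arith (\<lambda>S e. R S (e 0) (e 1) (\<lambda>i. e (Suc (Suc i))))"
      "\<And>a b e. finite_use (\<lambda>S. R S a b e)"
      "\<And>S e. holds S e \<phi> \<longleftrightarrow> (\<exists>Y. \<forall>a. \<exists>b. R (case_nat Y S) a b e)"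
    by (fact normal_formE[OF nf])
  define J :: "(nat \<Rightarrow> bool) \<Rightarrow> (nat \<Rightarrow> bool) \<Rightarrow> senv" where
    \<comment> \<open>\<open>R\<close> expects the Skolem set at index \<open>0\<close>, the point
      \<open>X\<close> at \<open>1\<close> and the original witness at \<open>2\<close>. The even
      bits of \<open>V\<close> hold the first of these, the odd bits the last.\<close>
    "J X V = (\<lambda>i m. if i = 0 then V (2 * m) else if i = 1 then X m else if i = 2 then V (Suc (2 * m)) else False)" for X V
  define Q where "Q X V a c = R (J X V) a c (\<lambda>_. 0)" for X V a c
  show thesis
  proof (rule that[of Q])
    have J: "arith (\<lambda>S e. J (S 0) (S 1) i (e 0))" for i
      unfolding J_def by (cases "i = 0"; cases "i = 1"; cases "i = 2") (simp_all add: arI)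
    have "arith (\<lambda>S e. R (\<lambda>i m. J (S 0) (S 1) i m) (e 0) (e 1) (\<lambda>i. 0))"
      by (rule arith_matrix[OF R(1)]) (intro arI J)+
    then show "arith (\<lambda>S e. Q (S 0) (S 1) (e 0) (e 1))" by (simp add: Q_def)
    show "continuous_matrix Q" unfolding continuous_matrix_def
    proof (intro allI)
      fix X V a c
      obtain m where m: "\<forall>S'. (\<forall>i<m. \<forall>j<m. J X V i j = S' i j) \<longrightarrow> R (J X V) a c (\<lambda>_. 0) = R S' a c (\<lambda>_. 0)"
        using R(2)[of a c "\<lambda>_. 0"] unfolding finite_use_def by blast
      show "\<exists>m. \<forall>X' V'. (\<forall>i<m. X i = X' i \<and> V i = V' i) \<longrightarrow> Q X V a c = Q X' V' a c"
      proof (intro exI[of _ "2 * m"] allI impI)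
        fix X' V' :: "nat \<Rightarrow> bool" assume "\<forall>i<2 * m. X i = X' i \<and> V i = V' i"
        then show "Q X V a c = Q X' V' a c"
          unfolding Q_def by (intro m[rule_format]) (simp add: J_def)
      qed
    qed
    have "(\<exists>Y W. \<forall>a. \<exists>b. R (case_nat W ((\<lambda>_ _. False)(0 := X, 1 := Y))) a b (\<lambda>_. 0)) \<longleftrightarrow>
      (\<exists>V. \<forall>a. \<exists>b. R (J X V) a b (\<lambda>_. 0))" for X
    proof
      assume "\<exists>Y W. \<forall>a. \<exists>b. R (case_nat W ((\<lambda>_ _. False)(0 := X, 1 := Y))) a b (\<lambda>_. 0)"
      then obtain Y W where *: "\<forall>a. \<exists>b. R (case_nat W ((\<lambda>_ _. False)(0 := X, 1 := Y))) a b (\<lambda>_. 0)" by blast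
      have "case_nat W ((\<lambda>_ _. False)(0 := X, 1 := Y)) = J X (\<lambda>m. if even m then W (m div 2) else Y (m div 2))"
        by (intro ext) (auto simp: J_def split: nat.split)
      from *[unfolded this] show "\<exists>V. \<forall>a. \<exists>b. R (J X V) a b (\<lambda>_. 0)"
        by (rule exI[of _ "\<lambda>m. if even m then W (m div 2) else Y (m div 2)"])
    next
      assume "\<exists>V. \<forall>a. \<exists>b. R (J X V) a b (\<lambda>_. 0)"
      then obtain V where *: "\<forall>a. \<exists>b. R (J X V) a b (\<lambda>_. 0)" ..
      have "J X V = case_nat (\<lambda>m. V (2 * m)) ((\<lambda>_ _. False)(0 := X, 1 := \<lambda>m. V (Suc (2 * m))))"
        by (intro ext) (auto simp: J_def split: nat.split)
      from *[unfolded this]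
      show "\<exists>Y W. \<forall>a. \<exists>b. R (case_nat W ((\<lambda>_ _. False)(0 := X, 1 := Y))) a b (\<lambda>_. 0)"
        by (rule exI[of "\<lambda>Y. \<exists>W. \<forall>a. \<exists>b. R (case_nat W ((\<lambda>_ _. False)(0 := X, 1 := Y))) a b (\<lambda>_. 0)", OF exI])
    qed
    then show "X \<in> C \<longleftrightarrow> (\<exists>V. \<forall>a. \<exists>c. Q X V a c)" for X
      unfolding \<phi> R(3) Q_def .
  qed
qed

section \<open>Cones in Cantor space\<close>

abbreviation fair_coins :: "(nat \<Rightarrow> bool) measure" where
  "fair_coins \<equiv> \<Pi>\<^sub>M i\<in>UNIV. measure_pmf (bernoulli_pmf (1/2))"

abbreviation lam :: "(nat \<Rightarrow> bool) set \<Rightarrow> real" where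
  "lam A \<equiv> measure cantor_measure A"

interpretation cantor: prob_space cantor_measure
  unfolding cantor_measure_def
  by (intro prob_space.prob_space_completion prob_space_PiM measure_pmf.prob_space_axioms)

lemma space_cantor [simp]: "space cantor_measure = UNIV"
  unfolding cantor_measure_def by (simp add: space_PiM)

lemma length_restr [simp]: "length (restr X n) = n"
  unfolding restr_def by simp

lemma nth_restr [simp]: "i < n \<Longrightarrow> restr X n ! i = X i"
  unfolding restr_def by simp

lemma mem_cone_eq: "X \<in> cone \<sigma> \<longleftrightarrow> restr X (length \<sigma>) = \<sigma>"
  by (simp add: cone_def)

lemma mem_cone_iff: "X \<in> cone \<sigma> \<longleftrightarrow> (\<forall>i<length \<sigma>. X i = \<sigma> ! i)"
  unfolding mem_cone_eq list_eq_iff_nth_eq by (simp cong: conj_cong)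

lemma mem_cone_restr [simp]: "X \<in> cone (restr X n)"
  by (simp add: mem_cone_eq)

lemma take_restr [simp]: "take m (restr X n) = restr X (min m n)"
  by (rule nth_equalityI) simp_all

lemma restr_cong: "(\<And>i. i < n \<Longrightarrow> X i = Y i) \<Longrightarrow> restr X n = restr Y n"
  by (rule nth_equalityI) simp_all

lemma restr_eq_iff: "restr X n = restr Y n \<longleftrightarrow> (\<forall>i<n. X i = Y i)"
  unfolding list_eq_iff_nth_eq by (simp cong: conj_cong)

lemma cone_Nil [simp]: "cone [] = UNIV"
  by (auto simp: mem_cone_iff)

lemma cone_append_subset: "cone (\<sigma> @ \<tau>) \<subseteq> cone \<sigma>"
  by (auto simp: mem_cone_iff nth_append)

lemma cone_disjoint: "length \<sigma> = length \<tau> \<Longrightarrow> \<sigma> \<noteq> \<tau> \<Longrightarrow> cone \<sigma> \<inter> cone \<tau> = {}"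
  by (auto simp: mem_cone_eq)

lemma cone_split: "cone \<sigma> = cone (\<sigma> @ [False]) \<union> cone (\<sigma> @ [True])"
  by (auto simp: mem_cone_iff nth_append less_Suc_eq)

lemma cone_eq_Collect: "cone \<sigma> = {X \<in> space fair_coins. \<forall>i\<in>{..<length \<sigma>}. X i \<in> {\<sigma> ! i}}"
  by (auto simp: mem_cone_iff space_PiM)

lemma cone_in_PiM: "cone \<sigma> \<in> sets fair_coins"
  unfolding cone_eq_Collect
  by (rule sets.sets_Collect_finite_All) (auto intro: sets_Collect_single)

lemma cone_sets [simp, intro]: "cone \<sigma> \<in> sets cantor_measure"
  using cone_in_PiM unfolding cantor_measure_def by blast

lemma lam_cone [simp]: "lam (cone \<sigma>) = (1/2) ^ length \<sigma>"
proof -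
  interpret product_prob_space "\<lambda>i::nat. measure_pmf (bernoulli_pmf (1/2))" UNIV
    by unfold_locales
  have half: "measure_pmf.prob (bernoulli_pmf (1/2)) {b} = 1/2" for b
    by (cases b) (simp_all add: measure_pmf_single)
  have "emeasure fair_coins (cone \<sigma>) = (\<Prod>i\<in>{..<length \<sigma>}. emeasure (measure_pmf (bernoulli_pmf (1/2))) {\<sigma> ! i})"
    unfolding cone_eq_Collect by (rule emeasure_PiM_Collect) auto
  also have "\<dots> = (\<Prod>i\<in>{..<length \<sigma>}. ennreal (1/2))"
    by (simp only: measure_pmf.emeasure_eq_measure half)
  also have "\<dots> = ennreal ((1/2) ^ length \<sigma>)"
    by (simp only: prod_constant card_lessThan ennreal_power)
  finally have "measure fair_coins (cone \<sigma>) = (1/2) ^ length \<sigma>"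
    by (simp add: measure_def)
  then show ?thesis
    unfolding cantor_measure_def by (simp add: cone_in_PiM)
qed

lemma UN_cone_sets [simp, intro]: "(\<Union>\<sigma>\<in>W. cone \<sigma>) \<in> sets cantor_measure"
  by (rule sets.countable_UN'') auto

lemma open_cone [simp, intro]: "open (cone \<sigma>)"
proof -
  have 1: "cone \<sigma> = (\<Inter>i\<in>{..<length \<sigma>}. (\<lambda>X. X i) -` {\<sigma> ! i})"
    unfolding set_eq_iff mem_cone_iff by blast
  have 2: "open ((\<lambda>X::nat \<Rightarrow> bool. X i) -` {b})" for i b
    by (rule open_vimage[OF Topological_Spaces.open_discrete continuous_on_product_coordinates])
  show ?thesis unfolding 1 by (intro open_INT finite_lessThan ballI 2)
qed

text \<open>Agreement of inner and outer measure gives measurability because the measure is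
  complete: \<open>C\<close> differs from a union of inner sets by a subset of a null set.\<close>

lemma cantor_squeeze_sets:
  assumes "\<And>m::nat. \<exists>F G. F \<in> sets cantor_measure \<and> G \<in> sets cantor_measure \<and> F \<subseteq> C \<and> C \<subseteq> G \<and>
    lam G \<le> lam F + 2 * (1/2) ^ m"
  shows "C \<in> sets cantor_measure"
proof -
  have "\<forall>m. \<exists>p. fst p \<in> sets cantor_measure \<and> snd p \<in> sets cantor_measure \<and> fst p \<subseteq> C \<and> C \<subseteq> snd p \<and>
    lam (snd p) \<le> lam (fst p) + 2 * (1/2) ^ m"
    using assms by simp
  from choice[OF this] obtain p where p: "\<forall>m. fst (p m) \<in> sets cantor_measure \<and>
    snd (p m) \<in> sets cantor_measure \<and> fst (p m) \<subseteq> C \<and> C \<subseteq> snd (p m) \<and>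
    lam (snd (p m)) \<le> lam (fst (p m)) + 2 * (1/2) ^ m" ..
  define F G where "F m = fst (p m)" and "G m = snd (p m)" for m
  have FG: "\<And>m. F m \<in> sets cantor_measure" "\<And>m. G m \<in> sets cantor_measure"
      "\<And>m. F m \<subseteq> C" "\<And>m. C \<subseteq> G m" "\<And>m. lam (G m) \<le> lam (F m) + 2 * (1/2) ^ m"
    using p by (simp_all add: F_def G_def)
  let ?F = "\<Union>m. F m" and ?G = "\<Inter>m. G m"
  have sets: "?F \<in> sets cantor_measure" "?G \<in> sets cantor_measure" using FG by auto
  have sub: "?F \<subseteq> C" "C \<subseteq> ?G" using FG(3) FG(4) by blast+
  have le: "lam (?G - ?F) \<le> 2 * (1/2) ^ m" for m
  proof -
    have "lam (?G - ?F) \<le> lam (G m - F m)"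
      by (rule cantor.finite_measure_mono) (use FG(1,2) in auto)
    also have "\<dots> = lam (G m) - lam (F m)"
      by (rule cantor.finite_measure_Diff) (use FG(1,2) FG(3)[of m] FG(4)[of m] in auto)
    finally show ?thesis using FG(5)[of m] by linarith
  qed
  have lim: "(\<lambda>m. 2 * (1/2) ^ m :: real) \<longlonglongrightarrow> 2 * 0"
    by (intro tendsto_intros LIMSEQ_power_zero) simp
  have "lam (?G - ?F) \<le> 2 * 0"
    by (rule LIMSEQ_le_const[OF lim]) (use le in blast)
  then have "lam (?G - ?F) = 0" by (simp add: antisym)
  then have "?G - ?F \<in> null_sets cantor_measure"
    using sets by (intro null_setsI) (auto simp: cantor.emeasure_eq_measure)
  then have "C - ?F \<in> null_sets cantor_measure"
    unfolding cantor_measure_def by (rule null_sets_completion_subset[rotated]) (use sub in auto)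
  then have "?F \<union> (C - ?F) \<in> sets cantor_measure" using sets by (intro sets.Un) auto
  moreover have "?F \<union> (C - ?F) = C" using sub by blast
  ultimately show ?thesis by simp
qed

text \<open>
  Open sets are represented by predicates on strings, relative to a root \<open>\<tau>\<close>; for upward closed
  predicates the relative measure is the limit of the densities at the finite levels.
\<close>

definition above :: "bool list \<Rightarrow> (bool list \<Rightarrow> bool) \<Rightarrow> (nat \<Rightarrow> bool) set" where
  "above \<tau> W = (\<Union>u\<in>{u. W u}. cone (\<tau> @ u))"

definition upward :: "(bool list \<Rightarrow> bool) \<Rightarrow> bool" where
  "upward W \<longleftrightarrow> (\<forall>u v. W u \<longrightarrow> W (u @ v))"

definition count_at :: "(bool list \<Rightarrow> bool) \<Rightarrow> nat \<Rightarrow> nat" where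
  "count_at W n = card {u. length u = n \<and> W u}"

lemma above_sets [simp, intro]: "above \<tau> W \<in> sets cantor_measure"
  unfolding above_def by (rule sets.countable_UN'') auto

lemma above_mono: "(\<And>u. W u \<Longrightarrow> W' u) \<Longrightarrow> above \<tau> W \<subseteq> above \<tau> W'"
  unfolding above_def by blast

lemma mem_cone_append: "X \<in> cone (\<tau> @ u) \<longleftrightarrow> X \<in> cone \<tau> \<and> (\<lambda>i. X (length \<tau> + i)) \<in> cone u"
proof
  assume *: "X \<in> cone (\<tau> @ u)"
  have "X (length \<tau> + i) = u ! i" if "i < length u" for i
    using *[unfolded mem_cone_iff, rule_format, of "length \<tau> + i"] that by simp
  then show "X \<in> cone \<tau> \<and> (\<lambda>i. X (length \<tau> + i)) \<in> cone u"
    using subsetD[OF cone_append_subset *] by (simp add: mem_cone_iff)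
next
  assume *: "X \<in> cone \<tau> \<and> (\<lambda>i. X (length \<tau> + i)) \<in> cone u"
  show "X \<in> cone (\<tau> @ u)" unfolding mem_cone_iff
  proof (intro allI impI)
    fix i assume "i < length (\<tau> @ u)"
    then show "X i = (\<tau> @ u) ! i"
      using * unfolding mem_cone_iff by (cases "i < length \<tau>") (auto simp: nth_append dest: spec[of _ "i - length \<tau>"])
  qed
qed

lemma mem_above_iff: "X \<in> above \<tau> W \<longleftrightarrow> X \<in> cone \<tau> \<and> (\<exists>n. W (restr (\<lambda>i. X (length \<tau> + i)) n))"
proof -
  have "(\<exists>u. W u \<and> Y \<in> cone u) \<longleftrightarrow> (\<exists>n. W (restr Y n))" for Y
    by (metis mem_cone_eq mem_cone_restr)
  then show ?thesis unfolding above_def mem_Collect_eq by (auto simp: mem_cone_append)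
qed

lemma upwardD: "upward W \<Longrightarrow> W (restr X m) \<Longrightarrow> m \<le> n \<Longrightarrow> W (restr X n)"
proof -
  assume "upward W" "W (restr X m)" "m \<le> n"
  then have "W (restr X m @ drop m (restr X n))" by (simp add: upward_def)
  moreover have "restr X m = take m (restr X n)" using \<open>m \<le> n\<close> by (simp add: min_absorb1)
  ultimately show "W (restr X n)" by (metis append_take_drop_id)
qed

lemma lam_above_level:
  "lam (above \<tau> (\<lambda>u. length u = n \<and> W u)) = count_at W n / 2 ^ (length \<tau> + n)"
proof -
  let ?U = "{u. length u = n \<and> W u}"
  have "lam (above \<tau> (\<lambda>u. length u = n \<and> W u)) = (\<Sum>u\<in>?U. lam (cone (\<tau> @ u)))"
    unfolding above_def
    by (rule cantor.finite_measure_finite_Union)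
      (auto simp: finite_length_eq disjoint_family_on_def intro!: cone_disjoint)
  also have "\<dots> = (\<Sum>u\<in>?U. (1/2) ^ (length \<tau> + n))" by (intro sum.cong) auto
  also have "\<dots> = count_at W n / 2 ^ (length \<tau> + n)"
    by (simp add: count_at_def power_divide)
  finally show ?thesis .
qed

lemma above_level_mono:
  assumes "upward W" "m \<le> n"
  shows "above \<tau> (\<lambda>u. length u = m \<and> W u) \<subseteq> above \<tau> (\<lambda>u. length u = n \<and> W u)"
  by (auto simp: mem_above_iff intro: upwardD[OF assms(1) _ assms(2)])

lemma above_eq_UN_level: "above \<tau> W = (\<Union>n. above \<tau> (\<lambda>u. length u = n \<and> W u))"
  unfolding above_def by auto

lemma count_at_tendsto:
  assumes "upward W"
  shows "(\<lambda>n. count_at W n / 2 ^ n) \<longlonglongrightarrow> 2 ^ length \<tau> * lam (above \<tau> W)"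
proof -
  have "(\<lambda>n. lam (above \<tau> (\<lambda>u. length u = n \<and> W u))) \<longlonglongrightarrow> lam (above \<tau> W)"
    unfolding above_eq_UN_level[of \<tau> W]
    by (rule cantor.finite_Lim_measure_incseq) (auto intro!: incseq_SucI above_level_mono[OF assms])
  then have "(\<lambda>n. 2 ^ length \<tau> * (count_at W n / 2 ^ (length \<tau> + n))) \<longlonglongrightarrow> 2 ^ length \<tau> * lam (above \<tau> W)"
    unfolding lam_above_level by (rule tendsto_mult_left)
  then show ?thesis by (simp add: power_add)
qed

lemma lam_above:
  assumes "upward W"
  shows "lam (above \<tau> W) = lam (above [] W) / 2 ^ length \<tau>"
  using LIMSEQ_unique[OF count_at_tendsto[OF assms, of \<tau>] count_at_tendsto[OF assms, of "[]"]]
  by (simp add: field_simps)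

lemma count_at_le:
  assumes "upward W"
  shows "count_at W n / 2 ^ n \<le> lam (above [] W)"
proof -
  have "lam (above [] (\<lambda>u. length u = n \<and> W u)) \<le> lam (above [] W)"
    by (rule cantor.finite_measure_mono) (auto intro!: above_mono)
  then show ?thesis by (simp add: lam_above_level)
qed

lemma count_at_gt:
  assumes "upward W" "r < lam (above [] W)"
  obtains n where "r < count_at W n / 2 ^ n"
  using order_tendstoD(1)[OF count_at_tendsto[OF assms(1), of "[]"], of r] assms(2)
  by (auto simp: eventually_sequentially)

section \<open>Open lower limits\<close>

text \<open>
  \<open>cutoff H j s N\<close>: the finite intersection of \<open>H j, ..., H N\<close> exceeds the infinite one in measure by at
  most \<open>2 ^ -s\<close>. The union over \<open>j\<close> of these finite intersections is open, contains the lower limit of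
  the sequence and is not much larger. Least choice of \<open>N\<close> makes the construction unique, and
  denominators are cleared to keep it arithmetical.
\<close>

definition meet :: "(nat \<Rightarrow> bool list \<Rightarrow> bool) \<Rightarrow> nat \<Rightarrow> nat \<Rightarrow> bool list \<Rightarrow> bool" where
  "meet H j N u \<longleftrightarrow> (\<forall>i\<le>N. j \<le> i \<longrightarrow> H i u)"

definition near :: "(bool list \<Rightarrow> bool) \<Rightarrow> (bool list \<Rightarrow> bool) \<Rightarrow> nat \<Rightarrow> bool" where
  "near W W' s \<longleftrightarrow> (\<forall>n. \<exists>m. count_at W n * 2 ^ m * 2 ^ s \<le> count_at W' m * 2 ^ n * 2 ^ s + 2 ^ n * 2 ^ m)"

definition cutoff :: "(nat \<Rightarrow> bool list \<Rightarrow> bool) \<Rightarrow> nat \<Rightarrow> nat \<Rightarrow> nat \<Rightarrow> bool" where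
  "cutoff H j s N \<longleftrightarrow> (\<forall>M\<ge>N. near (meet H j N) (meet H j M) s) \<and>
     (\<forall>N'<N. \<not> (\<forall>M\<ge>N'. near (meet H j N') (meet H j M) s))"

definition open_liminf :: "(nat \<Rightarrow> bool list \<Rightarrow> bool) \<Rightarrow> nat \<Rightarrow> bool list \<Rightarrow> bool" where
  "open_liminf H s u \<longleftrightarrow> (\<exists>j N. cutoff H j (s + j) N \<and> meet H j N u)"

abbreviation mu :: "(bool list \<Rightarrow> bool) \<Rightarrow> real" where
  "mu W \<equiv> lam (above [] W)"

lemma scaled_le_iff:
  fixes a b m n s :: nat
  shows "a * 2 ^ m * 2 ^ s \<le> b * 2 ^ n * 2 ^ s + 2 ^ n * 2 ^ m \<longleftrightarrow>
    real a / 2 ^ n \<le> real b / 2 ^ m + 1 / 2 ^ s"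
proof -
  have "real a / 2 ^ n \<le> real b / 2 ^ m + 1 / 2 ^ s \<longleftrightarrow>
    real a * 2 ^ m * 2 ^ s \<le> real b * 2 ^ n * 2 ^ s + 2 ^ n * 2 ^ m"
    by (simp add: field_simps)
  also have "\<dots> \<longleftrightarrow> real (a * 2 ^ m * 2 ^ s) \<le> real (b * 2 ^ n * 2 ^ s + 2 ^ n * 2 ^ m)" by simp
  finally show ?thesis by (simp only: of_nat_le_iff)
qed

lemma near_iff:
  "near W W' s \<longleftrightarrow> (\<forall>n. \<exists>m. count_at W n / 2 ^ n \<le> count_at W' m / 2 ^ m + 1 / 2 ^ s)"
  unfolding near_def scaled_le_iff ..

text \<open>With the converse \<open>nearI\<close>, the arithmetical relation \<open>near\<close> is
  squeezed between the strict and the weak inequality of the measures. This precision is enough, and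
  the reals themselves never have to be compared inside a formula.\<close>

lemma nearD:
  assumes "upward W" "upward W'" "near W W' s"
  shows "mu W \<le> mu W' + 1 / 2 ^ s"
proof (rule LIMSEQ_le_const2)
  show "(\<lambda>n. count_at W n / 2 ^ n) \<longlonglongrightarrow> mu W"
    using count_at_tendsto[OF assms(1), of "[]"] by simp
  have "count_at W n / 2 ^ n \<le> mu W' + 1 / 2 ^ s" for n
  proof -
    obtain m where "count_at W n / 2 ^ n \<le> count_at W' m / 2 ^ m + 1 / 2 ^ s"
      using assms(3) unfolding near_iff by blast
    then show ?thesis using count_at_le[OF assms(2), of m] by linarith
  qed
  then show "\<exists>N. \<forall>n\<ge>N. count_at W n / 2 ^ n \<le> mu W' + 1 / 2 ^ s" by blast
qed

lemma nearI:
  assumes "upward W" "upward W'" "mu W < mu W' + 1 / 2 ^ s"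
  shows "near W W' s"
  unfolding near_iff
proof
  fix n
  obtain m where "mu W - 1 / 2 ^ s < count_at W' m / 2 ^ m"
    using count_at_gt[OF assms(2), of "mu W - 1 / 2 ^ s"] assms(3) by (metis less_diff_eq diff_less_eq)
  then show "\<exists>m. count_at W n / 2 ^ n \<le> count_at W' m / 2 ^ m + 1 / 2 ^ s"
    using count_at_le[OF assms(1), of n] by (intro exI[of _ m]) linarith
qed

lemma upward_meet: "(\<And>i. upward (H i)) \<Longrightarrow> upward (meet H j N)"
  unfolding upward_def meet_def by blast

lemma upward_open_liminf: "(\<And>i. upward (H i)) \<Longrightarrow> upward (open_liminf H s)"
  using upward_meet[of H] unfolding upward_def open_liminf_def by blast

lemma above_Nil_iff: "X \<in> above [] W \<longleftrightarrow> (\<exists>n. W (restr X n))"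
  by (simp add: mem_above_iff)

lemma above_meet:
  assumes "\<And>i. upward (H i)"
  shows "above [] (meet H j N) = (\<Inter>i\<in>{j..N}. above [] (H i))"
proof (intro equalityI subsetI)
  fix X assume "X \<in> above [] (meet H j N)"
  then show "X \<in> (\<Inter>i\<in>{j..N}. above [] (H i))" by (auto simp: above_Nil_iff meet_def)
next
  fix X assume "X \<in> (\<Inter>i\<in>{j..N}. above [] (H i))"
  then have "\<forall>i\<in>{j..N}. \<exists>n. H i (restr X n)" by (simp add: above_Nil_iff)
  from bchoice[OF this] obtain n where n: "\<forall>i\<in>{j..N}. H i (restr X (n i))" ..
  have "H i (restr X (\<Sum>i\<in>{j..N}. n i))" if "i \<in> {j..N}" for i
  proof (rule upwardD[OF assms])
    show "H i (restr X (n i))" using n that by blast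
    show "n i \<le> (\<Sum>i\<in>{j..N}. n i)" using that by (intro member_le_sum) auto
  qed
  then have "meet H j N (restr X (\<Sum>i\<in>{j..N}. n i))" by (simp add: meet_def)
  then show "X \<in> above [] (meet H j N)" by (auto simp: above_Nil_iff)
qed

lemma cutoff_ex:
  assumes "\<And>i. upward (H i)" shows "\<exists>N. cutoff H j s N"
proof -
  let ?m = "\<lambda>N. mu (meet H j N)"
  have bdd: "bdd_below (range ?m)" by (rule bdd_belowI[of _ 0]) auto
  have "Inf (range ?m) < Inf (range ?m) + 1 / 2 ^ s" by simp
  then obtain N where N: "?m N < Inf (range ?m) + 1 / 2 ^ s"
    using cInf_lessD[of "range ?m" "Inf (range ?m) + 1 / 2 ^ s"] by auto
  have "near (meet H j N) (meet H j M) s" for M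
  proof (rule nearI)
    have "Inf (range ?m) \<le> ?m M" using bdd by (intro cInf_lower) auto
    then show "?m N < ?m M + 1 / 2 ^ s" using N by linarith
  qed (rule upward_meet[OF assms])+
  then have ex: "\<exists>N. \<forall>M\<ge>N. near (meet H j N) (meet H j M) s" by blast
  show ?thesis unfolding cutoff_def
    by (rule exI[of _ "LEAST N. \<forall>M\<ge>N. near (meet H j N) (meet H j M) s"])
      (use LeastI_ex[OF ex] not_less_Least[of _ "\<lambda>N. \<forall>M\<ge>N. near (meet H j N) (meet H j M) s"] in blast)
qed

lemma cutoff_unique: "cutoff H j s N \<Longrightarrow> cutoff H j s M \<Longrightarrow> N = M"
  unfolding cutoff_def by (rule linorder_cases[of N M]) blast+

lemma open_liminfI:
  assumes "cutoff H j (s + j) N" shows "meet H j N u \<Longrightarrow> open_liminf H s u"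
  using assms unfolding open_liminf_def by blast

text \<open>The lower limit is the increasing union of the sets \<open>D j\<close>, each inside some
  \<open>A j\<close>, so it has measure at most \<open>r\<close>. Cutting off the
  \<open>j\<close>-th intersection costs at most \<open>2 ^ -(s + j)\<close>, and these costs add up
  to \<open>2 / 2 ^ s\<close>.\<close>

lemma mu_open_liminf:
  assumes up: "\<And>i. upward (H i)" and r: "\<And>i. mu (H i) \<le> r"
  shows "mu (open_liminf H s) \<le> r + 2 / 2 ^ s"
proof -
  have "\<forall>j. \<exists>N. cutoff H j (s + j) N" using cutoff_ex[of H, OF up] by blast
  from choice[OF this] obtain c where c: "\<forall>j. cutoff H j (s + j) (c j)" ..
  define A where "A i = above [] (H i)" for i
  define G where "G j = above [] (meet H j (c j))" for j
  define D where "D j = (\<Inter>i\<in>{j..}. A i)" for j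
  have [simp, intro]: "A i \<in> sets cantor_measure" "G i \<in> sets cantor_measure" "D i \<in> sets cantor_measure" for i
    unfolding A_def G_def D_def by auto
  have G_sub: "above [] (open_liminf H s) \<subseteq> (\<Union>j. D j) \<union> (\<Union>j. G j - D j)"
  proof
    fix X assume "X \<in> above [] (open_liminf H s)"
    then obtain n j N where "cutoff H j (s + j) N" "meet H j N (restr X n)"
      by (auto simp: above_Nil_iff open_liminf_def)
    then have "X \<in> G j" using cutoff_unique[of H j "s + j" N "c j"] c by (auto simp: G_def above_Nil_iff)
    then show "X \<in> (\<Union>j. D j) \<union> (\<Union>j. G j - D j)" by blast
  qed
  have G_eq: "G j = (\<Inter>i\<in>{j..c j}. A i)" for j
    unfolding G_def A_def by (rule above_meet[of H, OF up])
  have D_sub_G: "D j \<subseteq> G j" for j unfolding G_eq D_def by auto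
  have diff: "lam (G j - D j) \<le> 1 / 2 ^ s * (1 / 2) ^ j" for j
  proof -
    let ?E = "\<lambda>M. \<Inter>i\<in>{j..j + M}. A i"
    have E: "?E M = above [] (meet H j (j + M))" for M
      unfolding A_def by (rule above_meet[of H, OF up, symmetric])
    have "(\<lambda>M. lam (?E M)) \<longlonglongrightarrow> lam (\<Inter>M. ?E M)"
    proof (rule cantor.finite_Lim_measure_decseq)
      show "range ?E \<subseteq> cantor.events" unfolding E by auto
      show "decseq ?E" unfolding decseq_def by auto
    qed
    moreover have "(\<Inter>M. ?E M) = D j"
    proof (intro equalityI subsetI)
      fix X assume X: "X \<in> (\<Inter>M. ?E M)"
      have "X \<in> A i" if "j \<le> i" for i
      proof -
        have "X \<in> ?E (i - j)" using X by blast
        then show ?thesis using that by auto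
      qed
      then show "X \<in> D j" by (simp add: D_def)
    qed (auto simp: D_def)
    ultimately have lim: "(\<lambda>M. lam (?E M)) \<longlonglongrightarrow> lam (D j)" by simp
    have "lam (G j) - 1 / 2 ^ (s + j) \<le> lam (D j)"
    proof (rule LIMSEQ_le_const[OF lim], intro exI[of _ "c j"] allI impI)
      fix M assume "c j \<le> M"
      then have "near (meet H j (c j)) (meet H j (j + M)) (s + j)"
        using c unfolding cutoff_def by simp
      then have "mu (meet H j (c j)) \<le> mu (meet H j (j + M)) + 1 / 2 ^ (s + j)"
        by (intro nearD upward_meet up)
      then show "lam (G j) - 1 / 2 ^ (s + j) \<le> lam (?E M)"
        unfolding E G_def by linarith
    qed
    moreover have "lam (G j - D j) = lam (G j) - lam (D j)"
      by (rule cantor.finite_measure_Diff) (use D_sub_G in auto)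
    ultimately show ?thesis by (simp add: power_add power_divide)
  qed
  have summ: "summable (\<lambda>j. 1 / 2 ^ s * (1 / 2) ^ j :: real)"
    by (intro summable_mult summable_geometric) simp
  have "lam (\<Union>j. G j - D j) \<le> (\<Sum>j. lam (G j - D j))"
    by (rule cantor.finite_measure_subadditive_countably)
      (use summable_comparison_test'[OF summ, of 0 "\<lambda>j. lam (G j - D j)"] diff in auto)
  also have "\<dots> \<le> (\<Sum>j. 1 / 2 ^ s * (1 / 2) ^ j)"
    by (rule suminf_le[OF diff _ summ])
      (use summable_comparison_test'[OF summ, of 0 "\<lambda>j. lam (G j - D j)"] diff in auto)
  also have "\<dots> = 2 / 2 ^ s"
    by (subst suminf_mult) (simp_all add: suminf_geometric)
  finally have 1: "lam (\<Union>j. G j - D j) \<le> 2 / 2 ^ s" .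
  have "(\<lambda>j. lam (D j)) \<longlonglongrightarrow> lam (\<Union>j. D j)"
    by (rule cantor.finite_Lim_measure_incseq) (auto simp: incseq_def D_def)
  moreover have "lam (D j) \<le> r" for j
  proof -
    have "lam (D j) \<le> lam (A j)" by (rule cantor.finite_measure_mono) (auto simp: D_def)
    then show ?thesis using r[of j] by (simp add: A_def)
  qed
  ultimately have 2: "lam (\<Union>j. D j) \<le> r" by (intro LIMSEQ_le_const2) auto
  have "mu (open_liminf H s) \<le> lam ((\<Union>j. D j) \<union> (\<Union>j. G j - D j))"
    by (rule cantor.finite_measure_mono[OF G_sub]) auto
  also have "\<dots> \<le> lam (\<Union>j. D j) + lam (\<Union>j. G j - D j)"
    by (rule measure_Un_le) auto
  finally show ?thesis using 1 2 by linarith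
qed

text \<open>Compactness of Cantor space, phrased without subsequences: having infinitely many
  indices at each length allows an index to be chosen that is large as well. \<open>V\<close> takes
  the bit \<open>True\<close> whenever infinitely many of the remaining \<open>y n\<close>
  do.\<close>

lemma binary_Koenig:
  fixes y :: "nat \<Rightarrow> nat \<Rightarrow> bool"
  obtains V where "\<And>m. infinite {n. restr (y n) m = restr V m}"
proof -
  define w :: "nat \<Rightarrow> bool list" where
    "w = rec_nat [] (\<lambda>m v. v @ [infinite {n. restr (y n) m = v \<and> y n m}])"
  have w: "w 0 = []" "w (Suc m) = w m @ [infinite {n. restr (y n) m = w m \<and> y n m}]" for m
    by (simp_all add: w_def)
  have len: "length (w m) = m" for m by (induction m) (simp_all add: w)
  have Suc_iff: "restr X (Suc m) = v @ [b] \<longleftrightarrow> restr X m = v \<and> X m = b" for X m v b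
    by (simp add: restr_def)
  have inf: "infinite {n. restr (y n) m = w m}" for m
  proof (induction m)
    case 0 then show ?case by (simp add: w restr_def)
  next
    case (Suc m)
    let ?b = "infinite {n. restr (y n) m = w m \<and> y n m}"
    have eq: "{n. restr (y n) (Suc m) = w (Suc m)} = {n. restr (y n) m = w m \<and> y n m = ?b}"
      by (simp add: w(2) Suc_iff)
    show ?case
    proof (cases ?b)
      case True then show ?thesis unfolding eq by simp
    next
      case False
      have "{n. restr (y n) m = w m} \<subseteq>
        {n. restr (y n) m = w m \<and> y n m} \<union> {n. restr (y n) m = w m \<and> \<not> y n m}" by blast
      from infinite_super[OF this Suc] have "infinite {n. restr (y n) m = w m \<and> \<not> y n m}"
        using False by simp
      then show ?thesis unfolding eq using False by simp
    qed
  qed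
  define V where "V i = w (Suc i) ! i" for i
  have "restr V m = w m" for m
  proof (induction m)
    case (Suc m)
    have "V m = infinite {n. restr (y n) m = w m \<and> y n m}"
      by (simp add: V_def w(2) nth_append len)
    then show ?case using Suc by (simp add: w(2) Suc_iff)
  qed (simp add: w restr_def)
  then show thesis using that[of V] inf by simp
qed

lemma continuous_matrix_modulus:
  fixes A :: "nat set" and B :: "nat \<Rightarrow> nat set"
  assumes "continuous_matrix Q" and fin: "finite A" "\<And>a. finite (B a)"
  shows "\<exists>m. \<forall>a\<in>A. \<forall>c\<in>B a. \<forall>X' V'. restr X m = restr X' m \<and> restr V m = restr V' m \<longrightarrow> Q X V a c = Q X' V' a c"
proof -
  have "\<forall>p. \<exists>m. \<forall>X' V'. (\<forall>i<m. X i = X' i \<and> V i = V' i) \<longrightarrow> Q X V (fst p) (snd p) = Q X' V' (fst p) (snd p)"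
    using assms(1) unfolding continuous_matrix_def by simp
  from choice[OF this] obtain m where
    m: "\<forall>p X' V'. (\<forall>i<m p. X i = X' i \<and> V i = V' i) \<longrightarrow> Q X V (fst p) (snd p) = Q X' V' (fst p) (snd p)" ..
  let ?P = "Sigma A B"
  have fin: "finite ?P" using fin by simp
  show ?thesis
  proof (intro exI[of _ "\<Sum>p\<in>?P. m p"] ballI allI impI)
    fix a c X' V'
    assume *: "a \<in> A" "c \<in> B a" "restr X (\<Sum>p\<in>?P. m p) = restr X' (\<Sum>p\<in>?P. m p) \<and>
      restr V (\<Sum>p\<in>?P. m p) = restr V' (\<Sum>p\<in>?P. m p)"
    have "m (a, c) \<le> (\<Sum>p\<in>?P. m p)" using * fin by (intro member_le_sum) auto
    then have "\<forall>i<m (a, c). X i = X' i \<and> V i = V' i"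
      using *(3) unfolding restr_eq_iff by auto
    then show "Q X V a c = Q X' V' a c" using m[rule_format, of "(a, c)"] by simp
  qed
qed

section \<open>Open covers of \<open>\<Sigma>\<^sup>1\<^sub>1\<close> classes\<close>

definition family :: "(nat \<Rightarrow> bool) \<Rightarrow> nat list \<Rightarrow> bool list \<Rightarrow> bool" where
  "family Y b u \<longleftrightarrow> Y (prod_encode (list_encode b, string_code u))"

text \<open>The least level that nearly exhausts \<open>W\<close>: the density at any level exceeds
  the one at \<open>N\<close> by at most \<open>2 ^ -t\<close>.\<close>

definition level_cut :: "(bool list \<Rightarrow> bool) \<Rightarrow> nat \<Rightarrow> nat \<Rightarrow> bool" where
  "level_cut W t N \<longleftrightarrow>
     (\<forall>n. count_at W n * 2 ^ N * 2 ^ t \<le> count_at W N * 2 ^ n * 2 ^ t + 2 ^ n * 2 ^ N) \<and>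
     (\<forall>N'<N. \<not> (\<forall>n. count_at W n * 2 ^ N' * 2 ^ t \<le> count_at W N' * 2 ^ n * 2 ^ t + 2 ^ n * 2 ^ N'))"

text \<open>
  A list \<open>b\<close> bounds the witnesses \<open>c\<close> for \<open>a < length b\<close>; \<open>K \<tau> b\<close> is the level \<open>length b\<close> clopen
  approximation, relative to \<open>\<tau>\<close>, of the resulting closed subset of \<open>C\<close>, and \<open>b\<close> is alive if its relative
  measure is at least \<open>p / d\<close>. In \<open>thin\<close> the tree of alive lists is well-founded. The equations in
  \<open>solves\<close> then have exactly one solution, found by recursion along the tree; quantifying
  over all solutions expresses membership in a \<open>\<Pi>\<^sup>1\<^sub>1\<close> way, without ordinal stages.
\<close>

locale Sigma11_matrix =
  fixes Q :: "(nat \<Rightarrow> bool) \<Rightarrow> (nat \<Rightarrow> bool) \<Rightarrow> nat \<Rightarrow> nat \<Rightarrow> bool"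
    and C :: "(nat \<Rightarrow> bool) set"
  assumes arith_Q: "arith (\<lambda>S e. Q (S 0) (S 1) (e 0) (e 1))"
    and continuous_Q: "continuous_matrix Q"
    and C_iff: "\<And>X. X \<in> C \<longleftrightarrow> (\<exists>V. \<forall>a. \<exists>c. Q X V a c)"
begin

text \<open>Strings stand for the points that continue them with \<open>False\<close>. By continuity
  of \<open>Q\<close> such points suffice, which turns quantifiers over points into quantifiers over
  numbers and keeps the tree of lists arithmetical.\<close>

definition good :: "nat list \<Rightarrow> bool list \<Rightarrow> bool list \<Rightarrow> bool" where
  "good b v y \<longleftrightarrow> (\<forall>a<length b. \<exists>c\<le>nthd b a. Q (bit_at v) (bit_at y) a c)"

definition K :: "bool list \<Rightarrow> nat list \<Rightarrow> bool list \<Rightarrow> bool" where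
  "K \<tau> b u \<longleftrightarrow> length u = length b \<and> (\<exists>v y. take (length \<tau> + length b) v = \<tau> @ u \<and> good b v y)"

definition alive :: "bool list \<Rightarrow> nat \<Rightarrow> nat \<Rightarrow> nat list \<Rightarrow> bool" where
  "alive \<tau> p d b \<longleftrightarrow> p * 2 ^ length b \<le> d * count_at (K \<tau> b) (length b)"

definition thin :: "bool list \<Rightarrow> nat \<Rightarrow> nat \<Rightarrow> bool" where
  "thin \<tau> p d \<longleftrightarrow> (\<forall>Y. \<not> ((\<exists>b. Y (list_encode b)) \<and>
     (\<forall>b. Y (list_encode b) \<longrightarrow> alive \<tau> p d b \<and> (\<exists>i. Y (list_encode (b @ [i]))))))"

definition solves :: "bool list \<Rightarrow> nat \<Rightarrow> nat \<Rightarrow> nat \<Rightarrow> (nat list \<Rightarrow> bool list \<Rightarrow> bool) \<Rightarrow> bool" where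
  "solves \<tau> p d \<kappa> H \<longleftrightarrow> (\<forall>b u. H b u \<longleftrightarrow>
     (if alive \<tau> p d b then open_liminf (\<lambda>i. H (b @ [i])) (\<kappa> + length b + 2) u
      else length b \<le> length u \<and> K \<tau> b (take (length b) u)))"

definition child :: "bool list \<Rightarrow> nat \<Rightarrow> nat \<Rightarrow> (nat list \<times> nat list) set" where
  "child \<tau> p d = {(b @ [i], b) |b i. alive \<tau> p d b}"

lemma wf_child:
  assumes "thin \<tau> p d" shows "wf (child \<tau> p d)"
proof (rule wfI_min, rule ccontr)
  fix x A
  assume A: "x \<in> A" "\<not> (\<exists>z\<in>A. \<forall>y. (y, z) \<in> child \<tau> p d \<longrightarrow> y \<notin> A)"
  have "alive \<tau> p d b \<and> (\<exists>i. b @ [i] \<in> A)" if "b \<in> A" for b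
  proof -
    from A(2) that have "\<exists>y. (y, b) \<in> child \<tau> p d \<and> y \<in> A" by simp
    then show ?thesis unfolding child_def by auto
  qed
  moreover have "\<not> ((\<exists>b. b \<in> A) \<and> (\<forall>b. b \<in> A \<longrightarrow> alive \<tau> p d b \<and> (\<exists>i. b @ [i] \<in> A)))"
    using spec[OF assms[unfolded thin_def], of "\<lambda>c. list_decode c \<in> A"] unfolding list_encode_inverse .
  ultimately show False using A(1) by blast
qed

lemma solves_exists:
  assumes "thin \<tau> p d" shows "\<exists>H. solves \<tau> p d \<kappa> H"
proof -
  define Fn where "Fn H b u \<longleftrightarrow> (if alive \<tau> p d b then open_liminf (\<lambda>i. H (b @ [i])) (\<kappa> + length b + 2) u
      else length b \<le> length u \<and> K \<tau> b (take (length b) u))" for H b u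
  define H where "H = wfrec (child \<tau> p d) Fn"
  have "H b u = Fn H b u" for b u
  proof -
    have "H b = Fn (cut H (child \<tau> p d) b) b"
      unfolding H_def by (rule wfrec[OF wf_child[OF assms]])
    moreover have "cut H (child \<tau> p d) b (b @ [i]) = H (b @ [i])" if "alive \<tau> p d b" for i
      using that by (simp add: cut_def child_def)
    ultimately show ?thesis unfolding Fn_def by simp
  qed
  then show ?thesis unfolding solves_def Fn_def by blast
qed

lemma solvesD:
  assumes "solves \<tau> p d \<kappa> H"
  shows "alive \<tau> p d b \<Longrightarrow> H b = open_liminf (\<lambda>i. H (b @ [i])) (\<kappa> + length b + 2)"
    "\<not> alive \<tau> p d b \<Longrightarrow> H b = (\<lambda>u. length b \<le> length u \<and> K \<tau> b (take (length b) u))"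
  by (intro ext; simp add: assms[unfolded solves_def, rule_format, of b])+

lemma thin_induct [consumes 1, case_names step]:
  assumes "thin \<tau> p d" "\<And>b. (\<And>i. alive \<tau> p d b \<Longrightarrow> P (b @ [i])) \<Longrightarrow> P b"
  shows "P b"
  using wf_child[OF assms(1)]
proof (induction b rule: wf_induct_rule)
  case (less b)
  show ?case by (rule assms(2)) (rule less, auto simp: child_def)
qed

lemma solves_unique:
  assumes "thin \<tau> p d" "solves \<tau> p d \<kappa> H" "solves \<tau> p d \<kappa> H'"
  shows "H b = H' b"
  using assms(1)
proof (induction b rule: thin_induct)
  case (step b)
  show ?case
  proof (cases "alive \<tau> p d b")
    case True
    then show ?thesis using step by (simp add: solvesD(1)[OF assms(2)] solvesD(1)[OF assms(3)])
  next
    case False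
    then show ?thesis by (simp add: solvesD(2)[OF assms(2)] solvesD(2)[OF assms(3)])
  qed
qed

lemma upward_solution:
  assumes "thin \<tau> p d" "solves \<tau> p d \<kappa> H" shows "upward (H b)"
  using assms(1)
proof (induction b rule: thin_induct)
  case (step b)
  show ?case
  proof (cases "alive \<tau> p d b")
    case True
    then show ?thesis using step by (simp add: solvesD(1)[OF assms(2)] upward_open_liminf)
  next
    case False
    then show ?thesis by (simp add: solvesD(2)[OF assms(2)] upward_def)
  qed
qed

lemma mu_dead:
  "mu (\<lambda>u. length b \<le> length u \<and> K \<tau> b (take (length b) u)) = count_at (K \<tau> b) (length b) / 2 ^ length b"
proof -
  have "above [] (\<lambda>u. length b \<le> length u \<and> K \<tau> b (take (length b) u)) =
    above [] (\<lambda>u. length u = length b \<and> K \<tau> b u)"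
    by (auto simp: above_Nil_iff min_absorb1) (rule exI[of _ "length b"], simp)
  then show ?thesis using lam_above_level[of "[]" "length b" "K \<tau> b"] by simp
qed

text \<open>Induction from the dead lists, whose relative measure is below \<open>p / d\<close> by
  definition. At an alive \<open>b\<close> the excess \<open>2 ^ -(\<kappa> + length b + 1)\<close>
  of the children and the equal cost of the open lower limit, taken with accuracy
  \<open>\<kappa> + length b + 2\<close>, add up to the excess allowed for \<open>b\<close>.\<close>

lemma mu_solution:
  assumes "thin \<tau> p d" "solves \<tau> p d \<kappa> H" "d > 0"
  shows "mu (H b) \<le> p / d + 1 / 2 ^ (\<kappa> + length b)"
  using assms(1)
proof (induction b rule: thin_induct)
  case (step b)
  show ?case
  proof (cases "alive \<tau> p d b")
    case True
    have "mu (open_liminf (\<lambda>i. H (b @ [i])) (\<kappa> + length b + 2)) \<le>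
        (p / d + 1 / 2 ^ (\<kappa> + length (b @ [0]))) + 2 / 2 ^ (\<kappa> + length b + 2)"
      by (rule mu_open_liminf) (use step True upward_solution[OF assms(1,2)] in auto)
    also have "\<dots> = p / d + 1 / 2 ^ (\<kappa> + length b)" by (simp add: field_simps)
    finally show ?thesis by (simp add: solvesD(1)[OF assms(2) True])
  next
    case False
    then have "d * count_at (K \<tau> b) (length b) < p * 2 ^ length b" by (simp add: alive_def)
    then have "real (d * count_at (K \<tau> b) (length b)) < real (p * 2 ^ length b)" by (simp only: of_nat_less_iff)
    then have "count_at (K \<tau> b) (length b) / 2 ^ length b \<le> p / d"
      using assms(3) by (simp add: field_simps)
    moreover have "0 \<le> 1 / (2::real) ^ (\<kappa> + length b)" by simp
    ultimately show ?thesis unfolding solvesD(2)[OF assms(2) False] mu_dead by linarith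
  qed
qed

lemma bit_at_restr: "i < n \<Longrightarrow> bit_at (restr X n) i = X i"
  by (simp add: bit_at_def)

lemma restr_bit_at_restr: "m \<le> n \<Longrightarrow> restr (bit_at (restr X n)) m = restr X m"
  by (rule restr_cong) (simp add: bit_at_restr)

lemma restr_add_cone:
  assumes "X \<in> cone \<tau>" shows "restr X (length \<tau> + n) = \<tau> @ restr (\<lambda>i. X (length \<tau> + i)) n"
  by (rule nth_equalityI) (use assms in \<open>auto simp: mem_cone_iff nth_append\<close>)

text \<open>Fix a witness \<open>V\<close> for \<open>X\<close> and a function \<open>g\<close>
  choosing the numbers \<open>c\<close>. Then \<open>X\<close> belongs to the set of every list
  \<open>b\<close> that dominates \<open>g\<close>. If \<open>b\<close> is alive, all children with
  last entry at least \<open>g (length b)\<close> dominate \<open>g\<close> too, so \<open>X\<close>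
  is in the lower limit. If \<open>b\<close> is dead, finite parts of \<open>X\<close> and
  \<open>V\<close> show that \<open>X\<close> passes the clopen approximation. The empty list
  dominates \<open>g\<close> trivially.\<close>

lemma solution_covers:
  assumes "thin \<tau> p d" "solves \<tau> p d \<kappa> H" "X \<in> C" "X \<in> cone \<tau>"
  shows "X \<in> above \<tau> (H [])"
proof -
  let ?X = "\<lambda>i. X (length \<tau> + i)"
  from assms(3) obtain V where "\<forall>a. \<exists>c. Q X V a c" unfolding C_iff ..
  from choice[OF this] obtain g where g: "\<forall>a. Q X V a (g a)" ..
  have "(\<forall>a<length b. g a \<le> nthd b a) \<longrightarrow> (\<exists>n. H b (restr ?X n))" for b
    using assms(1)
  proof (induction b rule: thin_induct)
    case (step b)
    show ?case
    proof
      assume b: "\<forall>a<length b. g a \<le> nthd b a"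
      show "\<exists>n. H b (restr ?X n)"
      proof (cases "alive \<tau> p d b")
        case True
        have "H (b @ [i]) = H (b @ [i]) \<and> (\<exists>n. H (b @ [i]) (restr ?X n))" if "g (length b) \<le> i" for i
          using step[OF True, of i] b that by (auto simp: nthd_def nth_append less_Suc_eq)
        then have "\<forall>i\<in>{g (length b)..}. \<exists>n. H (b @ [i]) (restr ?X n)" by simp
        from bchoice[OF this] obtain n where
          n: "\<forall>i\<in>{g (length b)..}. H (b @ [i]) (restr ?X (n i))" ..
        obtain N where N: "cutoff (\<lambda>i. H (b @ [i])) (g (length b)) (\<kappa> + length b + 2 + g (length b)) N"
          using cutoff_ex[of "\<lambda>i. H (b @ [i])"] upward_solution[OF assms(1,2)] by blast
        have "meet (\<lambda>i. H (b @ [i])) (g (length b)) N (restr ?X (\<Sum>i\<le>N. n i))"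
          unfolding meet_def
        proof (intro allI impI)
          fix i assume i: "i \<le> N" "g (length b) \<le> i"
          show "H (b @ [i]) (restr ?X (\<Sum>i\<le>N. n i))"
          proof (rule upwardD[OF upward_solution[OF assms(1,2)]])
            show "H (b @ [i]) (restr ?X (n i))" using n i by simp
            show "n i \<le> (\<Sum>i\<le>N. n i)" using i by (intro member_le_sum) auto
          qed
        qed
        from open_liminfI[OF N this] show ?thesis unfolding solvesD(1)[OF assms(2) True] by blast
      next
        case False
        obtain m where m: "\<forall>a\<in>{..<length b}. \<forall>c\<in>{g a}. \<forall>X' V'. restr X m = restr X' m \<and>
            restr V m = restr V' m \<longrightarrow> Q X V a c = Q X' V' a c"
          using continuous_matrix_modulus[OF continuous_Q, of "{..<length b}" "\<lambda>a. {g a}" X V] by auto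
        define M where "M = m + length \<tau> + length b"
        have "good b (restr X M) (restr V M)" unfolding good_def
        proof (intro allI impI)
          fix a assume a: "a < length b"
          have "Q X V a (g a) = Q (bit_at (restr X M)) (bit_at (restr V M)) a (g a)"
            by (rule m[rule_format]) (use a in \<open>auto simp: restr_bit_at_restr M_def\<close>)
          then show "\<exists>c\<le>nthd b a. Q (bit_at (restr X M)) (bit_at (restr V M)) a c" using g b a by auto
        qed
        moreover have "take (length \<tau> + length b) (restr X M) = \<tau> @ restr ?X (length b)"
          using restr_add_cone[OF assms(4)] by (simp add: M_def min_def)
        ultimately have "\<exists>v y. take (length \<tau> + length b) v = \<tau> @ restr ?X (length b) \<and> good b v y"
          by blast
        then have "K \<tau> b (restr ?X (length b))" unfolding K_def by simp
        then show ?thesis unfolding solvesD(2)[OF assms(2) False] by (intro exI[of _ "length b"]) simp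
      qed
    qed
  qed
  from this[of "[]"] show ?thesis using assms(4) by (simp add: mem_above_iff)
qed

text \<open>Along an infinite path of alive lists the clopen sets \<open>A n\<close> decrease and
  keep relative measure at least \<open>p / d\<close>; \<open>F\<close> is their intersection. For
  \<open>X \<in> F\<close> the finite witnesses have a cluster point \<open>V\<close>. Since the
  path bounds the candidates for \<open>c\<close> by \<open>g a\<close>, finitely many instances of
  \<open>Q\<close> have a common modulus, and one of them passes to the limit
  \<open>(X, V)\<close>.\<close>

lemma not_thin_inner:
  assumes "\<not> thin \<tau> p d" "d > 0"
  obtains F where "F \<in> sets cantor_measure" "F \<subseteq> C \<inter> cone \<tau>" "p / d / 2 ^ length \<tau> \<le> lam F"
proof -
  obtain Y where Y0: "\<exists>b. Y (list_encode b)"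
    and YS: "\<forall>b. Y (list_encode b) \<longrightarrow> alive \<tau> p d b \<and> (\<exists>i. Y (list_encode (b @ [i])))"
    using assms(1) unfolding thin_def by blast
  \<comment> \<open>The path may start at any list; the entries of \<open>b0\<close> then serve as
    the first bounds.\<close>
  obtain b0 where b0: "Y (list_encode b0)" using Y0 ..
  define f where "f = rec_nat b0 (\<lambda>_ b. b @ [SOME i. Y (list_encode (b @ [i]))])"
  have f: "f 0 = b0" "f (Suc n) = f n @ [SOME i. Y (list_encode (f n @ [i]))]" for n
    by (simp_all add: f_def)
  have Yf: "Y (list_encode (f n))" for n
  proof (induction n)
    case (Suc n)
    then have "\<exists>i. Y (list_encode (f n @ [i]))" using YS by blast
    from someI_ex[OF this] show ?case by (simp add: f(2))
  qed (simp add: f b0)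
  have len: "length (f n) = length b0 + n" for n by (induction n) (simp_all add: f)
  have f_nth: "f m ! a = f n ! a" if "n \<le> m" "a < length (f n)" for a m n
    using that
  proof (induction m rule: dec_induct)
    case (step m)
    then show ?case by (simp add: f(2) nth_append len)
  qed simp
  \<comment> \<open>As \<open>b0\<close> may be empty, \<open>f (Suc a)\<close> is the first list
    certain to have an entry at \<open>a\<close>.\<close>
  define g where "g a = f (Suc a) ! a" for a
  have g: "nthd (f n) a = g a" if "a < length (f n)" for a n
  proof (cases "n \<le> Suc a")
    case True
    then show ?thesis using f_nth[OF True that] that by (simp add: nthd_def g_def)
  next
    case False
    then show ?thesis using f_nth[of "Suc a" n a] that by (simp add: nthd_def g_def len)
  qed
  define A where "A n = above \<tau> (\<lambda>u. length u = length (f n) \<and> K \<tau> (f n) u)" for n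
  have mem_A: "X \<in> A n \<longleftrightarrow> X \<in> cone \<tau> \<and> K \<tau> (f n) (restr (\<lambda>i. X (length \<tau> + i)) (length (f n)))" for X n
    by (auto simp: A_def mem_above_iff)
  have A_sets: "A n \<in> sets cantor_measure" for n by (simp add: A_def)
  have A_Suc: "A (Suc n) \<subseteq> A n" for n
  proof
    fix X assume X: "X \<in> A (Suc n)"
    then have cone: "X \<in> cone \<tau>" by (simp add: mem_A)
    from X obtain v y where v: "take (length \<tau> + length (f (Suc n))) v =
        \<tau> @ restr (\<lambda>i. X (length \<tau> + i)) (length (f (Suc n)))" and y: "good (f (Suc n)) v y"
      unfolding mem_A K_def by blast
    have "take (length \<tau> + length (f n)) v = take (length \<tau> + length (f n)) (take (length \<tau> + length (f (Suc n))) v)"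
      by (simp add: len min_def)
    also have "\<dots> = \<tau> @ restr (\<lambda>i. X (length \<tau> + i)) (length (f n))"
      unfolding v by (simp add: len min_def)
    finally have "take (length \<tau> + length (f n)) v = \<tau> @ restr (\<lambda>i. X (length \<tau> + i)) (length (f n))" .
    moreover have "good (f n) v y"
      using y unfolding good_def by (auto simp: g len)
    ultimately have "\<exists>v y. take (length \<tau> + length (f n)) v = \<tau> @ restr (\<lambda>i. X (length \<tau> + i)) (length (f n)) \<and> good (f n) v y"
      by blast
    then show "X \<in> A n" using cone unfolding mem_A K_def by simp
  qed
  have dec: "decseq A" by (intro decseq_SucI A_Suc)
  define F where "F = (\<Inter>n. A n)"
  have lim: "(\<lambda>n. lam (A n)) \<longlonglongrightarrow> lam F"
    unfolding F_def by (rule cantor.finite_Lim_measure_decseq) (use dec A_sets in auto)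
  have "p / d / 2 ^ length \<tau> \<le> lam (A n)" for n
  proof -
    have "alive \<tau> p d (f n)" using YS Yf by blast
    then have "real (p * 2 ^ length (f n)) \<le> real (d * count_at (K \<tau> (f n)) (length (f n)))"
      unfolding alive_def by (simp only: of_nat_le_iff)
    then show ?thesis using assms(2)
      unfolding A_def lam_above_level by (simp add: field_simps power_add)
  qed
  then have "p / d / 2 ^ length \<tau> \<le> lam F" by (intro LIMSEQ_le_const[OF lim]) blast
  moreover have "F \<subseteq> C \<inter> cone \<tau>"
  proof
    fix X assume X: "X \<in> F"
    then have XA: "X \<in> A n" for n by (simp add: F_def)
    then have cone: "X \<in> cone \<tau>" by (simp add: mem_A)
    have "\<forall>n. \<exists>q. take (length \<tau> + length (f n)) (fst q) =
        \<tau> @ restr (\<lambda>i. X (length \<tau> + i)) (length (f n)) \<and> good (f n) (fst q) (snd q)"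
      using XA unfolding mem_A K_def by simp
    from choice[OF this] obtain q where q: "\<forall>n. take (length \<tau> + length (f n)) (fst (q n)) =
        \<tau> @ restr (\<lambda>i. X (length \<tau> + i)) (length (f n)) \<and> good (f n) (fst (q n)) (snd (q n))" ..
    have vX: "restr (bit_at (fst (q n))) m = restr X m" if "m \<le> length \<tau> + length (f n)" for n m
    proof (rule restr_cong)
      fix i assume i: "i < m"
      have *: "take (length \<tau> + length (f n)) (fst (q n)) = restr X (length \<tau> + length (f n))"
        using q restr_add_cone[OF cone] by simp
      then have l: "length \<tau> + length (f n) \<le> length (fst (q n))"
        by (metis length_restr length_take min.absorb_iff2 min.commute)
      have "fst (q n) ! i = X i"
        using arg_cong[OF *, of "\<lambda>xs. xs ! i"] i that by simp
      then show "bit_at (fst (q n)) i = X i" using l i that by (simp add: bit_at_def)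
    qed
    obtain V where V: "\<And>m. infinite {n. restr (bit_at (snd (q n))) m = restr V m}"
      using binary_Koenig[of "\<lambda>n. bit_at (snd (q n))"] by blast
    have "\<exists>c. Q X V a c" for a
    proof -
      obtain m where m: "\<forall>a'\<in>{a}. \<forall>c\<in>{..g a}. \<forall>X' V'. restr X m = restr X' m \<and>
          restr V m = restr V' m \<longrightarrow> Q X V a' c = Q X' V' a' c"
        using continuous_matrix_modulus[OF continuous_Q, of "{a}" "\<lambda>_. {..g a}" X V] by auto
      obtain n where n: "n > m + a" "restr (bit_at (snd (q n))) m = restr V m"
        using V[of m] unfolding infinite_nat_iff_unbounded by blast
      have "a < length (f n)" using n by (simp add: len)
      then obtain c where c: "c \<le> g a" "Q (bit_at (fst (q n))) (bit_at (snd (q n))) a c"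
        using q g unfolding good_def by metis
      have "Q X V a c = Q (bit_at (fst (q n))) (bit_at (snd (q n))) a c"
        by (rule m[rule_format]) (use c n vX[of m n] in \<open>auto simp: len\<close>)
      then show ?thesis using c by blast
    qed
    then have "X \<in> C" unfolding C_iff by blast
    then show "X \<in> C \<inter> cone \<tau>" using cone by blast
  qed
  moreover have "F \<in> sets cantor_measure" unfolding F_def using A_sets by auto
  ultimately show thesis using that by blast
qed

lemma count_at_le_power: "count_at W n \<le> 2 ^ n"
proof -
  have "count_at W n \<le> card {u::bool list. length u = n}"
    unfolding count_at_def by (rule card_mono) (use finite_length_eq[of n "\<lambda>_. True"] in auto)
  also have "\<dots> = 2 ^ n" using card_lists_length_eq[of "UNIV :: bool set" n] by simp
  finally show ?thesis .
qed

text \<open>For \<open>p = d + 1\<close> no list is alive, for \<open>p = 0\<close> all are, so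
  there is a least thin \<open>p > 0\<close>. Thinness at \<open>p\<close> gives a cover and its
  failure at \<open>p - 1\<close> an inner set. With \<open>d = 2 ^ m\<close> the measures differ by
  at most one grid step plus the excess of the cover, both equal to \<open>2 ^ -m\<close>.\<close>

lemma C_sets: "C \<in> sets cantor_measure"
proof (rule cantor_squeeze_sets)
  fix m :: nat
  define d :: nat where "d = 2 ^ m"
  have d: "d > 0" by (simp add: d_def)
  have "\<not> alive [] (Suc d) d b" for b
  proof
    assume "alive [] (Suc d) d b"
    then have "Suc d * 2 ^ length b \<le> d * count_at (K [] b) (length b)" by (simp add: alive_def)
    also have "\<dots> \<le> d * 2 ^ length b" by (intro mult_left_mono count_at_le_power) simp
    finally show False by simp
  qed
  then have "thin [] (Suc d) d" unfolding thin_def by blast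
  then have ex: "\<exists>p. thin [] p d" by blast
  define p where "p = (LEAST p. thin [] p d)"
  have p: "thin [] p d" unfolding p_def by (rule LeastI_ex[OF ex])
  have "\<not> thin [] 0 d" unfolding thin_def alive_def by auto
  then have "p \<noteq> 0" using p by metis
  then have p1: "\<not> thin [] (p - 1) d" unfolding p_def by (intro not_less_Least) (simp add: p_def)
  obtain F where F: "F \<in> sets cantor_measure" "F \<subseteq> C \<inter> cone []" "real (p - 1) / d / 2 ^ length ([]::bool list) \<le> lam F"
    using not_thin_inner[OF p1 d] .
  obtain H where H: "solves [] p d m H" using solves_exists[OF p] ..
  have "mu (H []) \<le> p / d + 1 / 2 ^ m" using mu_solution[OF p H d, of "[]"] by simp
  moreover have "real p / d = real (p - 1) / d + 1 / 2 ^ m"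
    using \<open>p \<noteq> 0\<close> by (simp add: d_def add_divide_distrib[symmetric] of_nat_diff)
  ultimately have "mu (H []) \<le> lam F + 2 * (1/2) ^ m" using F(3) by (simp add: power_divide)
  moreover have "C \<subseteq> above [] (H [])" using solution_covers[OF p H] by auto
  ultimately show "\<exists>F G. F \<in> sets cantor_measure \<and> G \<in> sets cantor_measure \<and> F \<subseteq> C \<and> C \<subseteq> G \<and>
    lam G \<le> lam F + 2 * (1/2) ^ m"
    using F by (intro exI[of _ F] exI[of _ "above [] (H [])"]) auto
qed

lemma thin_lam_le:
  assumes "thin \<tau> p d" "d > 0" shows "lam (C \<inter> cone \<tau>) \<le> p / d / 2 ^ length \<tau>"
proof -
  have "lam (C \<inter> cone \<tau>) \<le> (p / d + 1 / 2 ^ \<kappa>) / 2 ^ length \<tau>" for \<kappa>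
  proof -
    obtain H where H: "solves \<tau> p d \<kappa> H" using solves_exists[OF assms(1)] ..
    have "lam (C \<inter> cone \<tau>) \<le> lam (above \<tau> (H []))"
      by (rule cantor.finite_measure_mono) (use solution_covers[OF assms(1) H] in auto)
    also have "\<dots> = mu (H []) / 2 ^ length \<tau>" by (rule lam_above[OF upward_solution[OF assms(1) H]])
    also have "\<dots> \<le> (p / d + 1 / 2 ^ \<kappa>) / 2 ^ length \<tau>"
      using mu_solution[OF assms(1) H assms(2), of "[]"] by (intro divide_right_mono) auto
    finally show ?thesis .
  qed
  moreover have "(\<lambda>\<kappa>. (p / d + 1 / 2 ^ \<kappa>) / 2 ^ length \<tau>) \<longlonglongrightarrow> (p / d + 0) / 2 ^ length \<tau>"
    using LIMSEQ_power_zero[of "1 / 2 :: real"] by (intro tendsto_intros) (simp_all add: power_divide)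
  ultimately show ?thesis by (intro LIMSEQ_le_const[of "\<lambda>\<kappa>. (p / d + 1 / 2 ^ \<kappa>) / 2 ^ length \<tau>"]) auto
qed

text \<open>Together with \<open>thin_lam_le\<close>, thinness lies between density less than
  \<open>p / d\<close> and density at most \<open>p / d\<close>. This is how upper bounds on the
  measure of \<open>C\<close> become \<open>Pi11\<close>.\<close>

lemma thinI:
  assumes "lam (C \<inter> cone \<tau>) < p / d / 2 ^ length \<tau>" "d > 0" shows "thin \<tau> p d"
proof (rule ccontr)
  assume "\<not> thin \<tau> p d"
  then obtain F where "F \<in> sets cantor_measure" "F \<subseteq> C \<inter> cone \<tau>" "p / d / 2 ^ length \<tau> \<le> lam F"
    using not_thin_inner assms(2) by blast
  moreover have "lam F \<le> lam (C \<inter> cone \<tau>)"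
    by (rule cantor.finite_measure_mono) (use calculation C_sets in auto)
  ultimately show False using assms(1) by linarith
qed

text \<open>
  The open cover of \<open>C\<close> above \<open>\<tau>\<close> is split at a level where it is nearly exhausted: \<open>Edge\<close> is the clopen
  part, \<open>Rest\<close> the remainder, and \<open>Hole\<close> the part of the cone missed by the clopen part.
\<close>

definition Edge :: "nat \<Rightarrow> nat \<Rightarrow> nat \<Rightarrow> bool list \<Rightarrow> bool list \<Rightarrow> bool" where
  "Edge p d \<kappa> \<tau> \<rho> \<longleftrightarrow> thin \<tau> p d \<and> (\<forall>Y. solves \<tau> p d \<kappa> (family Y) \<longrightarrow>
     (\<exists>u N. level_cut (family Y []) (length \<tau>) N \<and> \<rho> = \<tau> @ u \<and> length u = N \<and> family Y [] u))"

definition Rest :: "nat \<Rightarrow> nat \<Rightarrow> nat \<Rightarrow> bool list \<Rightarrow> bool list \<Rightarrow> bool" where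
  "Rest p d \<kappa> \<tau> \<rho> \<longleftrightarrow> thin \<tau> p d \<and> (\<forall>Y. solves \<tau> p d \<kappa> (family Y) \<longrightarrow>
     (\<exists>u N. level_cut (family Y []) (length \<tau>) N \<and> \<rho> = \<tau> @ u \<and> N \<le> length u \<and>
       family Y [] u \<and> \<not> family Y [] (take N u)))"

definition Hole :: "nat \<Rightarrow> nat \<Rightarrow> nat \<Rightarrow> bool list \<Rightarrow> (nat \<Rightarrow> bool) \<Rightarrow> bool" where
  "Hole p d \<kappa> \<tau> X \<longleftrightarrow> thin \<tau> p d \<and> (\<forall>Y. solves \<tau> p d \<kappa> (family Y) \<longrightarrow>
     (\<exists>u N. level_cut (family Y []) (length \<tau>) N \<and> restr X (length \<tau> + N) = \<tau> @ u \<and> \<not> family Y [] u))"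

end

lemma level_cut_unique: "level_cut W t N \<Longrightarrow> level_cut W t M \<Longrightarrow> N = M"
  unfolding level_cut_def by (rule linorder_cases[of N M]) blast+

lemma level_cut_ex:
  assumes "upward W" shows "\<exists>N. level_cut W t N \<and> mu W \<le> count_at W N / 2 ^ N + 1 / 2 ^ t"
proof -
  let ?P = "\<lambda>N. \<forall>n. count_at W n * 2 ^ N * 2 ^ t \<le> count_at W N * 2 ^ n * 2 ^ t + 2 ^ n * 2 ^ N"
  have "mu W - 1 / 2 ^ t < mu W" by simp
  then obtain N where N: "mu W - 1 / 2 ^ t < count_at W N / 2 ^ N"
    by (rule count_at_gt[OF assms])
  have "?P N" unfolding scaled_le_iff using count_at_le[OF assms] N by (smt (verit))
  then have P: "?P (LEAST N. ?P N)" by (rule LeastI)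
  have cut: "level_cut W t (LEAST N. ?P N)"
    unfolding level_cut_def using P not_less_Least[of _ ?P] by blast
  have "mu W \<le> count_at W (LEAST N. ?P N) / 2 ^ (LEAST N. ?P N) + 1 / 2 ^ t"
  proof (rule LIMSEQ_le_const2)
    show "(\<lambda>n. count_at W n / 2 ^ n) \<longlonglongrightarrow> mu W" using count_at_tendsto[OF assms, of "[]"] by simp
    show "\<exists>M. \<forall>n\<ge>M. count_at W n / 2 ^ n \<le> count_at W (LEAST N. ?P N) / 2 ^ (LEAST N. ?P N) + 1 / 2 ^ t"
      using P unfolding scaled_le_iff by blast
  qed
  with cut show ?thesis by blast
qed

context Sigma11_matrix begin

text \<open>All solutions agree and one has a code, so quantifying over all codes of solutions means
  evaluating at the unique one. Later arguments use only the resulting open set \<open>U\<close> and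
  level \<open>N\<close>; the recursion that produced them no longer appears.\<close>

lemma thin_structure:
  assumes "thin \<tau> p d" "d > 0"
  obtains U N where "upward U" "mu U \<le> p / d + 1 / 2 ^ \<kappa>" "C \<inter> cone \<tau> \<subseteq> above \<tau> U"
    "mu U \<le> count_at U N / 2 ^ N + 1 / 2 ^ length \<tau>"
    "\<And>\<rho>. Edge p d \<kappa> \<tau> \<rho> \<longleftrightarrow> (\<exists>u. \<rho> = \<tau> @ u \<and> length u = N \<and> U u)"
    "\<And>\<rho>. Rest p d \<kappa> \<tau> \<rho> \<longleftrightarrow> (\<exists>u. \<rho> = \<tau> @ u \<and> N \<le> length u \<and> U u \<and> \<not> U (take N u))"
    "\<And>X. Hole p d \<kappa> \<tau> X \<longleftrightarrow> (\<exists>u. restr X (length \<tau> + N) = \<tau> @ u \<and> \<not> U u)"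
proof -
  obtain H where H: "solves \<tau> p d \<kappa> H" using solves_exists[OF assms(1)] ..
  have up: "upward (H [])" by (rule upward_solution[OF assms(1) H])
  obtain N where N: "level_cut (H []) (length \<tau>) N" "mu (H []) \<le> count_at (H []) N / 2 ^ N + 1 / 2 ^ length \<tau>"
    using level_cut_ex[OF up] by blast
  have fam: "family Y [] = H []" if "solves \<tau> p d \<kappa> (family Y)" for Y
    by (rule solves_unique[OF assms(1) that H])
  define Y where "Y c = H (list_decode (fst (prod_decode c))) (string_decode (snd (prod_decode c)))" for c
  have "family Y = H" by (intro ext) (simp add: family_def Y_def)
  then have Y: "solves \<tau> p d \<kappa> (family Y)" using H by simp
  have cut: "level_cut (H []) (length \<tau>) M \<longleftrightarrow> M = N" for M
    using level_cut_unique N(1) by blast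
  have all: "(\<forall>Y. solves \<tau> p d \<kappa> (family Y) \<longrightarrow> B (family Y [])) \<longleftrightarrow> B (H [])" for B
    using fam Y by auto
  show thesis
  proof (rule that[of "H []" N])
    show "upward (H [])" by (rule up)
    show "mu (H []) \<le> p / d + 1 / 2 ^ \<kappa>" using mu_solution[OF assms(1) H assms(2), of "[]"] by simp
    show "C \<inter> cone \<tau> \<subseteq> above \<tau> (H [])" using solution_covers[OF assms(1) H] by blast
    show "mu (H []) \<le> count_at (H []) N / 2 ^ N + 1 / 2 ^ length \<tau>" by (rule N)
    show "Edge p d \<kappa> \<tau> \<rho> \<longleftrightarrow> (\<exists>u. \<rho> = \<tau> @ u \<and> length u = N \<and> H [] u)" for \<rho>
      unfolding Edge_def using assms(1)
        all[of "\<lambda>W. \<exists>u N. level_cut W (length \<tau>) N \<and> \<rho> = \<tau> @ u \<and> length u = N \<and> W u"] by (simp add: cut)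
    show "Rest p d \<kappa> \<tau> \<rho> \<longleftrightarrow> (\<exists>u. \<rho> = \<tau> @ u \<and> N \<le> length u \<and> H [] u \<and> \<not> H [] (take N u))" for \<rho>
      unfolding Rest_def using assms(1)
        all[of "\<lambda>W. \<exists>u N. level_cut W (length \<tau>) N \<and> \<rho> = \<tau> @ u \<and> N \<le> length u \<and> W u \<and> \<not> W (take N u)"]
      by (simp add: cut)
    show "Hole p d \<kappa> \<tau> X \<longleftrightarrow> (\<exists>u. restr X (length \<tau> + N) = \<tau> @ u \<and> \<not> H [] u)" for X
      unfolding Hole_def using assms(1)
        all[of "\<lambda>W. \<exists>u N. level_cut W (length \<tau>) N \<and> restr X (length \<tau> + N) = \<tau> @ u \<and> \<not> W u"]
      by (simp add: cut)
  qed
qed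

end

section \<open>Selected covers and tests\<close>

lemma arithN_const [arI]: "arithN (\<lambda>S e. b)"
  unfolding arithN_def by (rule arithF_const)

lemma arithL_const [arI]: "arithL (\<lambda>S e. u)"
  unfolding arithL_def by (rule arithF_const)

lemma arithF_count_at [arI]:
  assumes "arith (\<lambda>S e. P S (\<lambda>j. e (Suc j)) (string_decode (e 0)))" "arithF n"
  shows "arithF (\<lambda>S e. count_at (P S e) (n S e))"
  unfolding count_at_def by (rule arithF_card[OF assms])

lemma arith_app4:
  assumes "arith (\<lambda>S e. R S (e 0) (e 1) (e 2) (e 3))" "arithF f" "arithF g" "arithF h" "arithF k"
  shows "arith (\<lambda>S e. R S (f S e) (g S e) (h S e) (k S e))"
  using arith_subst[OF assms(1),
      of "\<lambda>i. if i = 0 then f else if i = 1 then g else if i = 2 then h else k" "\<lambda>i S e m. S i m"]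
    assms(2-5)
  by (simp add: arI)

lemma arith_family [arI]:
  "arithN b \<Longrightarrow> arithL u \<Longrightarrow> arith (\<lambda>S e. family (S k) (b S e) (u S e))"
  unfolding family_def by (intro arI)

lemma arith_level_cut:
  assumes "arithF t" "arithF N"
  shows "arith (\<lambda>S e. level_cut (family (S 0) []) (t S e) (N S e))"
proof -
  have "arith (\<lambda>S e. level_cut (family (S 0) []) (e 0) (e 1))"
    unfolding level_cut_def by (intro arI)
  from arith_app2[OF this assms] show ?thesis .
qed

context Sigma11_matrix begin

lemma arith_Q_bits [arI]:
  assumes "arithL v" "arithL y" "arithF f" "arithF g"
  shows "arith (\<lambda>S e. Q (bit_at (v S e)) (bit_at (y S e)) (f S e) (g S e))"
proof -
  have "arith (\<lambda>S e. Q (\<lambda>m. if (0::nat) = 0 then bit_at (v S e) m else bit_at (y S e) m)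
      (\<lambda>m. if (1::nat) = 0 then bit_at (v S e) m else bit_at (y S e) m)
      (if (0::nat) = 0 then f S e else g S e) (if (1::nat) = 0 then f S e else g S e))"
  proof (rule arith_subst[OF arith_Q, where F = "\<lambda>i S e. if i = 0 then f S e else g S e"
        and D = "\<lambda>i S e m. if i = 0 then bit_at (v S e) m else bit_at (y S e) m"])
    fix i :: nat
    show "arithF (\<lambda>S e. if i = 0 then f S e else g S e)" by (cases "i = 0") (simp_all add: assms)
    show "arith (\<lambda>S e. if i = 0 then bit_at (v S (\<lambda>j. e (Suc j))) (e 0) else bit_at (y S (\<lambda>j. e (Suc j))) (e 0))"
      by (cases "i = 0") (simp_all add: arith_bit_at[OF arithL_shift[OF assms(1)] arithF_var]
          arith_bit_at[OF arithL_shift[OF assms(2)] arithF_var])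
  qed
  then show ?thesis by simp
qed

lemma arith_K [arI]:
  assumes "arithL t" "arithN b" "arithL u"
  shows "arith (\<lambda>S e. K (t S e) (b S e) (u S e))"
proof -
  have "arith (\<lambda>S e. K (string_decode (e 0)) (list_decode (e 1)) (string_decode (e 2)))"
    unfolding K_def good_def by (intro arI)
  from arith_app3[OF this, of "\<lambda>S e. string_code (t S e)" "\<lambda>S e. list_encode (b S e)"
      "\<lambda>S e. string_code (u S e)"] assms
  show ?thesis by (simp add: arI)
qed

lemma arith_alive [arI]:
  assumes "arithL t" "arithF p" "arithF d" "arithN b"
  shows "arith (\<lambda>S e. alive (t S e) (p S e) (d S e) (b S e))"
proof -
  have "arith (\<lambda>S e. alive (string_decode (e 0)) (e 1) (e 2) (list_decode (e 3)))"
    unfolding alive_def by (intro arI)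
  from arith_app4[OF this, of "\<lambda>S e. string_code (t S e)" p d "\<lambda>S e. list_encode (b S e)"] assms
  show ?thesis by (simp add: arI)
qed

lemma Pi11_thin:
  assumes "arithL t" "arithF p" "arithF d"
  shows "Pi11 (\<lambda>S e. thin (t S e) (p S e) (d S e))"
proof -
  have "Pi11 (\<lambda>S e. thin (string_decode (e 0)) (e 1) (e 2))"
    unfolding thin_def by (rule Pi11_all_set) (intro arI)
  from Pi11_app3[OF this, of "\<lambda>S e. string_code (t S e)" p d] assms
  show ?thesis by (simp add: arI)
qed

lemma arith_solves:
  assumes "arithL t"
  shows "arith (\<lambda>S e. solves (t S e) p d \<kappa> (family (S 0)))"
proof -
  have "arith (\<lambda>S e. solves (string_decode (e 0)) p d \<kappa> (family (S 0)))"
    unfolding solves_def open_liminf_def cutoff_def near_def meet_def[abs_def] by (intro arI)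
  from arith_app2[OF this, of "\<lambda>S e. string_code (t S e)" "\<lambda>S e. 0"] assms
  show ?thesis by (simp add: arI)
qed

lemma Pi11_Edge:
  assumes "arithL t" "arithL r"
  shows "Pi11 (\<lambda>S e. Edge p d \<kappa> (t S e) (r S e))"
proof -
  have "Pi11 (\<lambda>S e. Edge p d \<kappa> (string_decode (e 0)) (string_decode (e 1)))"
    unfolding Edge_def
    by (intro Pi11_conj Pi11_thin Pi11_all_set arith_imp arith_solves arith_exL arith_ex arith_conj
        arith_level_cut arI)
  from Pi11_app2[OF this, of "\<lambda>S e. string_code (t S e)" "\<lambda>S e. string_code (r S e)"] assms
  show ?thesis by (simp add: arI)
qed

lemma Pi11_Rest:
  assumes "arithL t" "arithL r"
  shows "Pi11 (\<lambda>S e. Rest p d \<kappa> (t S e) (r S e))"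
proof -
  have "Pi11 (\<lambda>S e. Rest p d \<kappa> (string_decode (e 0)) (string_decode (e 1)))"
    unfolding Rest_def
    by (intro Pi11_conj Pi11_thin Pi11_all_set arith_imp arith_solves arith_exL arith_ex arith_conj
        arith_level_cut arI)
  from Pi11_app2[OF this, of "\<lambda>S e. string_code (t S e)" "\<lambda>S e. string_code (r S e)"] assms
  show ?thesis by (simp add: arI)
qed

lemma Pi11_Hole:
  "Pi11 (\<lambda>S e. Hole p d \<kappa> (string_decode (e 0)) (S 0))"
  unfolding Hole_def
  by (intro Pi11_conj Pi11_thin Pi11_all_set arith_imp arith_solves arith_exL arith_ex arith_conj
      arith_level_cut arI)

section \<open>Tests built from the selected covers\<close>

lemma lam_Rest:
  assumes "d > 0"
  shows "lam (\<Union>\<rho>\<in>{\<rho>. Rest p d \<kappa> \<tau> \<rho>}. cone \<rho>) \<le> (1/4) ^ length \<tau>"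
proof (cases "thin \<tau> p d")
  case False
  then show ?thesis by (simp add: Rest_def)
next
  case True
  obtain U N where U: "upward U" "mu U \<le> count_at U N / 2 ^ N + 1 / 2 ^ length \<tau>"
    "\<And>\<rho>. Rest p d \<kappa> \<tau> \<rho> \<longleftrightarrow> (\<exists>u. \<rho> = \<tau> @ u \<and> N \<le> length u \<and> U u \<and> \<not> U (take N u))"
    by (rule thin_structure[OF True assms, of \<kappa>]) (rule that)
  let ?L = "above \<tau> (\<lambda>u. length u = N \<and> U u)"
  have "(\<Union>\<rho>\<in>{\<rho>. Rest p d \<kappa> \<tau> \<rho>}. cone \<rho>) \<subseteq> above \<tau> U - ?L"
  proof
    fix X assume "X \<in> (\<Union>\<rho>\<in>{\<rho>. Rest p d \<kappa> \<tau> \<rho>}. cone \<rho>)"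
    then obtain u where u: "N \<le> length u" "U u" "\<not> U (take N u)" "X \<in> cone (\<tau> @ u)"
      unfolding U(3) by blast
    then have X: "X \<in> cone \<tau>" "restr (\<lambda>i. X (length \<tau> + i)) (length u) = u"
      unfolding mem_cone_append mem_cone_eq[of _ u] by blast+
    then have "restr (\<lambda>i. X (length \<tau> + i)) N = take N u"
      using take_restr[of N "\<lambda>i. X (length \<tau> + i)" "length u"] u(1) by (simp add: min_absorb1)
    then have "X \<notin> ?L" using u(3) by (auto simp: mem_above_iff)
    moreover have "X \<in> above \<tau> U" using X u(2) unfolding mem_above_iff by metis
    ultimately show "X \<in> above \<tau> U - ?L" by blast
  qed
  then have "lam (\<Union>\<rho>\<in>{\<rho>. Rest p d \<kappa> \<tau> \<rho>}. cone \<rho>) \<le> lam (above \<tau> U - ?L)"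
    by (rule cantor.finite_measure_mono) auto
  also have "\<dots> = lam (above \<tau> U) - lam ?L"
    by (rule cantor.finite_measure_Diff) (auto intro!: above_mono)
  also have "\<dots> = (mu U - count_at U N / 2 ^ N) / 2 ^ length \<tau>"
    unfolding lam_above_level lam_above[OF U(1), of \<tau>] by (simp add: power_add diff_divide_distrib)
  also have "\<dots> \<le> (1 / 2 ^ length \<tau>) / 2 ^ length \<tau>"
    using U(2) by (intro divide_right_mono) auto
  also have "\<dots> = (1/4) ^ length \<tau>"
    by (simp add: power_divide flip: power_mult_distrib)
  finally show ?thesis .
qed

text \<open>There are \<open>2 ^ k\<close> strings \<open>\<tau>\<close> of length \<open>k\<close>,
  and each remainder has measure at most \<open>4 ^ -k\<close>: one factor \<open>2 ^ -k\<close> is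
  the size of the cone, the other the accuracy of the level. The total \<open>2 ^ -k\<close> per
  length, summed from \<open>k = n + 1\<close> on, is \<open>2 ^ -n\<close>.\<close>

lemma random_avoids_Rest:
  assumes "Pi11_Martin_Loef_random Z" "d > 0"
  obtains n0 where "\<And>\<tau> \<rho>. n0 \<le> length \<tau> \<Longrightarrow> Rest p d \<kappa> \<tau> \<rho> \<Longrightarrow> Z \<notin> cone \<rho>"
proof -
  define W where "W n = {\<rho>. \<exists>\<tau>. Suc n \<le> length \<tau> \<and> Rest p d \<kappa> \<tau> \<rho>}" for n
  have "Pi11 (\<lambda>S e. \<exists>\<tau>. Suc (e 0) \<le> length \<tau> \<and> Rest p d \<kappa> \<tau> (string_decode (e 1)))"
    by (intro Pi11_exL Pi11_conj Pi11_Rest Pi11_arith[OF arith_le] arI)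
  then have "uniformly_Pi11 W" by (intro uniformly_Pi11I) (simp add: W_def)
  moreover have "lam (\<Union>\<sigma>\<in>W n. cone \<sigma>) \<le> (1/2) ^ n" for n
  proof -
    define B where "B k = (\<Union>\<tau>\<in>{\<tau>. length \<tau> = k}. \<Union>\<rho>\<in>{\<rho>. Rest p d \<kappa> \<tau> \<rho>}. cone \<rho>)" for k
    have fin: "finite {\<tau>::bool list. length \<tau> = k}" for k using finite_length_eq[of k "\<lambda>_. True"] by simp
    have B_sets: "B k \<in> sets cantor_measure" for k
      unfolding B_def by (rule sets.finite_UN[OF fin UN_cone_sets])
    have B: "lam (B k) \<le> (1/2) ^ k" for k
    proof -
      have "lam (B k) \<le> (\<Sum>\<tau>\<in>{\<tau>. length \<tau> = k}. lam (\<Union>\<rho>\<in>{\<rho>. Rest p d \<kappa> \<tau> \<rho>}. cone \<rho>))"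
        unfolding B_def by (rule cantor.finite_measure_subadditive_finite[OF fin]) blast
      also have "\<dots> \<le> (\<Sum>\<tau>\<in>{\<tau>::bool list. length \<tau> = k}. (1/4) ^ k)"
        using lam_Rest[OF assms(2)] by (intro sum_mono) force
      also have "\<dots> = 2 ^ k * (1/4) ^ k"
        using card_lists_length_eq[of "UNIV :: bool set" k] by simp
      also have "\<dots> = (1/2) ^ k" by (simp flip: power_mult_distrib)
      finally show ?thesis .
    qed
    have summ: "summable (\<lambda>k. (1/2) ^ Suc n * (1/2) ^ k :: real)"
      by (intro summable_mult summable_geometric) simp
    have B': "lam (B (k + Suc n)) \<le> (1/2) ^ Suc n * (1/2) ^ k" for k
      using B[of "k + Suc n"] by (simp add: power_add mult.commute)
    have summB: "summable (\<lambda>k. lam (B (k + Suc n)))"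
      by (rule summable_comparison_test'[OF summ, of 0]) (use B' in auto)
    have "(\<Union>\<sigma>\<in>W n. cone \<sigma>) \<subseteq> (\<Union>k. B (k + Suc n))"
    proof
      fix X assume "X \<in> (\<Union>\<sigma>\<in>W n. cone \<sigma>)"
      then obtain \<tau> \<rho> where \<tau>: "Suc n \<le> length \<tau>" "Rest p d \<kappa> \<tau> \<rho>" "X \<in> cone \<rho>"
        by (auto simp: W_def)
      then have "X \<in> B (length \<tau>)" unfolding B_def by blast
      then have "X \<in> B ((length \<tau> - Suc n) + Suc n)" unfolding le_add_diff_inverse2[OF \<tau>(1)] .
      then show "X \<in> (\<Union>k. B (k + Suc n))" by blast
    qed
    then have "lam (\<Union>\<sigma>\<in>W n. cone \<sigma>) \<le> lam (\<Union>k. B (k + Suc n))"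
      by (rule cantor.finite_measure_mono) (use B_sets in auto)
    also have "\<dots> \<le> (\<Sum>k. lam (B (k + Suc n)))"
      using B_sets summB by (intro cantor.finite_measure_subadditive_countably) auto
    also have "\<dots> \<le> (\<Sum>k. (1/2) ^ Suc n * (1/2) ^ k)" by (rule suminf_le[OF B' summB summ])
    also have "\<dots> = (1/2) ^ n" by (subst suminf_mult) (simp_all add: suminf_geometric)
    finally show ?thesis .
  qed
  ultimately obtain n where "Z \<notin> (\<Union>\<sigma>\<in>W n. cone \<sigma>)"
    using assms(1) unfolding Pi11_Martin_Loef_random_def by blast
  then show thesis by (intro that[of "Suc n"]) (auto simp: W_def)
qed

lemma covered_or_Rest:
  assumes "thin \<tau> p d" "d > 0" "Z \<in> C" "Z \<in> cone \<tau>" "\<And>\<rho>. Rest p d \<kappa> \<tau> \<rho> \<Longrightarrow> Z \<notin> cone \<rho>"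
  shows "\<exists>\<rho>. Edge p d \<kappa> \<tau> \<rho> \<and> Z \<in> cone \<rho>" "\<not> Hole p d \<kappa> \<tau> Z"
proof -
  obtain U N where U: "upward U" "C \<inter> cone \<tau> \<subseteq> above \<tau> U"
    "\<And>\<rho>. Edge p d \<kappa> \<tau> \<rho> \<longleftrightarrow> (\<exists>u. \<rho> = \<tau> @ u \<and> length u = N \<and> U u)"
    "\<And>\<rho>. Rest p d \<kappa> \<tau> \<rho> \<longleftrightarrow> (\<exists>u. \<rho> = \<tau> @ u \<and> N \<le> length u \<and> U u \<and> \<not> U (take N u))"
    "\<And>X. Hole p d \<kappa> \<tau> X \<longleftrightarrow> (\<exists>u. restr X (length \<tau> + N) = \<tau> @ u \<and> \<not> U u)"
    by (rule thin_structure[OF assms(1,2), of \<kappa>]) (rule that)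
  let ?Z = "\<lambda>i. Z (length \<tau> + i)"
  have "Z \<in> above \<tau> U" using U(2) assms(3,4) by blast
  then obtain n where "U (restr ?Z n)" unfolding mem_above_iff by blast
  then have U_m: "U (restr ?Z (max n N))" by (rule upwardD[OF U(1)]) simp
  have mem: "Z \<in> cone (\<tau> @ restr ?Z m)" for m
    unfolding mem_cone_append using assms(4) by simp
  have U_N: "U (restr ?Z N)"
  proof (rule ccontr)
    assume "\<not> U (restr ?Z N)"
    \<comment> \<open>\<open>Z\<close> enters the open set \<open>U\<close> but has not done so at
      level \<open>N\<close>; a prefix long enough for both facts is a string of the
      remainder.\<close>
    then have "Rest p d \<kappa> \<tau> (\<tau> @ restr ?Z (max n N))"
      unfolding U(4) using U_m by (intro exI[of _ "restr ?Z (max n N)"]) (simp add: min_absorb1)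
    then show False using assms(5) mem by blast
  qed
  then show "\<exists>\<rho>. Edge p d \<kappa> \<tau> \<rho> \<and> Z \<in> cone \<rho>"
    unfolding U(3) using mem by (intro exI[of _ "\<tau> @ restr ?Z N"]) simp
  show "\<not> Hole p d \<kappa> \<tau> Z"
    unfolding U(5) using U_N restr_add_cone[OF assms(4), of N] by auto
qed

definition holeless :: "nat \<Rightarrow> nat \<Rightarrow> nat \<Rightarrow> nat \<Rightarrow> (nat \<Rightarrow> bool) set" where
  "holeless p d \<kappa> n0 = {X. \<forall>\<tau>. n0 \<le> length \<tau> \<longrightarrow> \<not> Hole p d \<kappa> \<tau> X}"

lemma Sigma11_holeless: "Sigma11_class (holeless p d \<kappa> n0)"
proof (rule Sigma11_classI)
  have "Pi11 (\<lambda>S e. \<exists>\<tau>. n0 \<le> length \<tau> \<and> Hole p d \<kappa> \<tau> (S 0))"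
    by (intro Pi11_exL Pi11_conj Pi11_Hole Pi11_arith[OF arith_le] arI)
  then show "Sigma11 (\<lambda>S e. S 0 \<in> holeless p d \<kappa> n0)"
    by (simp add: Pi11_def holeless_def)
qed

lemma closed_holeless:
  assumes "d > 0" shows "closed (holeless p d \<kappa> n0)"
proof -
  have "open {X. Hole p d \<kappa> \<tau> X}" for \<tau>
  proof (cases "thin \<tau> p d")
    case False
    then show ?thesis by (simp add: Hole_def)
  next
    case True
    obtain U N where "\<And>X. Hole p d \<kappa> \<tau> X \<longleftrightarrow> (\<exists>u. restr X (length \<tau> + N) = \<tau> @ u \<and> \<not> U u)"
      by (rule thin_structure[OF True assms, of \<kappa>]) (rule that)
    moreover have "(\<exists>u. restr X (length \<tau> + N) = \<tau> @ u \<and> \<not> U u) \<longleftrightarrow>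
        (\<exists>u. length u = N \<and> \<not> U u \<and> X \<in> cone (\<tau> @ u))" for X
    proof
      assume "\<exists>u. restr X (length \<tau> + N) = \<tau> @ u \<and> \<not> U u"
      then obtain u where u: "restr X (length \<tau> + N) = \<tau> @ u" "\<not> U u" by blast
      have "length (restr X (length \<tau> + N)) = length (\<tau> @ u)" by (rule arg_cong[OF u(1)])
      then have "length u = N" by simp
      then show "\<exists>u. length u = N \<and> \<not> U u \<and> X \<in> cone (\<tau> @ u)" using u by (auto simp: mem_cone_eq)
    qed (auto simp: mem_cone_eq)
    ultimately have "{X. Hole p d \<kappa> \<tau> X} = (\<Union>u\<in>{u. length u = N \<and> \<not> U u}. cone (\<tau> @ u))" by auto
    then show ?thesis by (simp only:) (intro open_UN ballI open_cone)
  qed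
  then have "open (\<Union>\<tau>\<in>{\<tau>. n0 \<le> length \<tau>}. {X. Hole p d \<kappa> \<tau> X})" by (intro open_UN ballI)
  moreover have "- holeless p d \<kappa> n0 = (\<Union>\<tau>\<in>{\<tau>. n0 \<le> length \<tau>}. {X. Hole p d \<kappa> \<tau> X})"
    by (auto simp: holeless_def)
  ultimately show ?thesis by (simp add: closed_def)
qed

lemma lam_holeless:
  assumes "thin \<tau> p d" "d > 0" "n0 \<le> length \<tau>"
  shows "lam (holeless p d \<kappa> n0 \<inter> cone \<tau>) \<le> (p / d + 1 / 2 ^ \<kappa>) / 2 ^ length \<tau>"
proof -
  obtain U N where U: "upward U" "mu U \<le> p / d + 1 / 2 ^ \<kappa>"
    "\<And>X. Hole p d \<kappa> \<tau> X \<longleftrightarrow> (\<exists>u. restr X (length \<tau> + N) = \<tau> @ u \<and> \<not> U u)"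
    by (rule thin_structure[OF assms(1,2), of \<kappa>]) (rule that)
  have "holeless p d \<kappa> n0 \<inter> cone \<tau> \<subseteq> above \<tau> U"
  proof
    fix X assume X: "X \<in> holeless p d \<kappa> n0 \<inter> cone \<tau>"
    then have "\<not> Hole p d \<kappa> \<tau> X" "X \<in> cone \<tau>" using assms(3) by (auto simp: holeless_def)
    then show "X \<in> above \<tau> U"
      unfolding U(3) mem_above_iff using restr_add_cone[of X \<tau> N] by blast
  qed
  then have "lam (holeless p d \<kappa> n0 \<inter> cone \<tau>) \<le> lam (above \<tau> U)"
    by (rule cantor.finite_measure_mono) auto
  also have "\<dots> \<le> (p / d + 1 / 2 ^ \<kappa>) / 2 ^ length \<tau>"
    unfolding lam_above[OF U(1), of \<tau>] using U(2) by (intro divide_right_mono) auto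
  finally show ?thesis .
qed

text \<open>Splitting off the first edge: its targets are extensions of \<open>\<tau>\<close> by
  strings of one common length \<open>N\<close> and of total relative measure at most
  \<open>p / d + 1 / 2 ^ \<kappa>\<close>. The induction hypothesis applies at each target. The
  levels below different targets may differ, so the induction bounds measures and not
  lengths.\<close>

lemma lam_Edge_chain:
  assumes "d > 0"
  shows "lam (\<Union>\<rho>\<in>{\<rho>. (\<tau>, \<rho>) \<in> {(\<tau>, \<rho>). Edge p d \<kappa> \<tau> \<rho>} ^^ i}. cone \<rho>) \<le> (p / d + 1 / 2 ^ \<kappa>) ^ i / 2 ^ length \<tau>"
proof (induction i arbitrary: \<tau>)
  case 0
  have "(\<Union>\<rho>\<in>{\<rho>. (\<tau>, \<rho>) \<in> {(\<tau>, \<rho>). Edge p d \<kappa> \<tau> \<rho>} ^^ 0}. cone \<rho>) = cone \<tau>" by auto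
  then show ?case by (simp add: power_divide)
next
  case (Suc i)
  let ?E = "{(\<tau>, \<rho>). Edge p d \<kappa> \<tau> \<rho>}" and ?q = "p / d + 1 / 2 ^ \<kappa>"
  let ?A = "\<lambda>\<tau>. \<Union>\<rho>\<in>{\<rho>. (\<tau>, \<rho>) \<in> ?E ^^ i}. cone \<rho>"
  have eq: "(\<Union>\<rho>\<in>{\<rho>. (\<tau>, \<rho>) \<in> ?E ^^ Suc i}. cone \<rho>) = (\<Union>\<sigma>\<in>{\<sigma>. Edge p d \<kappa> \<tau> \<sigma>}. ?A \<sigma>)"
    using relpow_Suc_D2[of \<tau> _ i ?E] relpow_Suc_I2[of \<tau> _ ?E _ i] by fastforce
  show ?case
  proof (cases "thin \<tau> p d")
    case False
    then have "{\<sigma>. Edge p d \<kappa> \<tau> \<sigma>} = {}" by (simp add: Edge_def)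
    then show ?thesis unfolding eq by (simp only: UN_empty measure_empty) simp
  next
    case True
    obtain U N where U: "upward U" "mu U \<le> ?q"
      "\<And>\<rho>. Edge p d \<kappa> \<tau> \<rho> \<longleftrightarrow> (\<exists>u. \<rho> = \<tau> @ u \<and> length u = N \<and> U u)"
      by (rule thin_structure[OF True assms, of \<kappa>]) (rule that)
    let ?U = "{u. length u = N \<and> U u}"
    have "{\<sigma>. Edge p d \<kappa> \<tau> \<sigma>} = (\<lambda>u. \<tau> @ u) ` ?U" unfolding U(3) by auto
    then have "(\<Union>\<sigma>\<in>{\<sigma>. Edge p d \<kappa> \<tau> \<sigma>}. ?A \<sigma>) = (\<Union>u\<in>?U. ?A (\<tau> @ u))" by auto
    then have "lam (\<Union>\<sigma>\<in>{\<sigma>. Edge p d \<kappa> \<tau> \<sigma>}. ?A \<sigma>) \<le> (\<Sum>u\<in>?U. lam (?A (\<tau> @ u)))"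
      by (simp only:) (rule cantor.finite_measure_subadditive_finite, auto simp: finite_length_eq)
    also have "\<dots> \<le> (\<Sum>u\<in>?U. ?q ^ i / 2 ^ (length \<tau> + N))"
    proof (rule sum_mono)
      fix u assume "u \<in> ?U"
      then have len: "length (\<tau> @ u) = length \<tau> + N" by simp
      show "lam (?A (\<tau> @ u)) \<le> ?q ^ i / 2 ^ (length \<tau> + N)" using Suc[of "\<tau> @ u"] unfolding len .
    qed
    also have "\<dots> = ?q ^ i * (count_at U N / 2 ^ N) / 2 ^ length \<tau>"
      by (simp add: count_at_def power_add mult.commute)
    also have "\<dots> \<le> ?q ^ i * ?q / 2 ^ length \<tau>"
      using count_at_le[OF U(1), of N] U(2) by (intro divide_right_mono mult_left_mono) auto
    finally show ?thesis unfolding eq by (simp add: mult.commute)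
  qed
qed

text \<open>A chain is coded by one number, so only number quantifiers are added, and
  \<open>Pi11\<close> is closed under these. The factor \<open>k\<close> allows a test to use every
  \<open>k\<close>-th stage.\<close>

lemma Pi11_Edge_chain:
  "Pi11 (\<lambda>S e. (\<tau>0, string_decode (e 1)) \<in> {(\<tau>, \<rho>). Edge p d \<kappa> \<tau> \<rho>} ^^ (k * e 0))"
proof -
  let ?E = "{(\<tau>, \<rho>). Edge p d \<kappa> \<tau> \<rho>}"
  have eq: "(\<tau>0, \<rho>) \<in> ?E ^^ m \<longleftrightarrow> (\<exists>c. string_decode (nthd (list_decode c) 0) = \<tau>0 \<and>
      string_decode (nthd (list_decode c) m) = \<rho> \<and> (\<forall>i. i < m \<longrightarrow>
      Edge p d \<kappa> (string_decode (nthd (list_decode c) i)) (string_decode (nthd (list_decode c) (Suc i)))))"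
    (is "_ \<longleftrightarrow> (\<exists>c. ?R c)") for \<rho> m
  proof
    assume "(\<tau>0, \<rho>) \<in> ?E ^^ m"
    then obtain f where f: "f 0 = \<tau>0" "f m = \<rho>" "\<forall>i<m. Edge p d \<kappa> (f i) (f (Suc i))"
      unfolding relpow_fun_conv by auto
    define c where "c = list_encode (map (\<lambda>i. string_code (f i)) [0..<Suc m])"
    have "string_decode (nthd (list_decode c) i) = f i" if "i \<le> m" for i
      using that unfolding c_def nthd_def by (simp del: upt_Suc)
    then have "?R c" using f by simp
    then show "\<exists>c. ?R c" ..
  next
    assume "\<exists>c. ?R c"
    then obtain c where "?R c" ..
    then show "(\<tau>0, \<rho>) \<in> ?E ^^ m"
      unfolding relpow_fun_conv by (intro exI[of _ "\<lambda>i. string_decode (nthd (list_decode c) i)"]) simp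
  qed
  show ?thesis unfolding eq
    by (intro Pi11_ex Pi11_conj Pi11_all Pi11_imp Pi11_Edge Pi11_arith[OF arith_eqL] arI)
qed

text \<open>If all long prefixes of \<open>Z\<close> are thin, \<open>Z\<close> can always follow a
  further edge. It then lies in every stage of the chains from \<open>\<tau>0\<close>, whose
  measures decrease geometrically with ratio \<open>?q < 1\<close>. Taking every \<open>k\<close>-th
  stage, where \<open>?q ^ k < 1/2\<close>, gives a Martin-Loef test that captures
  \<open>Z\<close>.\<close>

lemma random_leaves_thin:
  assumes "Pi11_Martin_Loef_random Z" "Z \<in> C" "d > 0" "p / d + 1 / 2 ^ \<kappa> < 1"
    and thin: "\<And>n. n1 \<le> n \<Longrightarrow> thin (restr Z n) p d"
  shows False
proof -
  obtain n0 where n0: "\<And>\<tau> \<rho>. n0 \<le> length \<tau> \<Longrightarrow> Rest p d \<kappa> \<tau> \<rho> \<Longrightarrow> Z \<notin> cone \<rho>"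
    using random_avoids_Rest[OF assms(1,3)] by blast
  let ?E = "{(\<tau>, \<rho>). Edge p d \<kappa> \<tau> \<rho>}" and ?q = "p / d + 1 / 2 ^ \<kappa>"
  have q0: "0 \<le> ?q" by simp
  define \<tau>0 where "\<tau>0 = restr Z (max n0 n1)"
  have step: "\<exists>\<rho>. Edge p d \<kappa> \<tau> \<rho> \<and> Z \<in> cone \<rho> \<and> max n0 n1 \<le> length \<rho>"
    if Z\<tau>: "Z \<in> cone \<tau>" and len: "max n0 n1 \<le> length \<tau>" for \<tau>
  proof -
    have "restr Z (length \<tau>) = \<tau>" using Z\<tau> by (simp add: mem_cone_eq)
    moreover have "thin (restr Z (length \<tau>)) p d" using thin[of "length \<tau>"] len by simp
    ultimately have \<tau>: "thin \<tau> p d" by simp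
    have "Z \<notin> cone \<rho>" if "Rest p d \<kappa> \<tau> \<rho>" for \<rho> using n0[OF _ that] len by simp
    from covered_or_Rest(1)[OF \<tau> assms(3,2) Z\<tau> this]
    obtain \<rho> where \<rho>: "Edge p d \<kappa> \<tau> \<rho>" "Z \<in> cone \<rho>" by blast
    obtain U N where "\<And>\<rho>. Edge p d \<kappa> \<tau> \<rho> \<longleftrightarrow> (\<exists>u. \<rho> = \<tau> @ u \<and> length u = N \<and> U u)"
      by (rule thin_structure[OF \<tau> assms(3), of \<kappa>]) (rule that)
    then have "length \<tau> \<le> length \<rho>" using \<rho>(1) by auto
    then show ?thesis using \<rho> len by (intro exI[of _ \<rho>]) simp
  qed
  have chain: "\<exists>\<rho>. (\<tau>0, \<rho>) \<in> ?E ^^ i \<and> Z \<in> cone \<rho> \<and> max n0 n1 \<le> length \<rho>" for i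
  proof (induction i)
    case 0
    show ?case by (rule exI[of _ \<tau>0]) (simp add: \<tau>0_def)
  next
    case (Suc i)
    then obtain \<rho> where \<rho>: "(\<tau>0, \<rho>) \<in> ?E ^^ i" "Z \<in> cone \<rho>" "max n0 n1 \<le> length \<rho>" by blast
    obtain \<rho>' where \<rho>': "Edge p d \<kappa> \<rho> \<rho>'" "Z \<in> cone \<rho>'" "max n0 n1 \<le> length \<rho>'"
      using step[OF \<rho>(2,3)] by blast
    then show ?case using relpow_Suc_I[OF \<rho>(1), of \<rho>'] by auto
  qed
  obtain k where k: "?q ^ k < 1/2" using real_arch_pow_inv[of "1/2" ?q] assms(4) by auto
  define W where "W n = {\<rho>. (\<tau>0, \<rho>) \<in> ?E ^^ (k * n)}" for n
  have "uniformly_Pi11 W"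
    unfolding W_def by (rule uniformly_Pi11I) (unfold mem_Collect_eq, rule Pi11_Edge_chain)
  moreover have "lam (\<Union>\<sigma>\<in>W n. cone \<sigma>) \<le> (1/2) ^ n" for n
  proof -
    have "lam (\<Union>\<sigma>\<in>W n. cone \<sigma>) \<le> ?q ^ (k * n) / 2 ^ length \<tau>0"
      unfolding W_def by (rule lam_Edge_chain[OF assms(3)])
    also have "\<dots> \<le> ?q ^ (k * n) / 1"
      by (rule divide_left_mono) (use zero_le_power[OF q0, of "k * n"] in auto)
    also have "\<dots> = (?q ^ k) ^ n" by (simp add: power_mult)
    also have "\<dots> \<le> (1/2) ^ n" using k q0 by (intro power_mono) auto
    finally show ?thesis .
  qed
  ultimately have "Z \<notin> (\<Inter>n. \<Union>\<sigma>\<in>W n. cone \<sigma>)"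
    using assms(1) unfolding Pi11_Martin_Loef_random_def by blast
  moreover have "Z \<in> (\<Union>\<sigma>\<in>W n. cone \<sigma>)" for n
    using chain[of "k * n"] by (auto simp: W_def)
  ultimately show False by blast
qed

end

section \<open>Densities\<close>

text \<open>The ratios never exceed \<open>1\<close>, so density one is a matter of lower bounds
  only.\<close>

lemma lower_density_eq_1_iff:
  "lower_density C Z = 1 \<longleftrightarrow>
     (\<forall>\<delta>>0. eventually (\<lambda>n. 1 - \<delta> < lam (C \<inter> cone (restr Z n)) * 2 ^ n) sequentially)"
proof -
  let ?r = "\<lambda>n. lam (C \<inter> cone (restr Z n)) * 2 ^ n"
  have eq: "lower_density C Z = liminf (\<lambda>n. ereal (?r n))"
    unfolding lower_density_def by (simp add: power_divide)
  have le1: "?r n \<le> 1" for n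
  proof -
    have "lam (C \<inter> cone (restr Z n)) \<le> lam (cone (restr Z n))"
      by (rule cantor.finite_measure_mono) auto
    then show ?thesis by (simp add: power_divide field_simps)
  qed
  have "liminf (\<lambda>n. ereal (?r n)) \<le> 1"
    using Liminf_le_Limsup[of sequentially "\<lambda>n. ereal (?r n)"]
      Limsup_bounded[of "\<lambda>n. ereal (?r n)" 1 sequentially] le1
    by (auto intro: order_trans)
  then have "lower_density C Z = 1 \<longleftrightarrow> 1 \<le> liminf (\<lambda>n. ereal (?r n))" unfolding eq by auto
  also have "\<dots> \<longleftrightarrow> (\<forall>\<delta>>0. eventually (\<lambda>n. 1 - \<delta> < ?r n) sequentially)"
  proof (intro iffI allI impI)
    fix \<delta> :: real assume 1: "1 \<le> liminf (\<lambda>n. ereal (?r n))" and "\<delta> > 0"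
    then have "ereal (1 - \<delta>) < 1" unfolding one_ereal_def by simp
    from less_le_trans[OF this 1] have "ereal (1 - \<delta>) < liminf (\<lambda>n. ereal (?r n))" .
    from less_LiminfD[OF this] show "eventually (\<lambda>n. 1 - \<delta> < ?r n) sequentially" by simp
  next
    assume *: "\<forall>\<delta>>0. eventually (\<lambda>n. 1 - \<delta> < ?r n) sequentially"
    show "1 \<le> liminf (\<lambda>n. ereal (?r n))"
    proof (rule ereal_le_epsilon2)
      fix \<delta> :: real assume "\<delta> > 0"
      then have "eventually (\<lambda>n. 1 - \<delta> < ?r n) sequentially" using * by blast
      then have "eventually (\<lambda>n. ereal (1 - \<delta>) \<le> ereal (?r n)) sequentially"
        by (rule eventually_mono) simp
      then have "ereal (1 - \<delta>) \<le> liminf (\<lambda>n. ereal (?r n))" by (rule Liminf_bounded)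
      then have "ereal (1 - \<delta>) + ereal \<delta> \<le> liminf (\<lambda>n. ereal (?r n)) + ereal \<delta>" by (rule add_right_mono)
      moreover have "ereal (1 - \<delta>) + ereal \<delta> = 1" by (simp add: one_ereal_def)
      ultimately show "1 \<le> liminf (\<lambda>n. ereal (?r n)) + ereal \<delta>" by (simp only:)
    qed
  qed
  finally show ?thesis .
qed

lemma Sigma11_classD:
  assumes "Sigma11_class C" shows "\<exists>Q. Sigma11_matrix Q C"
proof -
  obtain Q where "arith (\<lambda>S e. Q (S 0) (S 1) (e 0) (e 1))" "continuous_matrix Q"
    "\<And>X. X \<in> C \<longleftrightarrow> (\<exists>V. \<forall>a. \<exists>c. Q X V a c)"
    by (rule Sigma11_class_normal_form[OF assms]) (rule that)
  then have "Sigma11_matrix Q C" by unfold_locales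
  then show ?thesis by blast
qed

section \<open>Rational numbers in codes and left-\<open>Pi11\<close> functions\<close>

lemma rat_code_iff:
  "k = rat_code q \<longleftrightarrow> (\<exists>x b. b > 0 \<and> coprime x b \<and>
     (k = prod_encode (2 * x, b) \<and> q = of_nat x / of_nat b \<or>
      x > 0 \<and> k = prod_encode (2 * x - 1, b) \<and> q = - of_nat x / of_nat b))"
proof
  assume k: "k = rat_code q"
  obtain a c where ac: "quotient_of q = (a, c)" by fastforce
  have c: "c > 0" "coprime a c" "q = of_int a / of_int c"
    using quotient_of_denom_pos[OF ac] quotient_of_coprime[OF ac] quotient_of_div[OF ac] by auto
  have k': "k = prod_encode (int_encode a, nat c)" by (simp add: k rat_code_def ac)
  \<comment> \<open>\<open>quotient_of\<close> returns reduced fractions; \<open>int_encode\<close>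
    sends \<open>x\<close> to \<open>2 * x\<close> and, for \<open>x > 0\<close>, \<open>- x\<close>
    to \<open>2 * x - 1\<close>, whence the two cases.\<close>
  have cop: "coprime (nat \<bar>a\<bar>) (nat c)" using c by (simp add: coprime_nat_abs_left_iff flip: coprime_int_iff)
  show "\<exists>x b. b > 0 \<and> coprime x b \<and>
     (k = prod_encode (2 * x, b) \<and> q = of_nat x / of_nat b \<or>
      x > 0 \<and> k = prod_encode (2 * x - 1, b) \<and> q = - of_nat x / of_nat b)"
  proof (rule exI[of _ "nat \<bar>a\<bar>"], rule exI[of _ "nat c"], intro conjI cop)
    show "0 < nat c" using c by simp
    show "k = prod_encode (2 * nat \<bar>a\<bar>, nat c) \<and> q = of_nat (nat \<bar>a\<bar>) / of_nat (nat c) \<or>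
      0 < nat \<bar>a\<bar> \<and> k = prod_encode (2 * nat \<bar>a\<bar> - 1, nat c) \<and> q = - of_nat (nat \<bar>a\<bar>) / of_nat (nat c)"
    proof (cases "a \<ge> 0")
      case True
      then show ?thesis using c by (simp add: k' int_encode_def sum_encode_def)
    next
      case False
      have "int_encode a = Suc (2 * nat (- a - 1))" using False by (simp add: int_encode_def sum_encode_def)
      also have "\<dots> = 2 * nat \<bar>a\<bar> - 1" using False by simp
      finally show ?thesis using False c by (simp add: k')
    qed
  qed
next
  assume "\<exists>x b. b > 0 \<and> coprime x b \<and>
     (k = prod_encode (2 * x, b) \<and> q = of_nat x / of_nat b \<or>
      x > 0 \<and> k = prod_encode (2 * x - 1, b) \<and> q = - of_nat x / of_nat b)"
  then obtain x b where xb: "b > 0" "coprime x b" and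
    disj: "k = prod_encode (2 * x, b) \<and> q = of_nat x / of_nat b \<or>
      x > 0 \<and> k = prod_encode (2 * x - 1, b) \<and> q = - of_nat x / of_nat b" by blast
  have quot: "quotient_of (of_int a / of_int (int b)) = (a, int b)" if "coprime a (int b)" for a
  proof -
    have "of_int a / of_int (int b) = Fract a (int b)" by (rule Fract_of_int_quotient[symmetric])
    then show ?thesis using xb(1) that by (simp add: quotient_of_Fract normalize_stable)
  qed
  from disj show "k = rat_code q"
  proof
    assume *: "k = prod_encode (2 * x, b) \<and> q = of_nat x / of_nat b"
    have "quotient_of q = (int x, int b)" using quot[of "int x"] xb(2) * by simp
    then show ?thesis using * by (simp add: rat_code_def int_encode_def sum_encode_def)
  next
    assume *: "x > 0 \<and> k = prod_encode (2 * x - 1, b) \<and> q = - of_nat x / of_nat b"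
    have "quotient_of q = (- int x, int b)" using quot[of "- int x"] xb(2) * by simp
    moreover obtain y where "x = Suc y" using * by (metis gr0_conv_Suc)
    then have "int_encode (- int x) = 2 * x - 1"
      by (simp add: int_encode_def sum_encode_def)
    ultimately show ?thesis using * by (simp add: rat_code_def)
  qed
qed

lemma inj_rat_code: "rat_code q = rat_code r \<longleftrightarrow> q = r"
proof
  assume *: "rat_code q = rat_code r"
  obtain a b c d where q: "quotient_of q = (a, b)" and r: "quotient_of r = (c, d)" by fastforce
  have "b > 0" "d > 0" using quotient_of_denom_pos q r by blast+
  then have *: "int_encode a = int_encode c" "b = d" using * by (auto simp: rat_code_def q r eq_nat_nat_iff)
  have "a = c" by (rule inj_onD[OF inj_int_encode[of UNIV] *(1)]) simp_all
  then show "q = r" using quotient_of_div[OF q] quotient_of_div[OF r] *(2) by simp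
qed simp

lemma rat_code_of_nat: "rat_code (of_nat m) = prod_encode (2 * m, 1)"
proof -
  have "quotient_of (of_nat m) = (int m, 1)" using quotient_of_int[of "int m"] by simp
  then show ?thesis by (simp add: rat_code_def int_encode_def sum_encode_def)
qed

lemma arith_coprime [arI]:
  assumes "arithF f" "arithF g" shows "arith (\<lambda>S e. coprime (f S e) (g S e))"
proof -
  have eq: "coprime x b \<longleftrightarrow> (\<forall>k. (\<exists>y. x = k * y) \<and> (\<exists>z. b = k * z) \<longrightarrow> k = 1)" for x b :: nat
    unfolding dvd_def[symmetric] by (auto simp: coprime_def)
  have "arith (\<lambda>S e. coprime (e 0) (e 1))" unfolding eq by (intro arI)
  from arith_app2[OF this assms] show ?thesis .
qed

lemma Pi11_left_martingale:
  assumes "left_Pi11 M" "arithL t" "arithF r" "\<And>S e. r S e = rat_code (q S e)"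
  shows "Pi11 (\<lambda>S e. of_rat (q S e) < M (t S e))"
proof -
  let ?A = "{prod_encode (string_code \<sigma>, rat_code q) |\<sigma> q. of_rat q < M \<sigma>}"
  have eq: "of_rat (q S e) < M (t S e) \<longleftrightarrow> prod_encode (string_code (t S e), r S e) \<in> ?A" for S e
    unfolding assms(4) by (auto simp: string_code_eq inj_rat_code)
  show ?thesis unfolding eq
    using assms(1) unfolding left_Pi11_def by (rule Pi11_setD) (intro arI assms)
qed

lemma left_Pi11I:
  assumes pos: "Pi11 (\<lambda>S e. of_nat (e 1) / of_nat (e 2) < M (string_decode (e 0)))"
    and neg: "Pi11 (\<lambda>S e. - of_nat (e 1) / of_nat (e 2) < M (string_decode (e 0)))"
  shows "left_Pi11 M"
  unfolding left_Pi11_def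
proof (rule Pi11_setI)
  have eq: "k \<in> {prod_encode (string_code \<sigma>, rat_code q) |\<sigma> q. of_rat q < M \<sigma>} \<longleftrightarrow>
    (\<exists>c x b j. k = prod_encode (c, j) \<and> string_code (string_decode c) = c \<and> 0 < b \<and> coprime x b \<and>
      ((j = prod_encode (2 * x, b) \<and> of_nat x / of_nat b < M (string_decode c)) \<or>
       (0 < x \<and> j = prod_encode (2 * x - 1, b) \<and> - of_nat x / of_nat b < M (string_decode c))))"
    (is "_ \<longleftrightarrow> ?R") for k
  proof
    assume "k \<in> {prod_encode (string_code \<sigma>, rat_code q) |\<sigma> q. of_rat q < M \<sigma>}"
    then obtain \<sigma> q where k: "k = prod_encode (string_code \<sigma>, rat_code q)" "of_rat q < M \<sigma>" by blast
    obtain x b where "b > 0 \<and> coprime x b \<and>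
     (rat_code q = prod_encode (2 * x, b) \<and> q = of_nat x / of_nat b \<or>
      x > 0 \<and> rat_code q = prod_encode (2 * x - 1, b) \<and> q = - of_nat x / of_nat b)"
      using rat_code_iff[of "rat_code q" q] by blast
    then show ?R using k
      by (intro exI[of _ "string_code \<sigma>"] exI[of _ x] exI[of _ b] exI[of _ "rat_code q"])
        (auto simp: of_rat_divide of_rat_minus)
  next
    assume ?R
    then obtain c x b j where R: "k = prod_encode (c, j)" "string_code (string_decode c) = c" "0 < b" "coprime x b"
      "(j = prod_encode (2 * x, b) \<and> of_nat x / of_nat b < M (string_decode c)) \<or>
       (0 < x \<and> j = prod_encode (2 * x - 1, b) \<and> - of_nat x / of_nat b < M (string_decode c))" by blast
    from R(5) show "k \<in> {prod_encode (string_code \<sigma>, rat_code q) |\<sigma> q. of_rat q < M \<sigma>}"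
    proof
      assume *: "j = prod_encode (2 * x, b) \<and> of_nat x / of_nat b < M (string_decode c)"
      have "j = rat_code (of_nat x / of_nat b)" unfolding rat_code_iff using R(3,4) * by blast
      then show ?thesis using R(1,2) * 
        by (intro CollectI exI[of _ "string_decode c"] exI[of _ "of_nat x / of_nat b :: rat"])
          (simp add: of_rat_divide)
    next
      assume *: "0 < x \<and> j = prod_encode (2 * x - 1, b) \<and> - of_nat x / of_nat b < M (string_decode c)"
      have "j = rat_code (- of_nat x / of_nat b)" unfolding rat_code_iff using R(3,4) * by blast
      then show ?thesis using R(1,2) *
        by (intro CollectI exI[of _ "string_decode c"] exI[of _ "- of_nat x / of_nat b :: rat"])
          (simp add: of_rat_divide of_rat_minus)
    qed
  qed
  have pos': "Pi11 (\<lambda>S e. of_nat (e (Suc (Suc 0))) / of_nat (e (Suc 0)) < M (string_decode (e (Suc (Suc (Suc 0))))))"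
    using Pi11_app3[OF pos, of "\<lambda>S e. e (Suc (Suc (Suc 0)))" "\<lambda>S e. e (Suc (Suc 0))" "\<lambda>S e. e (Suc 0)"]
    by (simp add: arI)
  have neg': "Pi11 (\<lambda>S e. - of_nat (e (Suc (Suc 0))) / of_nat (e (Suc 0)) < M (string_decode (e (Suc (Suc (Suc 0))))))"
    using Pi11_app3[OF neg, of "\<lambda>S e. e (Suc (Suc (Suc 0)))" "\<lambda>S e. e (Suc (Suc 0))" "\<lambda>S e. e (Suc 0)"]
    by (simp add: arI)
  show "Pi11 (\<lambda>S e. e 0 \<in> {prod_encode (string_code \<sigma>, rat_code q) |\<sigma> q. of_rat q < M \<sigma>})"
    unfolding eq
    by (intro Pi11_ex Pi11_conj Pi11_disj pos' neg' Pi11_arith[OF arith_eq] Pi11_arith[OF arith_less]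
        Pi11_arith[OF arith_coprime] arI)
qed

context Sigma11_matrix begin

section \<open>The martingale of a class and its behaviour along a random sequence\<close>

definition codensity :: "bool list \<Rightarrow> real" where
  "codensity \<sigma> = 1 - lam (C \<inter> cone \<sigma>) * 2 ^ length \<sigma>"

lemma is_martingale_codensity: "is_martingale codensity"
  unfolding is_martingale_def
proof (intro allI conjI)
  fix \<sigma>
  have "lam (C \<inter> cone \<sigma>) \<le> lam (cone \<sigma>)" by (rule cantor.finite_measure_mono) auto
  then show "0 \<le> codensity \<sigma>" by (simp add: codensity_def power_divide field_simps)
  have "C \<inter> cone \<sigma> = (C \<inter> cone (\<sigma> @ [False])) \<union> (C \<inter> cone (\<sigma> @ [True]))" using cone_split[of \<sigma>] by blast
  moreover have "lam ((C \<inter> cone (\<sigma> @ [False])) \<union> (C \<inter> cone (\<sigma> @ [True]))) =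
      lam (C \<inter> cone (\<sigma> @ [False])) + lam (C \<inter> cone (\<sigma> @ [True]))"
    by (rule cantor.finite_measure_Union)
      (use C_sets cone_disjoint[of "\<sigma> @ [False]" "\<sigma> @ [True]"] in auto)
  ultimately show "codensity \<sigma> = (codensity (\<sigma> @ [False]) + codensity (\<sigma> @ [True])) / 2"
    by (simp add: codensity_def algebra_simps)
qed

text \<open>A rational \<open>p / d\<close> between the density of \<open>C\<close> and
  \<open>1 - r\<close> is a certificate, because thinness is \<open>Pi11\<close> and bounds the
  density by \<open>p / d\<close>.\<close>

lemma less_codensity_iff:
  "r < codensity \<sigma> \<longleftrightarrow> (\<exists>p d. 0 < d \<and> real p / real d < 1 - r \<and> thin \<sigma> p d)"
proof
  let ?L = "lam (C \<inter> cone \<sigma>) * 2 ^ length \<sigma>"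
  assume "r < codensity \<sigma>"
  then have gap: "0 < 1 - r - ?L" by (simp add: codensity_def)
  obtain n where n: "inverse (real (Suc n)) < 1 - r - ?L" using reals_Archimedean[OF gap] by blast
  define d where "d = Suc n"
  \<comment> \<open>The least numerator with \<open>?L < p / d\<close>; it overshoots
    \<open>?L\<close> by at most \<open>1 / d\<close>, which fits into the gap.\<close>
  define p where "p = nat \<lfloor>?L * d\<rfloor> + 1"
  have d: "0 < d" by (simp add: d_def)
  have L0: "0 \<le> ?L * d" by simp
  have p: "real p = of_int \<lfloor>?L * d\<rfloor> + 1" using L0 by (simp add: p_def)
  have "?L * d < real p" unfolding p by linarith
  then have "?L < p / d" using d by (simp add: field_simps)
  then have "lam (C \<inter> cone \<sigma>) < p / d / 2 ^ length \<sigma>" by (subst pos_less_divide_eq) simp_all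
  then have "thin \<sigma> p d" using d by (rule thinI)
  moreover have "real p \<le> ?L * d + 1" unfolding p by linarith
  then have "p / d \<le> (?L * d + 1) / d" by (rule divide_right_mono) simp
  then have "p / d \<le> ?L + inverse (real (Suc n))"
    using d by (simp add: add_divide_distrib inverse_eq_divide flip: d_def)
  then have "p / d < 1 - r" using n by linarith
  ultimately show "\<exists>p d. 0 < d \<and> real p / real d < 1 - r \<and> thin \<sigma> p d" using d by blast
next
  assume "\<exists>p d. 0 < d \<and> real p / real d < 1 - r \<and> thin \<sigma> p d"
  then obtain p d where d: "0 < d" "real p / real d < 1 - r" "thin \<sigma> p d" by blast
  have "lam (C \<inter> cone \<sigma>) * 2 ^ length \<sigma> \<le> p / d" 
    by (rule pos_le_divide_eq[THEN iffD1, OF zero_less_power thin_lam_le[OF d(3,1)]]) simp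
  then show "r < codensity \<sigma>" using d(2) by (simp add: codensity_def)
qed

lemma left_Pi11_codensity: "left_Pi11 codensity"
proof (rule left_Pi11I)
  \<comment> \<open>The criterion asks for all pairs of naturals, including \<open>b = 0\<close>,
    where the quotient is \<open>0\<close> and the condition on the certificate becomes
    \<open>p / d < 1\<close>.\<close>
  have eq1: "of_nat x / of_nat b < codensity \<sigma> \<longleftrightarrow>
      (\<exists>p d. 0 < d \<and> (if b = 0 then p < d else p * b + x * d < d * b) \<and> thin \<sigma> p d)" for x b \<sigma>
    unfolding less_codensity_iff
  proof (intro ex_cong1 conj_cong refl)
    fix p d :: nat assume "0 < d"
    have "real p / real d < 1 - real x / real b \<longleftrightarrow> real (p * b + x * d) < real (d * b)" if "b > 0"
      using that \<open>0 < d\<close> by (simp add: field_simps)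
    then show "real p / real d < 1 - real x / real b \<longleftrightarrow> (if b = 0 then p < d else p * b + x * d < d * b)"
      using \<open>0 < d\<close> by (simp only: of_nat_less_iff) auto
  qed
  show "Pi11 (\<lambda>S e. of_nat (e 1) / of_nat (e 2) < codensity (string_decode (e 0)))"
    unfolding eq1 by (intro Pi11_ex Pi11_conj Pi11_thin Pi11_arith[OF arith_less] Pi11_arith[OF arith_if] arI)
  have eq2: "- of_nat x / of_nat b < codensity \<sigma> \<longleftrightarrow>
      (\<exists>p d. 0 < d \<and> (if b = 0 then p < d else p * b < d * b + x * d) \<and> thin \<sigma> p d)" for x b \<sigma>
    unfolding less_codensity_iff
  proof (intro ex_cong1 conj_cong refl)
    fix p d :: nat assume "0 < d"
    have "real p / real d < 1 - (- real x / real b) \<longleftrightarrow> real (p * b) < real (d * b + x * d)" if "b > 0"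
      using that \<open>0 < d\<close> by (simp add: field_simps)
    then show "real p / real d < 1 - (- real x / real b) \<longleftrightarrow> (if b = 0 then p < d else p * b < d * b + x * d)"
      using \<open>0 < d\<close> by (simp only: of_nat_less_iff) auto
  qed
  show "Pi11 (\<lambda>S e. - of_nat (e 1) / of_nat (e 2) < codensity (string_decode (e 0)))"
    unfolding eq2 by (intro Pi11_ex Pi11_conj Pi11_thin Pi11_arith[OF arith_less] Pi11_arith[OF arith_if] arI)
qed

lemma ratio_restr: "lam (C \<inter> cone (restr Z n)) * 2 ^ n = 1 - codensity (restr Z n)"
  by (simp add: codensity_def)

lemma thin_of_ratio:
  assumes "lam (C \<inter> cone (restr Z n)) * 2 ^ n < p / d" "d > 0"
  shows "thin (restr Z n) p d"
  by (rule thinI) (use assms in \<open>simp_all add: field_simps\<close>)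

lemma density_one_if_codensity_converges:
  assumes "Pi11_Martin_Loef_random Z" "Z \<in> C" "convergent (\<lambda>n. codensity (restr Z n))"
  shows "lower_density C Z = 1"
proof -
  obtain c where c: "(\<lambda>n. codensity (restr Z n)) \<longlonglongrightarrow> c" using assms(3) unfolding convergent_def ..
  have "0 \<le> c" by (rule LIMSEQ_le_const[OF c]) (use is_martingale_codensity in \<open>auto simp: is_martingale_def\<close>)
  have "c = 0"
  proof (rule ccontr)
    assume "c \<noteq> 0"
    then have "0 < c / 2" using \<open>0 \<le> c\<close> by simp
    then obtain \<kappa> where \<kappa>: "(1/2) ^ \<kappa> < c / 2" using real_arch_pow_inv[of "c / 2" "1/2"] by auto
    define \<kappa>' where "\<kappa>' = Suc \<kappa>"
    have "(1/2) ^ \<kappa> < c" using \<kappa> \<open>0 < c / 2\<close> by linarith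
    then have \<kappa>': "2 / 2 ^ \<kappa>' < c" "(2::nat) \<le> 2 ^ \<kappa>'" by (simp_all add: \<kappa>'_def power_divide)
    \<comment> \<open>The distance \<open>2 / 2 ^ \<kappa>'\<close> of \<open>p / d\<close> from
      \<open>1\<close> leaves room for the excess \<open>1 / 2 ^ \<kappa>'\<close> of the cover, so
      that the chains still shrink. Taking a successor for \<open>\<kappa>'\<close> keeps the
      subtraction in \<open>p\<close> from being truncated.\<close>
    define d p :: nat where "d = 2 ^ \<kappa>'" and "p = 2 ^ \<kappa>' - 2"
    have d: "d > 0" by (simp add: d_def)
    have pd: "p / d = 1 - 2 / 2 ^ \<kappa>'" using \<kappa>'(2) by (simp add: p_def d_def of_nat_diff diff_divide_distrib)
    have "eventually (\<lambda>n. 2 / 2 ^ \<kappa>' < codensity (restr Z n)) sequentially"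
      using order_tendstoD(1)[OF c \<kappa>'(1)] .
    then obtain n1 where n1: "\<And>n. n1 \<le> n \<Longrightarrow> 2 / 2 ^ \<kappa>' < codensity (restr Z n)"
      unfolding eventually_sequentially by blast
    show False
    proof (rule random_leaves_thin[OF assms(1,2) d])
      show "p / d + 1 / 2 ^ \<kappa>' < 1" unfolding pd by (simp add: field_simps)
      show "thin (restr Z n) p d" if "n1 \<le> n" for n
        by (rule thin_of_ratio[OF _ d]) (use n1[OF that] in \<open>simp add: ratio_restr pd\<close>)
    qed
  qed
  then have lim: "(\<lambda>n. codensity (restr Z n)) \<longlonglongrightarrow> 0" using c by simp
  show ?thesis unfolding lower_density_eq_1_iff ratio_restr
    using order_tendstoD(2)[OF lim] by simp
qed

lemma density_one_if_closed_density_one: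
  assumes "Pi11_Martin_Loef_random Z" "Z \<in> C"
    and closed: "\<And>D. closed D \<Longrightarrow> Sigma11_class D \<Longrightarrow> Z \<in> D \<Longrightarrow> lower_density D Z = 1"
  shows "lower_density C Z = 1"
  unfolding lower_density_eq_1_iff
proof (intro allI impI, rule ccontr)
  fix \<delta> :: real
  assume \<delta>: "\<delta> > 0" "\<not> eventually (\<lambda>n. 1 - \<delta> < lam (C \<inter> cone (restr Z n)) * 2 ^ n) sequentially"
  obtain \<kappa> where \<kappa>: "(1/2) ^ \<kappa> < \<delta>" using real_arch_pow_inv[of \<delta> "1/2"] \<delta>(1) by auto
  define \<kappa>' where "\<kappa>' = Suc \<kappa>"
  have \<kappa>': "2 / 2 ^ \<kappa>' < \<delta>" "(2::nat) \<le> 2 ^ \<kappa>'" using \<kappa> by (simp_all add: \<kappa>'_def power_divide)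
  define d p :: nat where "d = 2 ^ \<kappa>'" and "p = 2 ^ \<kappa>' - 2"
  have d: "d > 0" by (simp add: d_def)
  have pd: "p / d = 1 - 2 / 2 ^ \<kappa>'" using \<kappa>'(2) by (simp add: p_def d_def of_nat_diff diff_divide_distrib)
  obtain n0 where n0: "\<And>\<tau> \<rho>. n0 \<le> length \<tau> \<Longrightarrow> Rest p d \<kappa>' \<tau> \<rho> \<Longrightarrow> Z \<notin> cone \<rho>"
    using random_avoids_Rest[OF assms(1) d] by blast
  let ?D = "holeless p d \<kappa>' n0"
  have "Z \<in> ?D" unfolding holeless_def
  \<comment> \<open>A hole at \<open>\<tau>\<close> lies inside the cone of \<open>\<tau>\<close>,
    so only prefixes of \<open>Z\<close> matter; at long ones \<open>Z \<in> C\<close> is covered by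
    the clopen part.\<close>
  proof (intro CollectI allI impI notI)
    fix \<tau> assume \<tau>: "n0 \<le> length \<tau>" "Hole p d \<kappa>' \<tau> Z"
    then have thin: "thin \<tau> p d" by (simp add: Hole_def)
    obtain N U where "\<And>X. Hole p d \<kappa>' \<tau> X \<longleftrightarrow> (\<exists>u. restr X (length \<tau> + N) = \<tau> @ u \<and> \<not> U u)"
      by (rule thin_structure[OF thin d, of \<kappa>']) (rule that)
    then obtain u where u: "restr Z (length \<tau> + N) = \<tau> @ u" using \<tau>(2) by blast
    have "take (length \<tau>) (restr Z (length \<tau> + N)) = take (length \<tau>) (\<tau> @ u)"
      by (rule arg_cong[OF u])
    then have "Z \<in> cone \<tau>" by (simp add: mem_cone_eq)
    then show False using covered_or_Rest(2)[OF thin d assms(2)] n0[OF \<tau>(1)] \<tau>(2) by blast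
  qed
  then have "lower_density ?D Z = 1" using closed[OF closed_holeless[OF d] Sigma11_holeless] by blast
  then have "eventually (\<lambda>n. 1 - 1 / 2 ^ \<kappa>' < lam (?D \<inter> cone (restr Z n)) * 2 ^ n) sequentially"
    unfolding lower_density_eq_1_iff by simp
  then obtain n1 where n1: "\<And>n. n1 \<le> n \<Longrightarrow> 1 - 1 / 2 ^ \<kappa>' < lam (?D \<inter> cone (restr Z n)) * 2 ^ n"
    unfolding eventually_sequentially by blast
  obtain n where n: "max n0 n1 \<le> n" "lam (C \<inter> cone (restr Z n)) * 2 ^ n \<le> 1 - \<delta>"
    using \<delta>(2) unfolding eventually_sequentially by (meson not_le)
  \<comment> \<open>At a prefix where \<open>C\<close> has density at most
    \<open>1 - \<delta>\<close>, the closed class has a hole of relative measure at least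
    \<open>1 / 2 ^ \<kappa>'\<close>, against its density one at \<open>Z\<close>.\<close>
  have "thin (restr Z n) p d"
    by (rule thin_of_ratio[OF _ d]) (use n(2) \<kappa>'(1) in \<open>simp add: pd\<close>)
  from lam_holeless[OF this d, of n0 \<kappa>'] have "lam (?D \<inter> cone (restr Z n)) * 2 ^ n \<le> p / d + 1 / 2 ^ \<kappa>'"
    using n(1) by (simp add: field_simps)
  also have "\<dots> = 1 - 1 / 2 ^ \<kappa>'" unfolding pd by (simp add: field_simps)
  finally show False using n1[of n] n(1) by simp
qed

end

section \<open>Martingales\<close>

lemma martingale_nonneg: "is_martingale M \<Longrightarrow> 0 \<le> M \<sigma>"
  by (simp add: is_martingale_def)

lemma martingale_split: "is_martingale M \<Longrightarrow> M \<sigma> = (M (\<sigma> @ [False]) + M (\<sigma> @ [True])) / 2"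
  by (simp add: is_martingale_def)

lemma martingale_child_le:
  assumes "is_martingale M" shows "M (\<sigma> @ [b]) \<le> 2 * M \<sigma>"
  using martingale_nonneg[OF assms, of "\<sigma> @ [False]"] martingale_nonneg[OF assms, of "\<sigma> @ [True]"]
    martingale_split[OF assms, of \<sigma>] by (cases b) simp_all

section \<open>The maximal inequality and optional stopping\<close>

primrec exceeds :: "(bool list \<Rightarrow> real) \<Rightarrow> real \<Rightarrow> nat \<Rightarrow> bool list \<Rightarrow> (nat \<Rightarrow> bool) set" where
  "exceeds M B 0 \<sigma> = (if B < M \<sigma> then cone \<sigma> else {})"
| "exceeds M B (Suc n) \<sigma> = (if B < M \<sigma> then cone \<sigma> else exceeds M B n (\<sigma> @ [False]) \<union> exceeds M B n (\<sigma> @ [True]))"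

lemma exceeds_sets [simp, intro]: "exceeds M B n \<sigma> \<in> sets cantor_measure"
  by (induction n arbitrary: \<sigma>) auto

text \<open>Ville's inequality with a finite horizon: where the recursion stops successfully,
  \<open>M\<close> exceeds \<open>B\<close>, and otherwise \<open>M \<sigma>\<close> is the average
  over the children.\<close>

lemma exceeds_le:
  assumes "is_martingale M" "0 \<le> B"
  shows "B * lam (exceeds M B n \<sigma>) \<le> M \<sigma> / 2 ^ length \<sigma>"
proof (induction n arbitrary: \<sigma>)
  case 0
  show ?case using martingale_nonneg[OF assms(1), of \<sigma>] by (simp add: power_divide divide_right_mono)
next
  case (Suc n)
  show ?case
  proof (cases "B < M \<sigma>")
    case True
    then show ?thesis by (simp add: power_divide divide_right_mono)
  next
    case False
    have "lam (exceeds M B (Suc n) \<sigma>) \<le> lam (exceeds M B n (\<sigma> @ [False])) + lam (exceeds M B n (\<sigma> @ [True]))"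
      using False by (simp add: measure_Un_le)
    then have "B * lam (exceeds M B (Suc n) \<sigma>) \<le>
        B * lam (exceeds M B n (\<sigma> @ [False])) + B * lam (exceeds M B n (\<sigma> @ [True]))"
      using assms(2) mult_left_mono[of _ _ B] by (fastforce simp flip: distrib_left)
    also have "\<dots> \<le> M (\<sigma> @ [False]) / 2 ^ length (\<sigma> @ [False]) + M (\<sigma> @ [True]) / 2 ^ length (\<sigma> @ [True])"
      by (rule add_mono[OF Suc Suc])
    also have "\<dots> = M \<sigma> / 2 ^ length \<sigma>"
    proof -
      have sum: "M (\<sigma> @ [False]) + M (\<sigma> @ [True]) = 2 * M \<sigma>" using martingale_split[OF assms(1), of \<sigma>] by simp
      show ?thesis by (simp add: sum flip: add_divide_distrib)
    qed
    finally show ?thesis .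
  qed
qed

lemma mem_exceeds:
  "X \<in> cone \<sigma> \<Longrightarrow> k \<le> n \<Longrightarrow> B < M (restr X (length \<sigma> + k)) \<Longrightarrow> X \<in> exceeds M B n \<sigma>"
proof (induction n arbitrary: \<sigma> k)
  case 0
  then show ?case by (simp add: mem_cone_eq)
next
  case (Suc n)
  show ?case
  proof (cases "B < M \<sigma>")
    case True
    then show ?thesis using Suc by simp
  next
    case False
    have "k \<noteq> 0"
    proof
      assume "k = 0"
      then show False using Suc.prems False by (simp add: mem_cone_eq)
    qed
    then obtain j where j: "k = Suc j" using not0_implies_Suc by blast
    obtain b where b: "X \<in> cone (\<sigma> @ [b])" using Suc.prems(1) cone_split[of \<sigma>] by blast
    have "X \<in> exceeds M B n (\<sigma> @ [b])"
      by (rule Suc.IH[OF b, of j]) (use Suc.prems j in auto)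
    then show ?thesis using False by (cases b) auto
  qed
qed

lemma maximal_inequality:
  assumes "is_martingale M" "0 < B"
  shows "lam (\<Union>\<sigma>\<in>{\<sigma>. B < M \<sigma>}. cone \<sigma>) \<le> M [] / B"
proof -
  let ?A = "\<lambda>n. exceeds M B n []"
  \<comment> \<open>Each point of the open set lies in all events with a large enough horizon. The
    tail intersections increase by construction, so continuity from below applies to them.\<close>
  have mem: "X \<in> (\<Union>n. \<Inter>m\<in>{n..}. ?A m)" if "B < M \<sigma>" "X \<in> cone \<sigma>" for X \<sigma>
  proof -
    have "X \<in> ?A m" if "length \<sigma> \<le> m" for m
      by (rule mem_exceeds[of _ _ "length \<sigma>"]) (use \<open>B < M \<sigma>\<close> \<open>X \<in> cone \<sigma>\<close> that in \<open>auto simp: mem_cone_eq\<close>)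
    then show ?thesis by blast
  qed
  have "lam (\<Union>\<sigma>\<in>{\<sigma>. B < M \<sigma>}. cone \<sigma>) \<le> lam (\<Union>n. \<Inter>m\<in>{n..}. ?A m)"
    by (rule cantor.finite_measure_mono) (use mem in auto)
  moreover have "(\<lambda>n. lam (\<Inter>m\<in>{n..}. ?A m)) \<longlonglongrightarrow> lam (\<Union>n. \<Inter>m\<in>{n..}. ?A m)"
    by (rule cantor.finite_Lim_measure_incseq) (auto simp: incseq_def)
  moreover have "lam (\<Inter>m\<in>{n..}. ?A m) \<le> M [] / B" for n
  proof -
    have "lam (\<Inter>m\<in>{n..}. ?A m) \<le> lam (?A n)" by (rule cantor.finite_measure_mono) auto
    also have "\<dots> \<le> M [] / B" using exceeds_le[OF assms(1), of B n "[]"] assms(2) by (simp add: field_simps)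
    finally show ?thesis .
  qed
  ultimately show ?thesis by (meson LIMSEQ_le_const2 order_trans)
qed

lemma random_martingale_bounded:
  assumes "Pi11_Martin_Loef_random Z" "is_martingale M" "left_Pi11 M"
  obtains B :: nat where "0 < B" "\<And>m. M (restr Z m) \<le> B"
proof -
  \<comment> \<open>A natural number above \<open>M []\<close>: the thresholds
    \<open>2 ^ n * c\<close> have arithmetical codes, and the maximal inequality bounds the
    \<open>n\<close>-th level of the test by \<open>2 ^ -n\<close>.\<close>
  define c where "c = nat \<lceil>M []\<rceil> + 1"
  have c: "M [] \<le> c" "0 < c" unfolding c_def by linarith+
  define W where "W n = {\<sigma>. of_nat (2 ^ n * c) < M \<sigma>}" for n
  have "Pi11 (\<lambda>S e. of_rat (of_nat (2 ^ e 0 * c)) < M (string_decode (e 1)))"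
  proof (rule Pi11_left_martingale[OF assms(3)])
    show "prod_encode (2 * (2 ^ e 0 * c), 1) = rat_code (of_nat (2 ^ e 0 * c))" for S :: senv and e :: nenv
      by (rule rat_code_of_nat[symmetric])
  qed (intro arI)+
  then have "uniformly_Pi11 W" 
    by (intro uniformly_Pi11I) (simp only: W_def mem_Collect_eq of_rat_of_nat_eq)
  moreover have "lam (\<Union>\<sigma>\<in>W n. cone \<sigma>) \<le> (1/2) ^ n" for n
  proof -
    have "lam (\<Union>\<sigma>\<in>W n. cone \<sigma>) \<le> M [] / real (2 ^ n * c)"
      unfolding W_def by (rule maximal_inequality[OF assms(2)]) (use c in simp)
    also have "\<dots> \<le> real c / real (2 ^ n * c)" using c by (intro divide_right_mono) auto
    also have "\<dots> = (1/2) ^ n" using c by (simp add: power_divide)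
    finally show ?thesis .
  qed
  ultimately obtain n where n: "Z \<notin> (\<Union>\<sigma>\<in>W n. cone \<sigma>)"
    using assms(1) unfolding Pi11_Martin_Loef_random_def by blast
  have "M (restr Z m) \<le> real (2 ^ n * c)" for m
  proof (rule ccontr)
    assume "\<not> M (restr Z m) \<le> real (2 ^ n * c)"
    then have "restr Z m \<in> W n" by (simp add: W_def)
    then show False using n mem_cone_restr[of Z m] by blast
  qed
  then show thesis using that[of "2 ^ n * c"] c(2) by simp
qed

text \<open>
  The paths on which \<open>M\<close> has not dropped to \<open>q\<close> within \<open>n\<close> steps or has exceeded \<open>B\<close> before.
\<close>

primrec not_low :: "(bool list \<Rightarrow> real) \<Rightarrow> real \<Rightarrow> real \<Rightarrow> nat \<Rightarrow> bool list \<Rightarrow> (nat \<Rightarrow> bool) set" where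
  "not_low M q B 0 \<sigma> = (if M \<sigma> \<le> q then {} else cone \<sigma>)"
| "not_low M q B (Suc n) \<sigma> = (if M \<sigma> \<le> q then {} else if B < M \<sigma> then cone \<sigma>
     else not_low M q B n (\<sigma> @ [False]) \<union> not_low M q B n (\<sigma> @ [True]))"

lemma not_low_sets [simp, intro]: "not_low M q B n \<sigma> \<in> sets cantor_measure"
  by (induction n arbitrary: \<sigma>) auto

lemma not_low_subset: "not_low M q B n \<sigma> \<subseteq> cone \<sigma>"
proof (induction n arbitrary: \<sigma>)
  case (Suc n)
  show ?case
    using Suc[of "\<sigma> @ [False]"] Suc[of "\<sigma> @ [True]"]
      cone_append_subset[of \<sigma> "[False]"] cone_append_subset[of \<sigma> "[True]"]
    by (simp only: not_low.simps split: if_split) blast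
qed simp

lemma not_low_antimono: "not_low M q B (Suc n) \<sigma> \<subseteq> not_low M q B n \<sigma>"
proof (induction n arbitrary: \<sigma>)
  case 0
  show ?case
  proof (cases "M \<sigma> \<le> q")
    case False
    then show ?thesis using not_low_subset[of M q B "Suc 0" \<sigma>] by (simp only: not_low.simps(1) if_False)
  qed simp
next
  case (Suc n)
  show ?case
    using Suc[of "\<sigma> @ [False]"] Suc[of "\<sigma> @ [True]"]
    unfolding not_low.simps(2)[of M q B "Suc n" \<sigma>] not_low.simps(2)[of M q B n \<sigma>] by auto
qed

lemma not_low_stays:
  assumes "X \<in> not_low M q B n \<sigma>" "\<And>m. M (restr X m) \<le> B"
  shows "q < M (restr X (length \<sigma> + n))"
  using assms(1)
proof (induction n arbitrary: \<sigma>)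
  case 0
  then show ?case by (auto simp: mem_cone_eq split: if_splits)
next
  case (Suc n)
  have "X \<in> cone \<sigma>" using not_low_subset[of M q B "Suc n" \<sigma>] Suc.prems by blast
  then have "M \<sigma> \<le> B" using assms(2)[of "length \<sigma>"] by (simp add: mem_cone_eq)
  then obtain b where "X \<in> not_low M q B n (\<sigma> @ [b])" using Suc.prems by (auto split: if_splits)
  from Suc.IH[OF this] show ?case by simp
qed

text \<open>Optional stopping when \<open>M\<close> drops to \<open>q\<close>, exceeds
  \<open>B\<close> or reaches the horizon. The stopped value is at most \<open>q\<close> in the
  first case and at most \<open>2 * B\<close> otherwise, because the preceding value was at most
  \<open>B\<close> and a step at most doubles it. The bound \<open>2 * B\<close> at the root is the
  invariant that the induction hands to the children.\<close>

lemma stopped_martingale_le: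
  assumes M: "is_martingale M" and B: "0 \<le> B" "0 \<le> q"
  shows "M \<sigma> \<le> 2 * B \<Longrightarrow> M \<sigma> / 2 ^ length \<sigma> \<le> q / 2 ^ length \<sigma> + 2 * B * lam (not_low M q B n \<sigma>)"
proof (induction n arbitrary: \<sigma>)
  case 0
  have "M \<sigma> / 2 ^ length \<sigma> \<le> 2 * B / 2 ^ length \<sigma>" by (rule divide_right_mono[OF 0]) simp
  moreover have "0 \<le> q / 2 ^ length \<sigma>" using B by simp
  ultimately show ?case by (auto simp: power_divide divide_right_mono)
next
  case (Suc n)
  consider "M \<sigma> \<le> q" | "q < M \<sigma>" "B < M \<sigma>" | "q < M \<sigma>" "M \<sigma> \<le> B" by linarith
  then show ?case
  proof cases
    case 1
    then show ?thesis by (simp add: divide_right_mono)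
  next
    case 2
    have "M \<sigma> / 2 ^ length \<sigma> \<le> 2 * B / 2 ^ length \<sigma>" by (rule divide_right_mono[OF Suc.prems]) simp
    moreover have "0 \<le> q / 2 ^ length \<sigma>" using B by simp
    ultimately show ?thesis using 2 by (simp add: power_divide)
  next
    case 3
    let ?l = "\<lambda>b. lam (not_low M q B n (\<sigma> @ [b]))"
    have child: "M (\<sigma> @ [b]) / 2 ^ length (\<sigma> @ [b]) \<le> q / 2 ^ length (\<sigma> @ [b]) + 2 * B * ?l b" for b
      by (rule Suc.IH) (use martingale_child_le[OF M, of \<sigma> b] 3 in linarith)
    have "not_low M q B n (\<sigma> @ [False]) \<inter> not_low M q B n (\<sigma> @ [True]) = {}"
      using not_low_subset[of M q B n "\<sigma> @ [False]"] not_low_subset[of M q B n "\<sigma> @ [True]"]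
        cone_disjoint[of "\<sigma> @ [False]" "\<sigma> @ [True]"] by auto
    then have "lam (not_low M q B n (\<sigma> @ [False]) \<union> not_low M q B n (\<sigma> @ [True])) = ?l False + ?l True"
      by (intro cantor.finite_measure_Union) auto
    moreover have "not_low M q B (Suc n) \<sigma> = not_low M q B n (\<sigma> @ [False]) \<union> not_low M q B n (\<sigma> @ [True])"
      using 3 by simp
    ultimately have l: "lam (not_low M q B (Suc n) \<sigma>) = ?l False + ?l True" by simp
    have "M \<sigma> / 2 ^ length \<sigma> = M (\<sigma> @ [False]) / 2 ^ length (\<sigma> @ [False]) + M (\<sigma> @ [True]) / 2 ^ length (\<sigma> @ [True])"
      by (subst martingale_split[OF M, of \<sigma>]) (simp add: field_simps)
    also have "\<dots> \<le> (q / 2 ^ length (\<sigma> @ [False]) + 2 * B * ?l False) + (q / 2 ^ length (\<sigma> @ [True]) + 2 * B * ?l True)"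
      by (rule add_mono[OF child child])
    also have "\<dots> = q / 2 ^ length \<sigma> + 2 * B * lam (not_low M q B (Suc n) \<sigma>)"
      unfolding l by (simp add: field_simps)
    finally show ?thesis .
  qed
qed

definition recurrently_low :: "(bool list \<Rightarrow> real) \<Rightarrow> real \<Rightarrow> real \<Rightarrow> (nat \<Rightarrow> bool) set" where
  "recurrently_low M q B = {X. (\<forall>m. M (restr X m) \<le> B) \<and> (\<forall>k. \<exists>m. k \<le> m \<and> M (restr X m) \<le> q)}"

lemma Sigma11_recurrently_low:
  assumes "left_Pi11 M" shows "Sigma11_class (recurrently_low M (of_rat q) (of_rat B))"
proof (rule Sigma11_classI)
  have "Pi11 (\<lambda>S e. of_rat r < M (restr (S 0) (e 0)))" for r
    by (rule Pi11_left_martingale[OF assms, where q = "\<lambda>S e. r" and r = "\<lambda>S e. rat_code r"]) (intro arI | simp)+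
  then have le: "Sigma11 (\<lambda>S e. M (restr (S 0) (e 0)) \<le> of_rat r)" for r
    unfolding Pi11_def by (simp add: not_less)
  have "Sigma11 (\<lambda>S e. (\<forall>m. M (restr (S 0) m) \<le> of_rat B) \<and> (\<forall>k. \<exists>m. k \<le> m \<and> M (restr (S 0) m) \<le> of_rat q))"
    by (intro Sigma11_conj Sigma11_all Sigma11_ex le Sigma11_arith[OF arith_le] arI)
  then show "Sigma11 (\<lambda>S e. S 0 \<in> recurrently_low M (of_rat q) (of_rat B))"
    by (simp add: recurrently_low_def)
qed

text \<open>A path in the class never exceeds \<open>B\<close> and drops to \<open>q\<close> at some
  stage after \<open>n\<close>, so it leaves \<open>not_low\<close> at a finite horizon. As the
  horizon grows, \<open>not_low\<close> thus shrinks to a part of the cone outside the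
  class.\<close>

lemma martingale_le_codensity:
  assumes M: "is_martingale M" and B: "0 \<le> B" "0 \<le> q" and le: "\<And>m. M (restr Z m) \<le> B"
    and sets: "recurrently_low M q B \<in> sets cantor_measure"
  shows "M (restr Z n) \<le> q + 2 * B * (1 - lam (recurrently_low M q B \<inter> cone (restr Z n)) * 2 ^ n)"
proof -
  let ?K = "recurrently_low M q B" and ?\<sigma> = "restr Z n"
  let ?N = "\<lambda>i. not_low M q B i ?\<sigma>"
  have lim: "(\<lambda>i. lam (?N i)) \<longlonglongrightarrow> lam (\<Inter>i. ?N i)"
    by (rule cantor.finite_Lim_measure_decseq) (auto intro!: decseq_SucI not_low_antimono)
  have "M ?\<sigma> / 2 ^ n \<le> q / 2 ^ n + 2 * B * lam (?N i)" for i
    using stopped_martingale_le[OF M B, of ?\<sigma> i] le[of n] B by simp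
  then have "M ?\<sigma> / 2 ^ n \<le> q / 2 ^ n + 2 * B * lam (\<Inter>i. ?N i)"
    by (intro LIMSEQ_le_const[OF tendsto_add[OF tendsto_const tendsto_mult_left[OF lim]]]) auto
  also have "lam (\<Inter>i. ?N i) \<le> lam (cone ?\<sigma> - (?K \<inter> cone ?\<sigma>))"
  proof (rule cantor.finite_measure_mono)
    show "(\<Inter>i. ?N i) \<subseteq> cone ?\<sigma> - (?K \<inter> cone ?\<sigma>)"
    proof
      fix X assume X: "X \<in> (\<Inter>i. ?N i)"
      then have XN: "X \<in> ?N i" for i by blast
      have "X \<notin> ?K"
      proof
        assume XK: "X \<in> ?K"
        then obtain m where m: "n \<le> m" "M (restr X m) \<le> q" unfolding recurrently_low_def by blast
        have "q < M (restr X (length ?\<sigma> + (m - n)))"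
          by (rule not_low_stays[OF XN]) (use XK in \<open>auto simp: recurrently_low_def\<close>)
        then show False using m by simp
      qed
      then show "X \<in> cone ?\<sigma> - (?K \<inter> cone ?\<sigma>)" using subsetD[OF not_low_subset XN[of 0]] by blast
    qed
    show "cone ?\<sigma> - (?K \<inter> cone ?\<sigma>) \<in> sets cantor_measure" using sets by auto
  qed
  also have "lam (cone ?\<sigma> - (?K \<inter> cone ?\<sigma>)) = lam (cone ?\<sigma>) - lam (?K \<inter> cone ?\<sigma>)"
    by (rule cantor.finite_measure_Diff) (use sets in auto)
  finally have "M ?\<sigma> / 2 ^ n \<le> q / 2 ^ n + 2 * B * (1 / 2 ^ n - lam (?K \<inter> cone ?\<sigma>))"
    using B by (simp add: power_divide mult_left_mono)
  then have "M ?\<sigma> / 2 ^ n * 2 ^ n \<le> (q / 2 ^ n + 2 * B * (1 / 2 ^ n - lam (?K \<inter> cone ?\<sigma>))) * 2 ^ n"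
    by (rule mult_right_mono) simp
  moreover have "(q / h + 2 * B * (1 / h - x)) * h = q + 2 * B * (1 - x * h)" if "h \<noteq> 0" for h x
    using that by (simp add: field_simps)
  ultimately show ?thesis by simp
qed

lemma martingale_converges_if_density_one:
  assumes random: "Pi11_Martin_Loef_random Z" and M: "is_martingale M" "left_Pi11 M"
    and density: "\<And>C. Sigma11_class C \<Longrightarrow> Z \<in> C \<Longrightarrow> lower_density C Z = 1"
  shows "convergent (\<lambda>n. M (restr Z n))"
proof -
  let ?x = "\<lambda>n. M (restr Z n)"
  obtain B :: nat where B: "0 < B" "\<And>m. ?x m \<le> B" using random_martingale_bounded[OF random M] by blast
  have x0: "0 \<le> ?x n" for n by (rule martingale_nonneg[OF M(1)])
  \<comment> \<open>This bounds the upper limit of \<open>M\<close> along \<open>Z\<close> by every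
    \<open>q\<close> to which \<open>M\<close> falls infinitely often. Such \<open>q\<close> are
    taken rational because the class must be definable without parameters. Every rational above the
    lower limit qualifies, so upper and lower limit coincide.\<close>
  have key: "eventually (\<lambda>n. ?x n < of_rat q + \<epsilon>) sequentially"
    if freq: "\<And>k. \<exists>m\<ge>k. ?x m \<le> of_rat q" and \<epsilon>: "0 < \<epsilon>" for q \<epsilon>
  proof -
    let ?K = "recurrently_low M (of_rat q) (of_rat (of_nat B))"
    have q0: "0 \<le> (of_rat q :: real)" using freq[of 0] x0 order_trans by blast
    have K: "Sigma11_class ?K" by (rule Sigma11_recurrently_low[OF M(2)])
    have sets: "?K \<in> sets cantor_measure" using Sigma11_classD[OF K] Sigma11_matrix.C_sets by blast
    have "Z \<in> ?K" using freq B(2) by (auto simp: recurrently_low_def)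
    then have "lower_density ?K Z = 1" by (rule density[OF K])
    then have "eventually (\<lambda>n. 1 - \<epsilon> / (2 * B) < lam (?K \<inter> cone (restr Z n)) * 2 ^ n) sequentially"
      unfolding lower_density_eq_1_iff using \<epsilon> B(1) by simp
    then show ?thesis
    proof (rule eventually_mono)
      fix n assume n: "1 - \<epsilon> / (2 * B) < lam (?K \<inter> cone (restr Z n)) * 2 ^ n"
      have "?x n \<le> of_rat q + 2 * real B * (1 - lam (?K \<inter> cone (restr Z n)) * 2 ^ n)"
        using martingale_le_codensity[OF M(1) _ q0, of "of_rat (of_nat B)" Z n] B(2) sets by simp
      also have "\<dots> < of_rat q + 2 * real B * (\<epsilon> / (2 * B))"
        using n B(1) by (intro add_strict_left_mono mult_strict_left_mono) auto
      also have "\<dots> = of_rat q + \<epsilon>" using B(1) by simp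
      finally show "?x n < of_rat q + \<epsilon>" .
    qed
  qed
  define L where "L = liminf (\<lambda>n. ereal (?x n))"
  have "0 \<le> L" unfolding L_def by (rule Liminf_bounded) (simp add: x0)
  moreover have "L \<le> ereal B"
    unfolding L_def using Liminf_le_Limsup[of sequentially "\<lambda>n. ereal (?x n)"]
      Limsup_bounded[of "\<lambda>n. ereal (?x n)" "ereal B" sequentially] B(2)
    by (auto intro: order_trans)
  ultimately obtain l where l: "L = ereal l" by (cases L) auto
  have "?x \<longlonglongrightarrow> l"
  proof (rule order_tendstoI)
    fix a assume "a < l"
    then have "ereal a < liminf (\<lambda>n. ereal (?x n))" using l L_def by simp
    from less_LiminfD[OF this] show "eventually (\<lambda>n. a < ?x n) sequentially" by simp
  next
    fix a assume "l < a"
    then obtain q where q: "l < of_rat q" "of_rat q < a" using of_rat_dense by blast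
    have "\<exists>m\<ge>k. ?x m \<le> of_rat q" for k
    proof (rule ccontr)
      assume "\<not> (\<exists>m\<ge>k. ?x m \<le> of_rat q)"
      then have "eventually (\<lambda>m. ereal (of_rat q) \<le> ereal (?x m)) sequentially"
        unfolding eventually_sequentially by (intro exI[of _ k]) auto
      then have "ereal (of_rat q) \<le> L" unfolding L_def by (rule Liminf_bounded)
      then show False using q(1) l by simp
    qed
    from key[OF this, of "a - of_rat q"] q(2) show "eventually (\<lambda>n. ?x n < a) sequentially" by simp
  qed
  then show ?thesis by (rule convergentI)
qed

theorem theorem14p2:
  fixes Z :: "nat \<Rightarrow> bool"
  assumes "Pi11_Martin_Loef_random Z"
  shows "((\<forall>C. Sigma11_class C \<and> Z \<in> C \<longrightarrow> lower_density C Z = 1)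
           \<longleftrightarrow> (\<forall>C. closed C \<and> Sigma11_class C \<and> Z \<in> C \<longrightarrow> lower_density C Z = 1))
       \<and> ((\<forall>C. closed C \<and> Sigma11_class C \<and> Z \<in> C \<longrightarrow> lower_density C Z = 1)
           \<longleftrightarrow> (\<forall>M. is_martingale M \<and> left_Pi11 M \<longrightarrow> convergent (\<lambda>n. M (restr Z n))))"
    (is "(?i \<longleftrightarrow> ?ii) \<and> (_ \<longleftrightarrow> ?iii)")
proof -
  have "?i" if ?ii
  proof (intro allI impI)
    fix C assume C: "Sigma11_class C \<and> Z \<in> C"
    then obtain Q where "Sigma11_matrix Q C" using Sigma11_classD by blast
    from Sigma11_matrix.density_one_if_closed_density_one[OF this assms] C that
    show "lower_density C Z = 1" by blast
  qed
  moreover have "?iii" if ?i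
    using martingale_converges_if_density_one[OF assms] that by blast
  moreover have "?i" if ?iii
  proof (intro allI impI)
    fix C assume C: "Sigma11_class C \<and> Z \<in> C"
    then obtain Q where Q: "Sigma11_matrix Q C" using Sigma11_classD by blast
    show "lower_density C Z = 1"
      by (rule Sigma11_matrix.density_one_if_codensity_converges[OF Q assms])
        (use C that Sigma11_matrix.is_martingale_codensity[OF Q] Sigma11_matrix.left_Pi11_codensity[OF Q] in auto)
  qed
  moreover have "?ii" if ?i using that by blast
  ultimately show ?thesis by argo
qed

end
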